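(* Let $\mathbb{k}$ be a field, $T=\mathbb{k}[s,t,u]$ (standard grading), $m\ge2$, and $J=(f_1,\dots,f_m)\subset T$ an ideal generated by homogeneous polynomials with $\gcd(f_1,\dots,f_m)=1$ and $\deg(f_i)\le d$ for all $i$. Then: (i) $\operatorname{reg}(J)\le 3d-2$; (ii) $\beta_1(J)\le\beta_2(J)+m-1$; (iii) $\beta_2(J)\le H_J(\operatorname{reg}(J))\le H_J(3d-2)\le\binom{3d}{2}$; moreover, if $\deg(f_1)=\cdots=\deg(f_m)=d$, then $\beta_2(J)\le m\binom{2d}{2}$.
   Context: $\operatorname{reg}$ is Castelnuovo–Mumford regularity. $\beta_i(J)=\dim_{\mathbb{k}}\operatorname{Tor}_i^T(J,\mathbb{k})$ are the Betti numbers of $J$ (so $\beta_0$ is the number of minimal generators of $J$). $H_J(k)=\dim_{\mathbb{k}}J_k$ is the Hilbert function of $J$.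
   Formalization: The formal theorem assumes d ≥ 1; for d = 0 all generators are constants, J = T and reg(J) = 0, so the bound reg(J) ≤ 3d−2 = −2 fails. *)

theory Defs
  imports Complex_Main "HOL-Library.Poly_Mapping" "HOL-Library.Function_Algebras"
begin

datatype var = S | Tv | U

fun var_idx :: "var \<Rightarrow> nat" where
  "var_idx S = 0" | "var_idx Tv = 1" | "var_idx U = 2"

text \<open>Polynomials in k[s,t,u]: finitely supported maps from monomials
  (exponent vectors var \<Rightarrow>0 nat) to coefficients in the field k.
  The ring structure (convolution product) is the library's comm_ring_1 instance.\<close>
type_synonym 'a poly3 = "(var \<Rightarrow>\<^sub>0 nat) \<Rightarrow>\<^sub>0 'a"

definition mon_deg :: "(var \<Rightarrow>\<^sub>0 nat) \<Rightarrow> nat" where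
  "mon_deg \<mu> = Poly_Mapping.lookup \<mu> S + Poly_Mapping.lookup \<mu> Tv + Poly_Mapping.lookup \<mu> U"

definition homogeneous :: "nat \<Rightarrow> 'a::zero poly3 \<Rightarrow> bool" where
  "homogeneous n p \<longleftrightarrow> (\<forall>\<mu> \<in> Poly_Mapping.keys p. mon_deg \<mu> = n)"

definition var_poly :: "var \<Rightarrow> 'a::{zero,one} poly3" where
  "var_poly x = Poly_Mapping.single (Poly_Mapping.single x 1) 1"

definition pscale :: "'a::field \<Rightarrow> 'a poly3 \<Rightarrow> 'a poly3" where
  "pscale c p = Poly_Mapping.map (\<lambda>x. c * x) p"

definition gen_ideal :: "nat \<Rightarrow> (nat \<Rightarrow> 'a::field poly3) \<Rightarrow> 'a poly3 set" where
  "gen_ideal m f = {(\<Sum>i<m. g i * f i) | g. True}"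

definition ideal_piece :: "nat \<Rightarrow> (nat \<Rightarrow> 'a::field poly3) \<Rightarrow> nat \<Rightarrow> 'a poly3 set" where
  "ideal_piece m f n = {p \<in> gen_ideal m f. homogeneous n p}"

definition hilb :: "nat \<Rightarrow> (nat \<Rightarrow> 'a::field poly3) \<Rightarrow> nat \<Rightarrow> nat" where
  "hilb m f n = Vector_Spaces.vector_space.dim pscale (ideal_piece m f n)"

section \<open>Tor_i^T(J,k) via the Koszul resolution K(s,t,u) of k\<close>

text \<open>A chain of J \<otimes>_T K_i is a map from i-element subsets A of {s,t,u}
  (basis e_A of the exterior power) to polynomials.\<close>
type_synonym 'a chain = "var set \<Rightarrow> 'a poly3"

definition cscale :: "'a::field \<Rightarrow> 'a chain \<Rightarrow> 'a chain" where
  "cscale c x = (\<lambda>A. pscale c (x A))"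

text \<open>Degree-j part of J \<otimes> K_i: K_i is free on e_A (card A = i) in degree i,
  so the coefficient of e_A lies in J_{j-i} (zero if j < i).\<close>
definition chain_piece :: "nat \<Rightarrow> (nat \<Rightarrow> 'a::field poly3) \<Rightarrow> nat \<Rightarrow> nat \<Rightarrow> 'a chain set" where
  "chain_piece m f i j = {x. \<forall>A. (card A = i \<and> i \<le> j \<longrightarrow> x A \<in> ideal_piece m f (j - i))
                              \<and> (\<not> (card A = i \<and> i \<le> j) \<longrightarrow> x A = 0)}"

text \<open>Koszul differential: d(p e_A) = \<Sum>_{a\<in>A} (-1)^{#{b\<in>A. b<a}} x_a p e_{A-{a}}.\<close>
definition koszul_d :: "'a::field chain \<Rightarrow> 'a chain" where
  "koszul_d x = (\<lambda>B. \<Sum>a \<in> UNIV - B.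
      (if even (card {b \<in> B. var_idx b < var_idx a}) then 1 else -1) * var_poly a * x (insert a B))"

text \<open>Graded Betti number beta_{i,j}(J) = dim_k Tor_i^T(J,k)_j.\<close>
definition betti_graded :: "nat \<Rightarrow> (nat \<Rightarrow> 'a::field poly3) \<Rightarrow> nat \<Rightarrow> nat \<Rightarrow> nat" where
  "betti_graded m f i j =
     Vector_Spaces.vector_space.dim cscale {x \<in> chain_piece m f i j. koszul_d x = (\<lambda>_. 0)}
     - Vector_Spaces.vector_space.dim cscale (koszul_d ` chain_piece m f (Suc i) j)"

text \<open>Total Betti number beta_i(J) = dim_k Tor_i^T(J,k) (sum over the finitely many nonzero degrees).\<close>
definition betti :: "nat \<Rightarrow> (nat \<Rightarrow> 'a::field poly3) \<Rightarrow> nat \<Rightarrow> nat" where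
  "betti m f i = (\<Sum>j \<in> {j. betti_graded m f i j \<noteq> 0}. betti_graded m f i j)"

definition cm_reg :: "nat \<Rightarrow> (nat \<Rightarrow> 'a::field poly3) \<Rightarrow> nat" where
  "cm_reg m f = Max {j - i | i j. i \<le> j \<and> betti_graded m f i j \<noteq> 0}"

end

theory Submission
  imports Defs "HOL-Computational_Algebra.Computational_Algebra"
begin

text \<open>
  Work over an infinite extension \<open>K\<close> of the ground field and write \<open>J\<close> for the extended ideal. By Gauss' lemma
  a family without common factor has nonzero forms free of \<open>u\<close> and free of \<open>s\<close> in its ideal; this persists
  over \<open>K\<close>, and hence there are a linear form \<open>x = u - \<alpha>s - \<beta>t\<close> and forms \<open>F, G\<close> of degree \<open>d\<close> in \<open>J\<close> whose
  restrictions to the line \<open>x = 0\<close> are coprime. Then \<open>x\<close> is a nonzerodivisor modulo \<open>(F, G)\<close> and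
  \<open>(F, G, x)\<close> contains all forms of degree at least \<open>2d - 1\<close>. As \<open>J\<close> is generated in degrees at most \<open>d\<close>, multiplication
  by \<open>x\<close> on \<open>T/J\<close> is injective in degrees at least \<open>3d - 2\<close> and surjective in degrees at least \<open>2d - 2\<close>. This
  kills \<open>Hom(k, T/J)\<close> in degrees \<open>\<ge> 3d - 2\<close> and \<open>Ext\<^sup>1(k, T/J)\<close> in degrees \<open>\<ge> 3d - 3\<close>, which are
  \<open>Tor\<^sub>2(J, k)\<close> and \<open>Tor\<^sub>1(J, k)\<close> up to a shift. A \<open>k\<close>-linear retraction \<open>K \<rightarrow> k\<close>
  brings the statement back to \<open>k\<close>.

  A Koszul 2-cycle is determined by one of its coefficients, so \<open>\<beta>\<^bsub>2,j\<^esub> \<le> H\<^sub>J(j - 2) - H\<^sub>J(j - 3)\<close>, and these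
  bounds telescope to \<open>\<beta>\<^sub>2 \<le> H\<^sub>J(reg J)\<close>. Finally \<open>\<beta>\<^sub>0 - \<beta>\<^sub>1 + \<beta>\<^sub>2\<close> bounds the second difference
  of \<open>H\<^sub>J\<close> in all large degrees; since \<open>H\<^sub>J\<close> grows quadratically, it is at least 1.
\<close>

text \<open>The zero set of \<open>J\<close> is finite, and the line \<open>x = 0\<close> has to
  miss it. Over a finite field there may be no such line, so \<open>K\<close> is taken to be the
  rational function field \<open>k(X)\<close>; being a fraction field, it also carries the gcd
  structure required of the coefficients. Restriction to the line is computed in the affine chart t
  = 1, where coprimality is a Bezout identity in \<open>K[s]\<close>. The chart omits the point t =
  0 of the line; a common zero there is excluded by requiring the restriction of \<open>F\<close> to
  have degree exactly d. Accordingly \<alpha> is chosen first, so that a generator not divisible by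
  t is nonzero at (1:0:\<alpha>), and then \<beta>, which shifts the roots of the form in t, u away
  from the roots of the form in s, t. The constant 3d - 2 is (2d - 2) + d:
  \<open>T/(F, G, x)\<close> vanishes above degree 2d - 2, and the coefficient of a generator lies
  at most d below the degree of the element that it helps to represent.\<close>

definition fin_dim :: "('a::field \<Rightarrow> 'b::ab_group_add \<Rightarrow> 'b) \<Rightarrow> 'b set \<Rightarrow> bool" where
  "fin_dim scale V \<longleftrightarrow> (\<exists>W. finite W \<and> V \<subseteq> module.span scale W)"

section \<open>Finite-dimensional subspaces and rank-nullity\<close>

context vector_space
begin

lemma fin_dim_subset: "V \<subseteq> W \<Longrightarrow> fin_dim scale W \<Longrightarrow> fin_dim scale V"
  unfolding fin_dim_def by blast

lemma fin_dim_basis: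
  assumes "fin_dim scale V"
  obtains B where "finite B" "B \<subseteq> V" "independent B" "V \<subseteq> span B" "card B = dim V"
proof -
  obtain W where W: "finite W" "V \<subseteq> span W" using assms unfolding fin_dim_def by blast
  obtain B where B: "B \<subseteq> V" "independent B" "V \<subseteq> span B" "card B = dim V"
    by (rule basis_exists)
  have "finite B" using independent_span_bound[OF W(1) B(2)] B(1) W(2) by blast
  then show ?thesis using B that by blast
qed

lemma independent_card_le_dim_fin:
  assumes "fin_dim scale V" "B \<subseteq> V" "independent B"
  shows "finite B \<and> card B \<le> dim V"
proof -
  obtain C where C: "finite C" "V \<subseteq> span C" "card C = dim V"
    using fin_dim_basis[OF assms(1)] by metis
  show ?thesis using independent_span_bound[OF C(1) assms(3)] assms(2) C by auto
qed

text \<open>\<open>dim\<close> is a cardinality and hence 0 for a space with an infinite basis. The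
  spaces of all polynomials and chains are infinite-dimensional, so finite dimension of the larger
  subspace has to be assumed.\<close>

lemma dim_mono_fin:
  assumes "V \<subseteq> W" "fin_dim scale W"
  shows "dim V \<le> dim W"
proof -
  obtain B where B: "B \<subseteq> V" "independent B" "card B = dim V"
    using basis_exists by metis
  show ?thesis using independent_card_le_dim_fin[OF assms(2), of B] B assms(1) by auto
qed

lemma dim_zero_singleton: "dim {0} = 0"
  using dim_le_card[of "{0}" "{}"] by simp

end

context vector_space_pair
begin

lemma fin_dim_image:
  assumes "Vector_Spaces.linear s1 s2 f" "fin_dim s1 V"
  shows "fin_dim s2 (f ` V)"
proof -
  obtain W where W: "finite W" "V \<subseteq> vs1.span W" using assms(2) unfolding fin_dim_def by blast
  have "f ` V \<subseteq> vs2.span (f ` W)"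
    using W(2) linear_span_image[OF assms(1), of W] by blast
  then show ?thesis unfolding fin_dim_def using W(1) by blast
qed

lemma rank_nullity:
  assumes f: "Vector_Spaces.linear s1 s2 f" and V: "vs1.subspace V" and fd: "fin_dim s1 V"
  shows "vs1.dim V = vs1.dim {x \<in> V. f x = 0} + vs2.dim (f ` V)"
proof -
  let ?Z = "{x \<in> V. f x = 0}"
  obtain B0 where B0: "finite B0" "B0 \<subseteq> ?Z" "vs1.independent B0" "?Z \<subseteq> vs1.span B0" "card B0 = vs1.dim ?Z"
    using vs1.fin_dim_basis[OF vs1.fin_dim_subset[OF _ fd, of ?Z]] by blast
  obtain B where B: "B0 \<subseteq> B" "B \<subseteq> V" "vs1.independent B" "V \<subseteq> vs1.span B"
    using vs1.maximal_independent_subset_extend[of B0 V] B0 by blast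
  have finB: "finite B" using vs1.independent_card_le_dim_fin[OF fd B(2,3)] by simp
  define C where "C = B - B0"
  have indC: "vs1.independent C" using B(3) unfolding C_def by (metis Diff_subset vs1.independent_mono)
  have CV: "vs1.span C \<subseteq> V" using B(2) V unfolding C_def by (meson Diff_subset order_trans vs1.span_minimal)
  have inj: "inj_on f (vs1.span C)"
  proof (subst linear_inj_on_iff_eq_0[OF f vs1.subspace_span], intro ballI impI)
    fix x assume x: "x \<in> vs1.span C" "f x = 0"
    then have "x \<in> vs1.span B0" using CV B0(4) by blast
    \<comment> \<open>In the basis \<open>B\<close> the vector \<open>x\<close> has one expansion
      supported in \<open>B0\<close> and one supported in the disjoint set \<open>C\<close>; as
      expansions are unique, both vanish.\<close>
    then have "vs1.representation B0 x = vs1.representation B x"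
      using vs1.representation_extend[OF B(3) _ B(1)] by simp
    moreover have "vs1.representation C x = vs1.representation B x"
      using vs1.representation_extend[OF B(3) x(1)] unfolding C_def by simp
    ultimately have "vs1.representation C x b = 0" for b
      using vs1.representation_ne_zero[of C x b] vs1.representation_ne_zero[of B0 x b]
      unfolding C_def by auto
    then show "x = 0"
      using vs1.sum_nonzero_representation_eq[OF indC x(1)] by simp
  qed
  have indfC: "vs2.independent (f ` C)"
    using linear_independent_injective_image[OF f indC inj] .
  have "f ` V \<subseteq> vs2.span (f ` C)"
  proof
    fix y assume "y \<in> f ` V"
    then obtain x where x: "x \<in> V" "y = f x" by blast
    then have "y \<in> vs2.span (f ` B)" using B(4) linear_span_image[OF f, of B] by blast
    moreover have "f ` B \<subseteq> insert 0 (f ` C)" using B0(2) unfolding C_def by auto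
    ultimately show "y \<in> vs2.span (f ` C)" using vs2.span_mono vs2.span_insert_0 by blast
  qed
  moreover have "f ` C \<subseteq> f ` V" using B(2) unfolding C_def by blast
  ultimately have "vs2.dim (f ` V) = card (f ` C)" using indfC vs2.dim_unique by blast
  also have "\<dots> = card C" by (meson card_image inj inj_on_subset vs1.span_superset)
  finally have 1: "vs2.dim (f ` V) = card C" .
  have "card B = vs1.dim V" using vs1.basis_card_eq_dim[OF B(2,4,3)] .
  moreover have "card B = card B0 + card C" unfolding C_def
    using B(1) finB by (simp add: card_Diff_subset card_mono B0(1))
  ultimately show ?thesis using 1 B0(5) by simp
qed

lemma dim_image_inj:
  assumes f: "Vector_Spaces.linear s1 s2 f" and V: "vs1.subspace V" and fd: "fin_dim s1 V"
    and inj: "\<And>x. x \<in> V \<Longrightarrow> f x = 0 \<Longrightarrow> x = 0"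
  shows "vs2.dim (f ` V) = vs1.dim V"
proof -
  have "{x \<in> V. f x = 0} = {0}" using inj V linear_0[OF f] vs1.subspace_0 by auto
  then show ?thesis using rank_nullity[OF f V fd] vs1.dim_zero_singleton by simp
qed

lemma dim_le_of_inj:
  assumes f: "Vector_Spaces.linear s1 s2 f" and V: "vs1.subspace V" and fd: "fin_dim s1 V"
    and inj: "\<And>x. x \<in> V \<Longrightarrow> f x = 0 \<Longrightarrow> x = 0"
    and "f ` V \<subseteq> W" "fin_dim s2 W"
  shows "vs1.dim V \<le> vs2.dim W"
  using dim_image_inj[OF f V fd inj] vs2.dim_mono_fin[OF assms(5,6)] by simp

end


lemma vector_space_pointwise:
  assumes "vector_space scale"
  shows "vector_space (\<lambda>c x i. scale c (x i))"
proof -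
  interpret vector_space scale by fact
  show ?thesis
    by standard (simp_all add: fun_eq_iff scale_right_distrib scale_left_distrib)
qed

text \<open>Made for the chains of the Koszul complex, which are families of ideal elements indexed
  by subsets of the variables. Evaluation at a new index has kernel \<open>W I\<close> and image
  \<open>V\<close>, so each index adds one copy of \<open>V\<close>.\<close>

lemma dim_functions:
  fixes scale :: "'a::field \<Rightarrow> 'b::ab_group_add \<Rightarrow> 'b" and I :: "'i set"
  assumes vs: "vector_space scale" and V: "module.subspace scale V" and fd: "fin_dim scale V"
    and I: "finite I"
  defines "fscale \<equiv> (\<lambda>c x i. scale c (x i)) :: 'a \<Rightarrow> ('i \<Rightarrow> 'b) \<Rightarrow> 'i \<Rightarrow> 'b"
    and "W \<equiv> (\<lambda>I. {x. \<forall>i. (i \<in> I \<longrightarrow> x i \<in> V) \<and> (i \<notin> I \<longrightarrow> x i = 0)})"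
  shows "module.subspace fscale (W I) \<and> fin_dim fscale (W I) \<and>
         vector_space.dim fscale (W I) = card I * vector_space.dim scale V"
proof -
  interpret fw: vector_space_pair fscale scale
    using vs vector_space_pointwise[OF vs] unfolding vector_space_pair_def fscale_def by blast
  interpret bw: vector_space_pair scale fscale
    using vs vector_space_pointwise[OF vs] unfolding vector_space_pair_def fscale_def by blast
  have sub: "fw.vs1.subspace (W I)" for I
    unfolding W_def fscale_def
    using V by (auto intro!: fw.vs1.subspaceI[unfolded fscale_def]
        simp: fw.vs2.subspace_0 fw.vs2.subspace_add fw.vs2.subspace_scale)
  show ?thesis using I
  proof (induction I rule: finite_induct)
    case empty
    have "W {} = {0}" unfolding W_def by auto
    then show ?case using sub[of "{}"] fw.vs1.dim_zero_singleton
      unfolding fin_dim_def by (auto intro!: exI[of _ "{}"])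
  next
    case (insert a I)
    let ?ev = "\<lambda>x :: 'i \<Rightarrow> 'b. x a" and ?dl = "\<lambda>b i. if i = a then b else (0 :: 'b)"
    have ev: "Vector_Spaces.linear fscale scale ?ev"
      by (subst Vector_Spaces.linear_iff) (use fw.vector_space_pair_axioms in \<open>auto simp: vector_space_pair_def fscale_def\<close>)
    have dl: "Vector_Spaces.linear scale fscale ?dl"
      by (subst Vector_Spaces.linear_iff) (use bw.vector_space_pair_axioms in
          \<open>auto simp: vector_space_pair_def fscale_def fun_eq_iff\<close>)
    obtain S1 where S1: "finite S1" "W I \<subseteq> fw.vs1.span S1" using insert unfolding fin_dim_def by blast
    obtain S2 where S2: "finite S2" "?dl ` V \<subseteq> fw.vs1.span S2"
      using bw.fin_dim_image[OF dl fd] unfolding fin_dim_def by blast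
    have "W (insert a I) \<subseteq> fw.vs1.span (S1 \<union> S2)"
    proof
      fix x assume x: "x \<in> W (insert a I)"
      have "x(a := 0) \<in> W I" using x insert(2) unfolding W_def by auto
      then have "x(a := 0) \<in> fw.vs1.span (S1 \<union> S2)" using S1 fw.vs1.span_mono[of S1 "S1 \<union> S2"] by blast
      moreover have "?dl (x a) \<in> fw.vs1.span (S1 \<union> S2)"
        using x S2 fw.vs1.span_mono[of S2 "S1 \<union> S2"] unfolding W_def by blast
      ultimately have "x(a := 0) + ?dl (x a) \<in> fw.vs1.span (S1 \<union> S2)" by (rule fw.vs1.span_add)
      moreover have "x(a := 0) + ?dl (x a) = x" by (auto simp: fun_eq_iff)
      ultimately show "x \<in> fw.vs1.span (S1 \<union> S2)" by simp
    qed
    then have fdW: "fin_dim fscale (W (insert a I))" unfolding fin_dim_def using S1(1) S2(1) by blast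
    have "{x \<in> W (insert a I). ?ev x = 0} = W I"
      using insert(2) V unfolding W_def by (auto simp: fw.vs2.subspace_0)
    moreover have "?ev ` W (insert a I) = V"
    proof
      show "V \<subseteq> ?ev ` W (insert a I)"
      proof
        fix v assume "v \<in> V"
        then have "?dl v \<in> W (insert a I)" using V unfolding W_def by (auto simp: fw.vs2.subspace_0)
        then show "v \<in> ?ev ` W (insert a I)" by (rule rev_image_eqI) simp
      qed
    qed (auto simp: W_def)
    ultimately have "fw.vs1.dim (W (insert a I)) = fw.vs1.dim (W I) + fw.vs2.dim V"
      using fw.rank_nullity[OF ev sub fdW] by simp
    then show ?case using insert sub fdW by simp
  qed
qed

text \<open>Gauss' lemma is available in the library only over rings with a gcd structure. Fraction fields are given the
  trivial one here; the copy \<open>'a fract\<close> of a field \<open>'a\<close> can then serve as coefficient field.\<close>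

instantiation fract :: (idom) "{unique_euclidean_ring, normalization_euclidean_semiring, normalization_semidom_multiplicative}"
begin

definition [simp]: "normalize_fract = (\<lambda>x :: 'a fract. if x = 0 then 0 else 1 :: 'a fract)"
definition [simp]: "unit_factor_fract = (\<lambda>x :: 'a fract. x)"
definition [simp]: "modulo_fract = (\<lambda>(x :: 'a fract) (y :: 'a fract). if y = 0 then x else 0)"
definition [simp]: "euclidean_size_fract = (\<lambda>x :: 'a fract. if x = 0 then 0 else 1 :: nat)"
definition [simp]: "division_segment (x :: 'a fract) = 1"

instance
  by standard
    (simp_all add: dvd_field_iff field_split_simps split: if_splits)

end

instantiation fract :: (idom) euclidean_ring_gcd
begin

definition gcd_fract :: "'a fract \<Rightarrow> 'a fract \<Rightarrow> 'a fract" where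
  "gcd_fract = Euclidean_Algorithm.gcd"
definition lcm_fract :: "'a fract \<Rightarrow> 'a fract \<Rightarrow> 'a fract" where
  "lcm_fract = Euclidean_Algorithm.lcm"
definition Gcd_fract :: "'a fract set \<Rightarrow> 'a fract" where
 "Gcd_fract = Euclidean_Algorithm.Gcd"
definition Lcm_fract :: "'a fract set \<Rightarrow> 'a fract" where
 "Lcm_fract = Euclidean_Algorithm.Lcm"

instance by standard (simp_all add: gcd_fract_def lcm_fract_def Gcd_fract_def Lcm_fract_def)

end

instance fract :: (idom) field_gcd ..

text \<open>The instance of \<open>idom\<close> for \<^typ>\<open>'a poly3\<close> requires linearly ordered exponent vectors.\<close>

instantiation var :: linorder
begin

definition less_eq_var :: "var \<Rightarrow> var \<Rightarrow> bool" where
  "x \<le> y \<longleftrightarrow> var_idx x \<le> var_idx y"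

definition less_var :: "var \<Rightarrow> var \<Rightarrow> bool" where
  "x < y \<longleftrightarrow> var_idx x < var_idx y"

instance
proof
  fix x y :: var
  show "x \<le> y \<Longrightarrow> y \<le> x \<Longrightarrow> x = y"
    by (cases x; cases y) (auto simp: less_eq_var_def)
qed (auto simp: less_eq_var_def less_var_def)

end

section \<open>Polynomials as sums of terms\<close>

lemma UNIV_var: "(UNIV :: var set) = {S, Tv, U}"
  using var.exhaust by auto

lemma poly_mapping_sum_single:
  fixes p :: "'a \<Rightarrow>\<^sub>0 'b::comm_monoid_add"
  shows "(\<Sum>\<mu>\<in>Poly_Mapping.keys p. Poly_Mapping.single \<mu> (Poly_Mapping.lookup p \<mu>)) = p"
  by (rule poly_mapping_eqI)
     (auto simp: lookup_sum lookup_single when_def in_keys_iff sum.delta[OF finite_keys])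

lemma poly_mapping_single_induct [case_names zero single add]:
  fixes P :: "('a \<Rightarrow>\<^sub>0 'b::comm_monoid_add) \<Rightarrow> bool"
  assumes "P 0" "\<And>\<mu> a. P (Poly_Mapping.single \<mu> a)" "\<And>p q. P p \<Longrightarrow> P q \<Longrightarrow> P (p + q)"
  shows "P p"
proof -
  have "P (\<Sum>\<mu>\<in>A. Poly_Mapping.single \<mu> (Poly_Mapping.lookup p \<mu>))" if "finite A" for A
    using that by (induction A rule: finite_induct) (auto intro: assms)
  from this[of "Poly_Mapping.keys p"] show ?thesis by (simp add: poly_mapping_sum_single)
qed

subsection \<open>Evaluation homomorphisms\<close>

definition ring_map :: "('a::comm_ring_1 \<Rightarrow> 'b::comm_ring_1) \<Rightarrow> bool" where
  "ring_map h \<longleftrightarrow> h 1 = 1 \<and> (\<forall>a b. h (a + b) = h a + h b \<and> h (a * b) = h a * h b)"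

lemma ring_mapD:
  assumes "ring_map h"
  shows "h 0 = 0" "h 1 = 1" "h (a + b) = h a + h b" "h (a * b) = h a * h b" "h (- a) = - h a" "h (a - b) = h a - h b"
    "h (a ^ n) = h a ^ n" "h (sum g A) = (\<Sum>i\<in>A. h (g i))"
proof -
  show 1: "h 1 = 1" "\<And>a b. h (a + b) = h a + h b" "\<And>a b. h (a * b) = h a * h b"
    using assms unfolding ring_map_def by auto
  show 0: "h 0 = 0" using 1(2)[of 0 0] by simp
  show 2: "\<And>a. h (- a) = - h a" using 1(2) 0 by (metis add.right_inverse add_eq_0_iff)
  show "h (a - b) = h a - h b" using 1(2)[of a "- b"] 2 by simp
  show "h (a ^ n) = h a ^ n" by (induction n) (auto simp: 1)
  show "h (sum g A) = (\<Sum>i\<in>A. h (g i))" by (induction A rule: infinite_finite_induct) (auto simp: 0 1)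
qed

lemma ring_map_dvd: "ring_map h \<Longrightarrow> p dvd q \<Longrightarrow> h p dvd h q"
  by (auto simp: ring_mapD elim!: dvdE)

definition mon_eval :: "(var \<Rightarrow> 'r::comm_ring_1) \<Rightarrow> (var \<Rightarrow>\<^sub>0 nat) \<Rightarrow> 'r" where
  "mon_eval v \<mu> = v S ^ Poly_Mapping.lookup \<mu> S * v Tv ^ Poly_Mapping.lookup \<mu> Tv * v U ^ Poly_Mapping.lookup \<mu> U"

definition poly3_eval :: "('a::comm_ring_1 \<Rightarrow> 'r::comm_ring_1) \<Rightarrow> (var \<Rightarrow> 'r) \<Rightarrow> 'a poly3 \<Rightarrow> 'r" where
  "poly3_eval h v p = (\<Sum>\<mu>\<in>Poly_Mapping.keys p. h (Poly_Mapping.lookup p \<mu>) * mon_eval v \<mu>)"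

lemma mon_eval_0 [simp]: "mon_eval v 0 = 1"
  by (simp add: mon_eval_def)

lemma mon_eval_add: "mon_eval v (\<mu> + \<nu>) = mon_eval v \<mu> * mon_eval v \<nu>"
  by (simp add: mon_eval_def lookup_add power_add mult_ac)

lemma mon_eval_single: "mon_eval v (Poly_Mapping.single x n) = v x ^ n"
  by (cases x) (simp_all add: mon_eval_def lookup_single)

lemma poly3_eval_single:
  "ring_map h \<Longrightarrow> poly3_eval h v (Poly_Mapping.single \<mu> a) = h a * mon_eval v \<mu>"
  by (simp add: poly3_eval_def ring_mapD)

lemma poly3_eval_add:
  assumes "ring_map h"
  shows "poly3_eval h v (p + q) = poly3_eval h v p + poly3_eval h v q"
  unfolding poly3_eval_def
  by (rule setsum_keys_plus_distrib) (simp_all add: ring_mapD[OF assms] algebra_simps)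

lemma poly3_eval_zero [simp]: "poly3_eval h v 0 = 0"
  by (simp add: poly3_eval_def)

lemma poly3_eval_mult:
  assumes h: "ring_map h"
  shows "poly3_eval h v (p * q) = poly3_eval h v p * poly3_eval h v q"
proof (induction p rule: poly_mapping_single_induct)
  case (single \<mu> a)
  show ?case
    by (induction q rule: poly_mapping_single_induct)
       (simp_all add: mult_single poly3_eval_single[OF h] mon_eval_add ring_mapD[OF h]
         poly3_eval_add[OF h] ring_distribs mult_ac)
qed (simp_all add: ring_distribs poly3_eval_add[OF h])

lemma ring_map_poly3_eval:
  assumes "ring_map h"
  shows "ring_map (poly3_eval h v)"
  using poly3_eval_single[OF assms, of v 0 1]
  by (simp add: ring_map_def poly3_eval_add[OF assms] poly3_eval_mult[OF assms] ring_mapD[OF assms])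

lemma poly3_eval_var_poly: "ring_map h \<Longrightarrow> poly3_eval h v (var_poly x) = v x"
  by (simp add: var_poly_def poly3_eval_single mon_eval_single ring_mapD)

lemma ring_map_single_0: "ring_map (Poly_Mapping.single 0 :: 'a::comm_ring_1 \<Rightarrow> 'a poly3)"
  by (simp add: ring_map_def single_add mult_single)

lemma single_split: "Poly_Mapping.single \<mu> a = Poly_Mapping.single 0 a * mon_eval var_poly \<mu>"
  for a :: "'a::comm_ring_1"
proof -
  have pow: "(var_poly x :: 'a poly3) ^ n = Poly_Mapping.single (Poly_Mapping.single x n) 1" for x n
    by (induction n) (simp_all add: var_poly_def mult_single flip: single_add)
  have "\<mu> = Poly_Mapping.single S (Poly_Mapping.lookup \<mu> S) + Poly_Mapping.single Tv (Poly_Mapping.lookup \<mu> Tv)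
      + Poly_Mapping.single U (Poly_Mapping.lookup \<mu> U)" (is "\<mu> = ?r")
  proof (rule poly_mapping_eqI)
    fix k show "Poly_Mapping.lookup \<mu> k = Poly_Mapping.lookup ?r k"
      by (cases k) (simp_all add: lookup_add lookup_single)
  qed
  then show ?thesis by (simp add: mon_eval_def pow mult_single)
qed

subsection \<open>Homogeneous components\<close>

lemma mon_deg_add: "mon_deg (\<mu> + \<nu>) = mon_deg \<mu> + mon_deg \<nu>"
  by (simp add: mon_deg_def lookup_add)

lemma mon_deg_0 [simp]: "mon_deg 0 = 0"
  by (simp add: mon_deg_def)

lemma mon_deg_single [simp]: "mon_deg (Poly_Mapping.single x n) = n"
  by (cases x) (simp_all add: mon_deg_def lookup_single)

lemma homogeneous_iff: "homogeneous n p \<longleftrightarrow> (\<forall>\<mu>. Poly_Mapping.lookup p \<mu> \<noteq> 0 \<longrightarrow> mon_deg \<mu> = n)"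
  by (auto simp: homogeneous_def in_keys_iff)

lemma homogeneous_0 [simp]: "homogeneous n 0"
  by (simp add: homogeneous_iff)

lemma homogeneous_1 [simp]: "homogeneous 0 (1 :: 'a::comm_ring_1 poly3)"
  by (simp add: homogeneous_def)

lemma homogeneous_add: "homogeneous n p \<Longrightarrow> homogeneous n q \<Longrightarrow> homogeneous n (p + q)"
  for p :: "'a::comm_monoid_add poly3"
  unfolding homogeneous_iff lookup_add by (metis add_0)

lemma homogeneous_uminus: "homogeneous n p \<Longrightarrow> homogeneous n (- p)"
  for p :: "'a::ab_group_add poly3"
  by (auto simp: homogeneous_iff)

lemma homogeneous_diff: "homogeneous n p \<Longrightarrow> homogeneous n q \<Longrightarrow> homogeneous n (p - q)"
  for p :: "'a::ab_group_add poly3"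
  unfolding homogeneous_iff lookup_minus by (metis diff_0_right)

lemma homogeneous_sum: "(\<And>i. i \<in> A \<Longrightarrow> homogeneous n (g i)) \<Longrightarrow> homogeneous n (sum g A)"
  by (induction A rule: infinite_finite_induct) (auto intro: homogeneous_add)

lemma homogeneous_single: "mon_deg \<mu> = n \<Longrightarrow> homogeneous n (Poly_Mapping.single \<mu> a)"
  by (simp add: homogeneous_def)

lemma homogeneous_var_poly [simp]: "homogeneous (Suc 0) (var_poly x :: 'a::comm_ring_1 poly3)"
  unfolding var_poly_def by (rule homogeneous_single) simp

lemma homogeneous_const [simp]: "homogeneous 0 (Poly_Mapping.single 0 c :: 'a::comm_ring_1 poly3)"
  by (rule homogeneous_single) simp

lemma homogeneous_mult:
  assumes "homogeneous a p" "homogeneous b q"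
  shows "homogeneous (a + b) (p * q)"
  using assms keys_mult[of p q] unfolding homogeneous_def by (force simp: mon_deg_add)

lemma homogeneous_mult': "homogeneous a p \<Longrightarrow> homogeneous b q \<Longrightarrow> a + b = n \<Longrightarrow> homogeneous n (p * q)"
  using homogeneous_mult by blast

lemma homogeneous_power: "homogeneous a p \<Longrightarrow> homogeneous (n * a) (p ^ n)"
  for p :: "'a::comm_ring_1 poly3"
  by (induction n) (auto intro: homogeneous_mult)

lemma homogeneous_var_power [simp]: "homogeneous n (var_poly x ^ n :: 'a::comm_ring_1 poly3)"
  using homogeneous_power[OF homogeneous_var_poly, of n] by simp

lift_definition hcomp :: "nat \<Rightarrow> 'a::zero poly3 \<Rightarrow> 'a poly3" is
  "\<lambda>n f \<mu>. f \<mu> when mon_deg \<mu> = n"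
  by (erule finite_subset[rotated]) auto

lemma lookup_hcomp: "Poly_Mapping.lookup (hcomp n p) \<mu> = (Poly_Mapping.lookup p \<mu> when mon_deg \<mu> = n)"
  by transfer simp

lemma homogeneous_hcomp [simp]: "homogeneous n (hcomp n p)"
  by (auto simp: homogeneous_iff lookup_hcomp)

lemma hcomp_homogeneous: "homogeneous m p \<Longrightarrow> hcomp n p = (if n = m then p else 0)"
  by (auto intro!: poly_mapping_eqI simp: homogeneous_iff lookup_hcomp when_def)

lemma hcomp_id: "homogeneous n p \<Longrightarrow> hcomp n p = p"
  by (simp add: hcomp_homogeneous)

lemma hcomp_add: "hcomp n (p + q) = hcomp n p + hcomp n q"
  by (auto intro!: poly_mapping_eqI simp: lookup_hcomp lookup_add when_def)

lemma hcomp_0 [simp]: "hcomp n 0 = 0"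
  by (auto intro!: poly_mapping_eqI simp: lookup_hcomp)

lemma hcomp_sum: "hcomp n (sum g A) = (\<Sum>i\<in>A. hcomp n (g i))"
  by (induction A rule: infinite_finite_induct) (auto simp: hcomp_add)

lemma hcomp_nonzero: "p \<noteq> 0 \<Longrightarrow> \<exists>n. hcomp n p \<noteq> 0"
proof -
  assume "p \<noteq> 0"
  then obtain \<mu> where "Poly_Mapping.lookup p \<mu> \<noteq> 0" by (metis lookup_zero poly_mapping_eqI)
  then have "Poly_Mapping.lookup (hcomp (mon_deg \<mu>) p) \<mu> \<noteq> 0" by (simp add: lookup_hcomp)
  then show ?thesis by (metis lookup_zero)
qed

lemma hcomp_mult:
  assumes "homogeneous m f"
  shows "hcomp n (g * f) = (if m \<le> n then hcomp (n - m) g * f else 0)"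
proof (induction g rule: poly_mapping_single_induct)
  case (single \<mu> a)
  have 1: "homogeneous (mon_deg \<mu>) (Poly_Mapping.single \<mu> a)" by (rule homogeneous_single) simp
  show ?case
    unfolding hcomp_homogeneous[OF homogeneous_mult[OF 1 assms]] hcomp_homogeneous[OF 1]
    by auto
qed (simp_all add: hcomp_add ring_distribs)

lemma hcomp_mult': 
  fixes f g :: "'a::comm_ring_1 poly3"
  assumes "homogeneous m f"
  shows "hcomp n (f * g) = (if m \<le> n then f * hcomp (n - m) g else 0)"
  using hcomp_mult[OF assms, of n g] by (simp add: mult.commute)

subsection \<open>Divisibility by a variable and the Koszul relations\<close>

definition var_zero :: "var \<Rightarrow> 'a::comm_ring_1 poly3 \<Rightarrow> 'a poly3" where
  "var_zero x = poly3_eval (Poly_Mapping.single 0) (\<lambda>y. if y = x then 0 else var_poly y)"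

lemma ring_map_var_zero: "ring_map (var_zero x)"
  unfolding var_zero_def by (rule ring_map_poly3_eval[OF ring_map_single_0])

lemma var_zero_var: "var_zero x (var_poly y) = (if y = x then 0 else var_poly y)"
  unfolding var_zero_def by (simp add: poly3_eval_var_poly[OF ring_map_single_0])

text \<open>The elements fixed by \<open>h\<close> modulo \<open>z\<close> are closed under sums and
  products, so it suffices to look at constants and variables.\<close>

lemma ring_map_eq_iff_dvd:
  fixes h :: "'a::comm_ring_1 poly3 \<Rightarrow> 'a poly3"
  assumes h: "ring_map h" and "\<And>c. h (Poly_Mapping.single 0 c) = Poly_Mapping.single 0 c"
    and v: "\<And>x. z dvd var_poly x - h (var_poly x)"
  shows "z dvd p - h p"
proof (induction p rule: poly_mapping_single_induct)
  case (add p q)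
  then show ?case using dvd_add[OF add] by (simp add: ring_mapD[OF h] algebra_simps)
next
  case (single \<mu> a)
  have *: "z dvd a * b - h (a * b)" if "z dvd a - h a" "z dvd b - h b" for a b
  proof -
    have "a * b - h (a * b) = a * (b - h b) + h b * (a - h a)"
      by (simp add: ring_mapD[OF h] algebra_simps)
    then show ?thesis using that by (simp add: dvd_add dvd_mult)
  qed
  have pw: "z dvd var_poly x ^ n - h (var_poly x ^ n)" for x n
  proof (induction n)
    case (Suc n)
    then show ?case using *[OF v Suc] by simp
  qed (simp add: ring_mapD[OF h])
  show ?case
    by (subst (1 2) single_split) (auto simp: mon_eval_def assms(2) intro!: * pw)
qed (simp add: ring_mapD[OF h])

lemma var_dvd_diff_var_zero: "var_poly x dvd p - var_zero x p"
  by (rule ring_map_eq_iff_dvd[OF ring_map_var_zero])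
     (auto simp: var_zero_var, simp add: var_zero_def poly3_eval_single[OF ring_map_single_0])

lemma var_dvd_iff: "var_poly x dvd p \<longleftrightarrow> var_zero x p = 0"
proof
  assume "var_zero x p = 0"
  then show "var_poly x dvd p" using var_dvd_diff_var_zero[of x p] by simp
next
  assume "var_poly x dvd p"
  then show "var_zero x p = 0"
    by (auto simp: ring_mapD[OF ring_map_var_zero] var_zero_var)
qed

lemma var_poly_nonzero [simp]: "(var_poly x :: 'a::comm_ring_1 poly3) \<noteq> 0"
  unfolding var_poly_def by (metis lookup_single_eq lookup_zero zero_neq_one)

text \<open>Exactness of the Koszul complex over \<open>T\<close> in homological degree 1. Setting u
  and then t to zero shows that \<open>a\<close> is a multiple of t modulo u; this fixes
  \<open>b\<close> modulo u, and the rest of the relation can be divided by u. The triple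
  \<open>p, q, r\<close> is the negative of the coefficients at \<open>{S, Tv}\<close>,
  \<open>{S, U}\<close>, \<open>{Tv, U}\<close> in the convention of
  \<open>koszul_d\<close>.\<close>

lemma koszul_exact:
  fixes a b c :: "'a::idom poly3"
  assumes "var_poly S * a + var_poly Tv * b + var_poly U * c = 0"
  obtains p q r where "a = var_poly Tv * p + var_poly U * q" "b = var_poly U * r - var_poly S * p"
    "c = - var_poly S * q - var_poly Tv * r"
proof -
  let ?s = "var_poly S :: 'a poly3" and ?t = "var_poly Tv :: 'a poly3" and ?u = "var_poly U :: 'a poly3"
  note rm = ring_mapD[OF ring_map_var_zero] var_zero_var
  have 1: "?s * var_zero U a + ?t * var_zero U b = 0"
    using arg_cong[OF assms, of "var_zero U"] by (simp add: rm)
  have "?s * var_zero Tv (var_zero U a) = 0"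
    using arg_cong[OF 1, of "var_zero Tv"] by (simp add: rm)
  then have "?t dvd var_zero U a" by (simp add: var_dvd_iff)
  then obtain p where p: "var_zero U a = ?t * p" by (elim dvdE)
  have "?t * (?s * p + var_zero U b) = 0" using 1 unfolding p by (simp add: algebra_simps)
  then have b0: "var_zero U b = - (?s * p)" by (simp add: add_eq_0_iff)
  obtain q r where q: "a - var_zero U a = ?u * q" and r: "b - var_zero U b = ?u * r"
    using var_dvd_diff_var_zero[of U a] var_dvd_diff_var_zero[of U b] by (auto elim!: dvdE)
  have a: "a = ?t * p + ?u * q" using q p by (simp add: algebra_simps)
  have b: "b = ?u * r - ?s * p" using r b0 by (simp add: algebra_simps)
  have "?u * (?s * q + ?t * r + c) = 0" using assms unfolding a b by (simp add: algebra_simps)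
  then have "?s * q + ?t * r + c = 0" by simp
  then have "c = - ?s * q - ?t * r" by (simp add: algebra_simps eq_neg_iff_add_eq_0)
  then show ?thesis using a b that by blast
qed

subsection \<open>Change of coefficients\<close>

definition additive_map :: "('a::ab_group_add \<Rightarrow> 'b::ab_group_add) \<Rightarrow> bool" where
  "additive_map h \<longleftrightarrow> (\<forall>a b. h (a + b) = h a + h b)"

lemma additive_map_0: "additive_map h \<Longrightarrow> h 0 = 0"
  unfolding additive_map_def by (metis add_cancel_right_right)

lemma lookup_map_additive:
  "additive_map h \<Longrightarrow> Poly_Mapping.lookup (Poly_Mapping.map h p) \<mu> = h (Poly_Mapping.lookup p \<mu>)"
  by (simp add: Poly_Mapping.map.rep_eq when_def additive_map_0)

lemma map_coeffs_add: "additive_map h \<Longrightarrow> Poly_Mapping.map h (p + q) = Poly_Mapping.map h p + Poly_Mapping.map h q"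
  by (rule poly_mapping_eqI) (simp add: lookup_map_additive lookup_add, simp add: additive_map_def)

lemma map_coeffs_0: "Poly_Mapping.map h 0 = 0"
  by (simp add: map_eq_zero_iff)

lemma map_coeffs_sum: "additive_map h \<Longrightarrow> Poly_Mapping.map h (sum g A) = (\<Sum>i\<in>A. Poly_Mapping.map h (g i))"
  by (induction A rule: infinite_finite_induct)
     (auto simp: map_coeffs_add map_eq_zero_iff additive_map_0)

text \<open>Covers two situations: with \<open>i\<close> the identity and \<open>h = j\<close> an
  embedding of fields, extension of coefficients is multiplicative; with \<open>h\<close> a
  retraction, \<open>i\<close> the embedding and \<open>j\<close> the identity, retraction of
  coefficients is linear over \<open>T\<close>.\<close>

lemma map_mult_semilinear:
  fixes i :: "'a::comm_ring_1 \<Rightarrow> 'b::comm_ring_1" and h :: "'b \<Rightarrow> 'c::comm_ring_1"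
  assumes h: "additive_map h" and i: "additive_map i" and j: "additive_map j"
    and "\<And>a b. h (i a * b) = j a * h b"
  shows "Poly_Mapping.map h (Poly_Mapping.map i p * q) = Poly_Mapping.map j p * (Poly_Mapping.map h q :: 'c poly3)"
proof (induction p rule: poly_mapping_single_induct)
  case (single \<mu> a)
  show ?case
  proof (induction q rule: poly_mapping_single_induct)
    case (single \<nu> b)
    show ?case
      using additive_map_0[OF h] additive_map_0[OF i] additive_map_0[OF j] assms(4)[of a b]
      by (simp add: mult_single)
  qed (simp_all add: ring_distribs map_coeffs_add[OF h] map_coeffs_0)
qed (simp_all add: ring_distribs map_coeffs_add[OF h] map_coeffs_add[OF i] map_coeffs_add[OF j] map_coeffs_0)

subsection \<open>Ideals generated by forms\<close>

lemma gen_idealI: "p = (\<Sum>i<m. g i * f i) \<Longrightarrow> p \<in> gen_ideal m f"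
  unfolding gen_ideal_def by blast

lemma gen_idealE:
  assumes "p \<in> gen_ideal m f"
  obtains g where "p = (\<Sum>i<m. g i * f i)"
  using assms unfolding gen_ideal_def by blast

lemma gen_ideal_0 [simp]: "0 \<in> gen_ideal m f"
  by (rule gen_idealI[of _ "\<lambda>_. 0"]) simp

lemma gen_ideal_add: "p \<in> gen_ideal m f \<Longrightarrow> q \<in> gen_ideal m f \<Longrightarrow> p + q \<in> gen_ideal m f"
proof -
  assume "p \<in> gen_ideal m f" "q \<in> gen_ideal m f"
  then obtain g h where "p = (\<Sum>i<m. g i * f i)" "q = (\<Sum>i<m. h i * f i)" by (metis gen_idealE)
  then show ?thesis by (intro gen_idealI[of _ "\<lambda>i. g i + h i"]) (simp add: ring_distribs sum.distrib)
qed

lemma gen_ideal_mult: "p \<in> gen_ideal m f \<Longrightarrow> r * p \<in> gen_ideal m f"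
proof -
  assume "p \<in> gen_ideal m f"
  then obtain g where "p = (\<Sum>i<m. g i * f i)" by (rule gen_idealE)
  then show ?thesis by (intro gen_idealI[of _ "\<lambda>i. r * g i"]) (simp add: sum_distrib_left mult_ac)
qed

lemma gen_ideal_uminus: "p \<in> gen_ideal m f \<Longrightarrow> - p \<in> gen_ideal m f"
  using gen_ideal_mult[of p m f "- 1"] by simp

lemma gen_ideal_diff: "p \<in> gen_ideal m f \<Longrightarrow> q \<in> gen_ideal m f \<Longrightarrow> p - q \<in> gen_ideal m f"
  using gen_ideal_add[OF _ gen_ideal_uminus, of p m f q] by simp

lemma gen_ideal_sum: "(\<And>i. i \<in> A \<Longrightarrow> g i \<in> gen_ideal m f) \<Longrightarrow> sum g A \<in> gen_ideal m f"
  by (induction A rule: infinite_finite_induct) (auto intro: gen_ideal_add)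

lemma gen_ideal_gen: "i < m \<Longrightarrow> f i \<in> gen_ideal m f"
  by (rule gen_idealI[of _ "\<lambda>j. if j = i then 1 else 0"]) (simp add: if_distrib[of "\<lambda>x. x * _"] cong: if_cong)

lemma hcomp_sum_mult:
  assumes "\<forall>i<m. homogeneous (e i) (f i)"
  shows "hcomp n (\<Sum>i<m. g i * f i) = (\<Sum>i<m. (if e i \<le> n then hcomp (n - e i) (g i) else 0) * f i)"
  unfolding hcomp_sum
  by (rule sum.cong) (use assms in \<open>auto simp: hcomp_mult\<close>)

lemma gen_ideal_hcomp:
  assumes "\<forall>i<m. homogeneous (e i) (f i)" "p \<in> gen_ideal m f"
  shows "hcomp n p \<in> gen_ideal m f"
  using assms(2) by (elim gen_idealE) (auto simp: hcomp_sum_mult[OF assms(1)] intro!: gen_idealI)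

text \<open>Any representation may be replaced by its component of degree \<open>n\<close>. The case
  \<open>n < e i\<close> is separate because truncated subtraction would allow constants
  there.\<close>

lemma gen_ideal_homogeneousE:
  assumes "\<forall>i<m. homogeneous (e i) (f i)" "p \<in> gen_ideal m f" "homogeneous n p"
  obtains g where "p = (\<Sum>i<m. g i * f i)" "\<And>i. e i \<le> n \<Longrightarrow> homogeneous (n - e i) (g i)"
    "\<And>i. n < e i \<Longrightarrow> g i = 0"
proof -
  obtain g where "p = (\<Sum>i<m. g i * f i)" using assms(2) by (rule gen_idealE)
  then have "p = (\<Sum>i<m. (if e i \<le> n then hcomp (n - e i) (g i) else 0) * f i)"
    using hcomp_sum_mult[OF assms(1), of n g] assms(3) by (simp add: hcomp_homogeneous)
  then show ?thesis by (rule that) auto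
qed

subsection \<open>Elimination of one variable\<close>

lemma bezout_family:
  fixes q :: "nat \<Rightarrow> 'b::euclidean_ring_gcd"
  shows "\<exists>c. \<forall>i<m. (\<Sum>j<m. c j * q j) dvd q i"
proof (induction m)
  case (Suc m)
  then obtain c where c: "\<forall>i<m. (\<Sum>j<m. c j * q j) dvd q i" by blast
  let ?D = "\<Sum>j<m. c j * q j"
  obtain a b where ab: "bezout_coefficients ?D (q m) = (a, b)" by (rule prod.exhaust)
  let ?c = "\<lambda>j. if j = m then b else a * c j"
  have "(\<Sum>j<Suc m. ?c j * q j) = a * ?D + b * q m"
    by (simp add: sum_distrib_left mult_ac)
  also have "\<dots> = gcd ?D (q m)" using bezout_coefficients[OF ab] .
  finally have eq: "(\<Sum>j<Suc m. ?c j * q j) = gcd ?D (q m)" .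
  have "gcd ?D (q m) dvd q i" if "i < Suc m" for i
  proof (cases "i = m")
    case False
    then have "?D dvd q i" using c that by simp
    then show ?thesis using dvd_trans[OF gcd_dvd1] by blast
  qed simp
  then show ?case using eq by metis
qed simp

lemma clear_denominators:
  fixes c :: "nat \<Rightarrow> 'r::{factorial_ring_gcd, semiring_gcd_mult_normalize} fract poly"
  shows "\<exists>r g. r \<noteq> 0 \<and> (\<forall>i<m. smult (to_fract r) (c i) = fract_poly (g i))"
proof (induction m)
  case 0
  show ?case by (rule exI[of _ 1]) simp
next
  case (Suc m)
  then obtain r g where r: "r \<noteq> 0" "\<forall>i<m. smult (to_fract r) (c i) = fract_poly (g i)" by blast
  obtain x q where x: "c m = smult x (fract_poly q)" by (rule content_decompose_fract)
  obtain a b where ab: "x = to_fract a / to_fract b" "b \<noteq> 0"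
    using Fract_cases[of x] by (metis Fract_conv_to_fract)
  have "smult (to_fract (r * b)) (c i) = fract_poly (if i = m then smult (r * a) q else smult b (g i))"
    if "i < Suc m" for i
  proof (cases "i = m")
    case False
    then have "smult (to_fract r) (c i) = fract_poly (g i)" using r(2) that by simp
    then show ?thesis using False by (simp flip: smult_smult add: mult.commute[of "to_fract r"])
  qed (use ab x in simp)
  then show ?case using r(1) ab(2)
    by (intro exI[of _ "r * b"] exI[of _ "\<lambda>i. if i = m then smult (r * a) q else smult b (g i)"]) simp
qed

text \<open>Over the fraction field the ideal of the \<open>p i\<close> is principal, with generator
  \<open>D\<close> say. By Gauss' lemma the primitive part of \<open>D\<close> divides every
  \<open>p i\<close> already over the base ring, so it is a unit, and so is \<open>D\<close>.
  Clearing denominators in the resulting representation of 1 leaves a nonzero constant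
  \<open>r\<close>.\<close>

lemma elimination:
  fixes p :: "nat \<Rightarrow> 'r::{factorial_ring_gcd, semiring_gcd_mult_normalize} poly"
  assumes "\<And>D. (\<forall>i<m. D dvd p i) \<Longrightarrow> D dvd 1"
  shows "\<exists>r g. r \<noteq> 0 \<and> (\<Sum>i<m. g i * p i) = [:r:]"
proof -
  obtain c where c: "\<forall>i<m. (\<Sum>j<m. c j * fract_poly (p j)) dvd fract_poly (p i)"
    using bezout_family[of m "\<lambda>i. fract_poly (p i)"] by blast
  define D where "D = (\<Sum>j<m. c j * fract_poly (p j))"
  have "D \<noteq> 0"
  proof
    assume "D = 0"
    then have "\<forall>i<m. 0 dvd p i" using c unfolding D_def[symmetric] by simp
    then show False using assms[of 0] by simp
  qed
  let ?D' = "primitive_part_fract D"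
  have D': "smult (fract_content D) (fract_poly ?D') = D" by (rule content_times_primitive_part_fract)
  have "fract_poly ?D' dvd D" by (subst (2) D'[symmetric]) (simp add: dvd_smult)
  then have "fract_poly ?D' dvd fract_poly (p i)" if "i < m" for i
    using c that dvd_trans unfolding D_def[symmetric] by blast
  then have "\<forall>i<m. ?D' dvd p i"
    using fract_poly_dvdD[OF _ content_primitive_part_fract[OF \<open>D \<noteq> 0\<close>]] by simp
  then have "fract_poly ?D' dvd 1" using assms fract_poly_is_unit by blast
  then have "D dvd 1" using \<open>D \<noteq> 0\<close> D'
    is_unit_smult_iff[of "fract_content D" "fract_poly ?D'"] by (simp add: dvd_field_iff)
  then obtain E where E: "1 = D * E" by (elim dvdE)
  obtain r g where r: "r \<noteq> 0" "\<forall>i<m. smult (to_fract r) (E * c i) = fract_poly (g i)"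
    using clear_denominators[of m "\<lambda>i. E * c i"] by blast
  have "fract_poly (\<Sum>i<m. g i * p i) = (\<Sum>i<m. fract_poly (g i) * fract_poly (p i))"
    by (induction m) simp_all
  also have "\<dots> = (\<Sum>i<m. smult (to_fract r) (E * c i) * fract_poly (p i))"
    using r(2) by simp
  also have "\<dots> = smult (to_fract r) (E * D)"
  proof -
    have "(\<Sum>i<m. smult (to_fract r) (E * c i) * fract_poly (p i)) =
        (\<Sum>i<m. [:to_fract r:] * E * (c i * fract_poly (p i)))"
      by (rule sum.cong) (simp_all add: mult_ac)
    also have "\<dots> = [:to_fract r:] * E * D" unfolding D_def sum_distrib_left ..
    finally show ?thesis by simp
  qed
  also have "\<dots> = fract_poly [:r:]" using E by (simp add: mult.commute map_poly_pCons)
  finally show ?thesis using r(1) by auto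
qed

text \<open>An isomorphism onto polynomials in \<open>c\<close> over polynomials in \<open>b\<close> over polynomials in \<open>a\<close>.\<close>

definition nested :: "var \<Rightarrow> var \<Rightarrow> var \<Rightarrow> 'a::field poly3 \<Rightarrow> 'a fract poly poly poly" where
  "nested a b c = poly3_eval (\<lambda>x. [:[:[:to_fract x:]:]:])
     (\<lambda>v. if v = a then [:[:[:0, 1:]:]:] else if v = b then [:[:0, 1:]:] else [:0, 1:])"

lemma ring_map_nested_const: "ring_map (\<lambda>x :: 'a::field. [:[:[:to_fract x:]:]:])"
  by (simp add: ring_map_def one_pCons)

lemma ring_map_nested: "ring_map (nested a b c)"
  unfolding nested_def by (rule ring_map_poly3_eval[OF ring_map_nested_const])

lemma coeff_nested:
  assumes "distinct [a, b, c]"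
  shows "coeff (coeff (coeff (nested a b c p) (Poly_Mapping.lookup \<mu> c)) (Poly_Mapping.lookup \<mu> b)) (Poly_Mapping.lookup \<mu> a)
    = to_fract (Poly_Mapping.lookup p \<mu>)"
proof (induction p rule: poly_mapping_single_induct)
  case (single \<nu> x)
  let ?l = "Poly_Mapping.lookup"
  have U: "k = a \<or> k = b \<or> k = c" for k
    using assms by (cases a; cases b; cases c; cases k) auto
  have ne: "a \<noteq> b" "b \<noteq> a" "a \<noteq> c" "c \<noteq> a" "b \<noteq> c" "c \<noteq> b" using assms by auto
  have pw: "[:0, 1:] ^ n = monom 1 n" for n by (simp add: monom_altdef)
  have pc: "[:p:] ^ n = [:p ^ n:]" for p :: "'z::comm_ring_1" and n
    by (induction n) (auto simp: one_pCons)
  have "mon_eval v \<nu> = v a ^ ?l \<nu> a * v b ^ ?l \<nu> b * v c ^ ?l \<nu> c" for v :: "var \<Rightarrow> 'a fract poly poly poly"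
    using assms by (cases a; cases b; cases c) (auto simp: mon_eval_def mult_ac)
  then have "nested a b c (Poly_Mapping.single \<nu> x) =
      monom (monom (monom (to_fract x) (?l \<nu> a)) (?l \<nu> b)) (?l \<nu> c)"
    by (simp add: ne nested_def poly3_eval_single[OF ring_map_nested_const] pw pc smult_monom mult.commute[of _ "monom _ _"])
  moreover have "\<nu> = \<mu> \<longleftrightarrow> ?l \<nu> a = ?l \<mu> a \<and> ?l \<nu> b = ?l \<mu> b \<and> ?l \<nu> c = ?l \<mu> c"
    using U by (auto intro!: poly_mapping_eqI) metis
  ultimately show ?case by (auto simp: lookup_single when_def)
qed (simp_all add: ring_mapD[OF ring_map_nested] lookup_add)

lemma nested_inject:
  assumes "distinct [a, b, c]" "nested a b c p = nested a b c q"
  shows "p = q"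
proof (rule poly_mapping_eqI)
  fix \<mu>
  have "to_fract (Poly_Mapping.lookup p \<mu>) = to_fract (Poly_Mapping.lookup q \<mu>)"
    using coeff_nested[OF assms(1), of p \<mu>] coeff_nested[OF assms(1), of q \<mu>] assms(2) by simp
  then show "Poly_Mapping.lookup p \<mu> = Poly_Mapping.lookup q \<mu>" by simp
qed

text \<open>Together with injectivity this transports common divisors back: a common divisor of the
  images is itself an image. Constants are reached because a quotient of elements of a field is
  already an element of that field.\<close>

lemma nested_surj:
  assumes "distinct [a, b, c]"
  shows "\<exists>p :: 'a::field poly3. nested a b c p = x"
proof -
  let ?R = "range (nested a b c :: 'a poly3 \<Rightarrow> _)"
  have add: "x + y \<in> ?R" if "x \<in> ?R" "y \<in> ?R" for x y
    using that by (auto simp flip: ring_mapD(3)[OF ring_map_nested])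
  have mult: "x * y \<in> ?R" if "x \<in> ?R" "y \<in> ?R" for x y
    using that by (auto simp flip: ring_mapD(4)[OF ring_map_nested])
  have v: "[:[:[:0, 1:]:]:] \<in> ?R" "[:[:0, 1:]:] \<in> ?R" "[:0, 1:] \<in> ?R"
  proof -
    have "nested a b c (var_poly a :: 'a poly3) = [:[:[:0, 1:]:]:]"
      "nested a b c (var_poly b :: 'a poly3) = [:[:0, 1:]:]" "nested a b c (var_poly c :: 'a poly3) = [:0, 1:]"
      using assms by (auto simp: nested_def poly3_eval_var_poly[OF ring_map_nested_const])
    then show "[:[:[:0, 1:]:]:] \<in> ?R" "[:[:0, 1:]:] \<in> ?R" "[:0, 1:] \<in> ?R"
      by (metis rangeI)+
  qed
  have 0: "[:[:[:y:]:]:] \<in> ?R" for y :: "'a fract"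
  proof -
    obtain n d where "y = to_fract n / to_fract d" "d \<noteq> 0"
      using Fract_cases[of y] by (metis Fract_conv_to_fract)
    moreover have "to_fract (n / d) * to_fract d = to_fract n" using \<open>d \<noteq> 0\<close> by (simp flip: to_fract_mult)
    ultimately have "y = to_fract (n / d)" using \<open>d \<noteq> 0\<close>
      by (metis mult_right_cancel nonzero_divide_eq_eq to_fract_eq_0_iff)
    moreover have "nested a b c (Poly_Mapping.single 0 (n / d)) = [:[:[:to_fract (n / d):]:]:]"
      by (simp add: nested_def poly3_eval_single[OF ring_map_nested_const])
    ultimately show ?thesis by (metis rangeI)
  qed
  have 1: "[:[:y:]:] \<in> ?R" for y
  proof (induction y)
    case 0
    show ?case using ring_mapD(1)[OF ring_map_nested, of a b c] by (metis pCons_0_0 rangeI)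
  next
    case (pCons z y)
    have "[:[:pCons z y:]:] = [:[:[:z:]:]:] + [:[:[:0, 1:]:]:] * [:[:y:]:]" by simp
    then show ?case using pCons add mult v 0 by metis
  qed
  have 2: "[:y:] \<in> ?R" for y
  proof (induction y)
    case 0
    show ?case using ring_mapD(1)[OF ring_map_nested, of a b c] by (metis pCons_0_0 rangeI)
  next
    case (pCons z y)
    have "[:pCons z y:] = [:[:z:]:] + [:[:0, 1:]:] * [:y:]" by simp
    then show ?case using pCons add mult v 1 by metis
  qed
  have "y \<in> ?R" for y
  proof (induction y)
    case 0
    show ?case using ring_mapD(1)[OF ring_map_nested, of a b c] by (metis rangeI)
  next
    case (pCons z y)
    have "pCons z y = [:z:] + [:0, 1:] * y" by simp
    then show ?case using pCons add mult v 2 by metis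
  qed
  from this[of x] show ?thesis by (metis imageE)
qed

text \<open>With \<open>c\<close> as the outermost variable, elimination yields a nonzero ideal
  element that is constant in \<open>c\<close>. Its homogeneous components are still free of
  \<open>c\<close>, and they lie in the ideal because the generators are homogeneous.\<close>

lemma ideal_contains_form_without_var:
  fixes f :: "nat \<Rightarrow> 'a::field poly3"
  assumes hom: "\<forall>i<m. homogeneous (e i) (f i)"
    and gcd1: "\<And>g. (\<forall>i<m. g dvd f i) \<Longrightarrow> g dvd 1"
  obtains n h where "h \<noteq> 0" "homogeneous n h" "h \<in> gen_ideal m f"
    "\<And>\<mu>. Poly_Mapping.lookup h \<mu> \<noteq> 0 \<Longrightarrow> Poly_Mapping.lookup \<mu> c = 0"
proof -
  have "\<exists>a b. distinct [a, b, c]"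
    by (cases c; rule exI[of _ "if c = S then Tv else S"]; rule exI[of _ "if c = U then Tv else U"]) auto
  then obtain a b where abc: "distinct [a, b, c]" by blast
  let ?N = "nested a b c :: 'a poly3 \<Rightarrow> _"
  note rm = ring_mapD[OF ring_map_nested]
  have surj: "\<exists>p. x = ?N p" for x
    using nested_surj[OF abc, of x] by (auto intro: sym)
  have "D dvd 1" if D: "\<forall>i<m. D dvd ?N (f i)" for D
  proof -
    obtain D0 where D0: "D = ?N D0" using surj by blast
    have "D0 dvd f i" if "i < m" for i
    proof -
      obtain q where q: "?N (f i) = D * q" using D \<open>i < m\<close> by (meson dvdE)
      obtain q0 where "q = ?N q0" using surj by blast
      then have "?N (f i) = ?N (D0 * q0)" using q D0 by (simp add: rm)
      then show ?thesis using nested_inject[OF abc] by (metis dvd_triv_left)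
    qed
    then have "D0 dvd 1" using gcd1 by blast
    then show ?thesis using D0 ring_map_dvd[OF ring_map_nested, of D0 1 a b c] by (simp add: rm)
  qed
  then obtain r g where r: "r \<noteq> 0" "(\<Sum>i<m. g i * ?N (f i)) = [:r:]"
    using elimination[of m "\<lambda>i. ?N (f i)"] by blast
  have "\<exists>g0. \<forall>i. g i = ?N (g0 i)" by (intro choice allI surj)
  then obtain g0 where g0: "\<And>i. g i = ?N (g0 i)" by blast
  define h where "h = (\<Sum>i<m. g0 i * f i)"
  have h: "?N h = [:r:]" using r(2) unfolding h_def by (simp add: rm g0)
  then have "h \<noteq> 0" using r(1) by (auto simp: rm)
  then obtain n where n: "hcomp n h \<noteq> 0" using hcomp_nonzero by blast
  have "Poly_Mapping.lookup \<mu> c = 0" if "Poly_Mapping.lookup h \<mu> \<noteq> 0" for \<mu>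
  proof (rule ccontr)
    assume "Poly_Mapping.lookup \<mu> c \<noteq> 0"
    then have "to_fract (Poly_Mapping.lookup h \<mu>) = 0"
      using coeff_nested[OF abc, of h \<mu>] unfolding h by (cases "Poly_Mapping.lookup \<mu> c") auto
    then show False using that by simp
  qed
  moreover have "hcomp n h \<in> gen_ideal m f"
    by (rule gen_ideal_hcomp[OF hom]) (auto simp: h_def intro: gen_idealI)
  ultimately show ?thesis using that[OF n homogeneous_hcomp] by (simp add: lookup_hcomp)
qed

subsection \<open>Restriction to a line\<close>

lemma ring_map_const_poly: "ring_map (\<lambda>c :: 'k::comm_ring_1. [:c:])"
  by (simp add: ring_map_def one_pCons)

lemma poly3_eval_cong:
  assumes "\<And>\<mu>. Poly_Mapping.lookup p \<mu> \<noteq> 0 \<Longrightarrow> mon_eval v \<mu> = mon_eval w \<mu>"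
  shows "poly3_eval h v p = poly3_eval h w p"
  unfolding poly3_eval_def by (rule sum.cong) (use assms in \<open>auto simp: in_keys_iff\<close>)

lemma ring_map_poly3_eval_comp:
  assumes "ring_map g"
  shows "g (poly3_eval h v p) = poly3_eval (\<lambda>x. g (h x)) (\<lambda>x. g (v x)) p"
  by (simp add: poly3_eval_def mon_eval_def ring_mapD[OF assms])

text \<open>Among monomials of degree \<open>n\<close> free of \<open>a\<close>, the exponent of
  \<open>c\<close> determines the monomial, so putting \<open>b = 1\<close> causes no cancellation.
  Monomials involving \<open>a\<close> are either killed by the substitution or absent from
  \<open>h\<close>.\<close>

lemma dehomogenized_nonzero:
  fixes h :: "'k::field poly3" and v :: "var \<Rightarrow> 'k poly"
  assumes hom: "homogeneous n h" and abc: "distinct [a, b, c]"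
    and \<mu>: "Poly_Mapping.lookup h \<mu> \<noteq> 0" "Poly_Mapping.lookup \<mu> a = 0"
    and v: "v b = 1" "v c = [:0, 1:]"
    and a: "v a = 0 \<or> (\<forall>\<nu>. Poly_Mapping.lookup h \<nu> \<noteq> 0 \<longrightarrow> Poly_Mapping.lookup \<nu> a = 0)"
  shows "poly3_eval (\<lambda>x. [:x:]) v h \<noteq> 0"
proof -
  let ?l = "Poly_Mapping.lookup"
  have U: "k = a \<or> k = b \<or> k = c" for k
    using abc by (cases a; cases b; cases c; cases k) auto
  have deg: "mon_deg \<nu> = ?l \<nu> a + ?l \<nu> b + ?l \<nu> c" for \<nu>
    using abc by (cases a; cases b; cases c) (auto simp: mon_deg_def)
  have mon: "mon_eval v \<nu> = v a ^ ?l \<nu> a * monom 1 (?l \<nu> c)" for \<nu>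
    using abc v by (cases a; cases b; cases c) (auto simp: mon_eval_def monom_altdef mult_ac)
  have 1: "?l h \<nu> * coeff (mon_eval v \<nu>) (?l \<mu> c) = (if \<nu> = \<mu> then ?l h \<mu> else 0)"
    if "\<nu> \<in> Poly_Mapping.keys h" for \<nu>
  proof (cases "?l \<nu> a = 0")
    case False
    then have "v a = 0" using a that by (auto simp: in_keys_iff)
    then have "mon_eval v \<nu> = 0" using mon False by simp
    then show ?thesis using False \<mu>(2) by auto
  next
    case True
    have "\<nu> = \<mu>" if "?l \<nu> c = ?l \<mu> c"
    proof (rule poly_mapping_eqI)
      fix k
      have "mon_deg \<nu> = n" "mon_deg \<mu> = n"
        using hom \<mu>(1) \<open>\<nu> \<in> _\<close> by (auto simp: homogeneous_def in_keys_iff)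
      then show "?l \<nu> k = ?l \<mu> k" using U[of k] that True \<mu>(2) deg[of \<nu>] deg[of \<mu>] by auto
    qed
    then show ?thesis using True by (auto simp: mon)
  qed
  have "coeff (poly3_eval (\<lambda>x. [:x:]) v h) (?l \<mu> c) = (\<Sum>\<nu>\<in>Poly_Mapping.keys h. if \<nu> = \<mu> then ?l h \<mu> else 0)"
    unfolding poly3_eval_def coeff_sum by (rule sum.cong) (use 1 in simp_all)
  also have "\<dots> = ?l h \<mu>" using \<mu>(1) by (simp add: sum.delta in_keys_iff)
  finally show ?thesis using \<mu>(1) by auto
qed

definition line_val :: "'k::field \<Rightarrow> 'k \<Rightarrow> var \<Rightarrow> 'k poly" where
  "line_val \<alpha> \<beta> x = (case x of S \<Rightarrow> [:0, 1:] | Tv \<Rightarrow> 1 | U \<Rightarrow> [:\<beta>, \<alpha>:])"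

definition on_line :: "'k::field \<Rightarrow> 'k \<Rightarrow> 'k poly3 \<Rightarrow> 'k poly" where
  "on_line \<alpha> \<beta> = poly3_eval (\<lambda>c. [:c:]) (line_val \<alpha> \<beta>)"

definition line_form :: "'k::field \<Rightarrow> 'k \<Rightarrow> 'k poly3" where
  "line_form \<alpha> \<beta> = var_poly U - Poly_Mapping.single 0 \<alpha> * var_poly S - Poly_Mapping.single 0 \<beta> * var_poly Tv"

text \<open>Homogenisation by t to degree \<open>n\<close>: a section of the restriction to the
  line, valid for polynomials of degree at most \<open>n\<close> since higher coefficients are
  dropped.\<close>

definition form_lift :: "nat \<Rightarrow> 'k::field poly \<Rightarrow> 'k poly3" where
  "form_lift n q = (\<Sum>i\<le>n. Poly_Mapping.single 0 (coeff q i) * (var_poly S ^ i * var_poly Tv ^ (n - i)))"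

lemma ring_map_on_line: "ring_map (on_line \<alpha> \<beta>)"
  unfolding on_line_def by (rule ring_map_poly3_eval[OF ring_map_const_poly])

lemma on_line_var: "on_line \<alpha> \<beta> (var_poly x) = line_val \<alpha> \<beta> x"
  unfolding on_line_def by (rule poly3_eval_var_poly[OF ring_map_const_poly])

lemma on_line_const: "on_line \<alpha> \<beta> (Poly_Mapping.single 0 c) = [:c:]"
  unfolding on_line_def by (simp add: poly3_eval_single[OF ring_map_const_poly])

lemmas on_line_simps = ring_mapD[OF ring_map_on_line] on_line_var on_line_const

lemma mon_eval_line_val:
  "mon_eval (line_val \<alpha> \<beta>) \<mu> = monom 1 (Poly_Mapping.lookup \<mu> S) * [:\<beta>, \<alpha>:] ^ Poly_Mapping.lookup \<mu> U"
  by (simp add: mon_eval_def line_val_def monom_altdef)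

lemma degree_linear_power_le: "degree ([:b, a:] ^ n) \<le> n"
  by (rule order_trans[OF degree_power_le]) simp

lemma coeff_linear_power_top: "coeff ([:b, a:] ^ n) n = a ^ n"
proof (induction n)
  case (Suc n)
  have "coeff ([:b, a:] ^ n) (Suc n) = 0"
    by (rule coeff_eq_0) (use degree_linear_power_le[of b a n] in simp)
  then show ?case using Suc by simp
qed simp

lemma degree_on_line_le:
  assumes "homogeneous n p"
  shows "degree (on_line \<alpha> \<beta> p) \<le> n"
  unfolding on_line_def poly3_eval_def
proof (rule degree_sum_le)
  fix \<mu> assume "\<mu> \<in> Poly_Mapping.keys p"
  then have n: "mon_deg \<mu> = n" using assms by (simp add: homogeneous_def)
  have "degree (mon_eval (line_val \<alpha> \<beta>) \<mu>) \<le> degree (monom (1::'a) (Poly_Mapping.lookup \<mu> S)) + degree ([:\<beta>, \<alpha>:] ^ Poly_Mapping.lookup \<mu> U)"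
    unfolding mon_eval_line_val by (rule degree_mult_le)
  also have "\<dots> \<le> Poly_Mapping.lookup \<mu> S + Poly_Mapping.lookup \<mu> U"
    by (rule add_mono[OF degree_monom_le degree_linear_power_le])
  finally have "degree (mon_eval (line_val \<alpha> \<beta>) \<mu>) \<le> n" using n by (simp add: mon_deg_def)
  then show "degree ([:Poly_Mapping.lookup p \<mu>:] * mon_eval (line_val \<alpha> \<beta>) \<mu>) \<le> n"
    by (simp add: order_trans[OF degree_smult_le])
qed simp

text \<open>The right-hand side is the value of \<open>p\<close> at (1:0:\<alpha>), the one point of
  the line that the chart t = 1 omits. Hence full degree of the restriction means that
  \<open>p\<close> does not vanish there.\<close>

lemma coeff_on_line_top:
  assumes "homogeneous n p"
  shows "coeff (on_line \<alpha> \<beta> p) n = poly3_eval (\<lambda>c. c) (\<lambda>x. case x of S \<Rightarrow> 1 | Tv \<Rightarrow> 0 | U \<Rightarrow> \<alpha>) p"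
  unfolding on_line_def poly3_eval_def coeff_sum
proof (rule sum.cong)
  fix \<mu> assume "\<mu> \<in> Poly_Mapping.keys p"
  then have n: "mon_deg \<mu> = n" using assms by (simp add: homogeneous_def)
  let ?i = "Poly_Mapping.lookup \<mu> S" and ?j = "Poly_Mapping.lookup \<mu> Tv" and ?l = "Poly_Mapping.lookup \<mu> U"
  have nn: "n = ?i + ?j + ?l" using n by (simp add: mon_deg_def)
  \<comment> \<open>The factor \<open>0 ^ ?j\<close> is 1 exactly for \<open>?j = 0\<close>, in
    accordance with the substitution of 0 for t.\<close>
  have "coeff ([:\<beta>, \<alpha>:] ^ ?l) (?j + ?l) = 0 ^ ?j * \<alpha> ^ ?l"
  proof (cases "?j = 0")
    case False
    then show ?thesis using degree_linear_power_le[of \<beta> \<alpha> ?l] by (simp add: coeff_eq_0)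
  qed (simp add: coeff_linear_power_top)
  then show "coeff ([:Poly_Mapping.lookup p \<mu>:] * mon_eval (line_val \<alpha> \<beta>) \<mu>) n =
      Poly_Mapping.lookup p \<mu> * mon_eval (\<lambda>x. case x of S \<Rightarrow> 1 | Tv \<Rightarrow> 0 | U \<Rightarrow> \<alpha>) \<mu>"
    by (simp add: mon_eval_line_val nn coeff_monom_mult mon_eval_def[where 'r = 'a] add.assoc)
qed simp

lemma line_form_nonzero: "line_form \<alpha> \<beta> \<noteq> 0"
proof
  assume "line_form \<alpha> \<beta> = 0"
  moreover have "Poly_Mapping.lookup (line_form \<alpha> \<beta>) (Poly_Mapping.single U 1) = 1"
    by (simp add: line_form_def var_poly_def lookup_minus mult_single lookup_single when_def)
       (metis One_nat_def lookup_single_eq lookup_single_not_eq var.distinct(3,5) zero_neq_one)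
  ultimately show False by simp
qed

lemma homogeneous_line_form: "homogeneous (Suc 0) (line_form \<alpha> \<beta>)"
  unfolding line_form_def
  by (intro homogeneous_diff homogeneous_var_poly homogeneous_mult'[OF homogeneous_const homogeneous_var_poly]) simp_all

lemma on_line_line_form: "on_line \<alpha> \<beta> (line_form \<alpha> \<beta>) = 0"
  by (simp add: line_form_def on_line_simps line_val_def one_pCons)

lemma homogeneous_form_lift: "homogeneous n (form_lift n q)"
  unfolding form_lift_def
  by (rule homogeneous_sum, rule homogeneous_mult'[OF homogeneous_const homogeneous_mult'[OF homogeneous_var_power homogeneous_var_power]])
     auto

lemma on_line_form_lift:
  assumes "degree q \<le> n"
  shows "on_line \<alpha> \<beta> (form_lift n q) = q"
proof -
  have "on_line \<alpha> \<beta> (form_lift n q) = (\<Sum>i\<le>n. smult (coeff q i) (monom 1 i))"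
    by (simp add: form_lift_def on_line_simps line_val_def monom_altdef)
  also have "\<dots> = q" using poly_as_sum_of_monoms'[OF assms] by (simp add: smult_monom)
  finally show ?thesis .
qed

lemma form_lift_add: "form_lift n (p + q) = form_lift n p + form_lift n q"
  by (simp add: form_lift_def single_add ring_distribs sum.distrib)

lemma form_lift_smult: "form_lift n (smult c q) = Poly_Mapping.single 0 c * form_lift n q"
  by (simp add: form_lift_def sum_distrib_left mult_single flip: mult.assoc)

lemma form_lift_Suc:
  assumes "degree q \<le> n"
  shows "form_lift (Suc n) q = var_poly Tv * form_lift n q"
proof -
  have "coeff q (Suc n) = 0" using assms by (simp add: coeff_eq_0)
  then show ?thesis
    by (simp add: form_lift_def sum_distrib_left mult_ac Suc_diff_le)
qed

lemma form_lift_pCons: "form_lift (Suc n) (pCons 0 q) = var_poly S * form_lift n q"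
  unfolding form_lift_def sum.atMost_Suc_shift by (simp add: sum_distrib_left mult_ac)

text \<open>Modulo the line form, u equals \<alpha>s + \<beta>t. Since \<open>form_lift n\<close> is
  not multiplicative, monomials are built up one factor at a time, by powers of u, then s, then t: a
  factor s shifts the coefficients, a factor t only raises the target degree.\<close>

lemma line_form_dvd_diff_lift:
  assumes "homogeneous n p"
  shows "line_form \<alpha> \<beta> dvd p - form_lift n (on_line \<alpha> \<beta> p)"
proof -
  let ?x = "line_form \<alpha> \<beta>" and ?s = "var_poly S :: 'a poly3" and ?t = "var_poly Tv :: 'a poly3" and ?u = "var_poly U :: 'a poly3"
  have 0: "?x dvd ?u ^ l - form_lift l ([:\<beta>, \<alpha>:] ^ l)" for l
  proof (induction l)
    case 0
    show ?case by (simp add: form_lift_def)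
  next
    case (Suc l)
    let ?q = "[:\<beta>, \<alpha>:] ^ l" and ?c = "Poly_Mapping.single 0 :: 'a \<Rightarrow> 'a poly3"
    have "[:\<beta>, \<alpha>:] ^ Suc l = smult \<beta> ?q + smult \<alpha> (pCons 0 ?q)" by (simp add: algebra_simps)
    then have "form_lift (Suc l) ([:\<beta>, \<alpha>:] ^ Suc l) = (?c \<alpha> * ?s + ?c \<beta> * ?t) * form_lift l ?q"
      by (simp only: form_lift_add form_lift_smult form_lift_Suc[OF degree_linear_power_le] form_lift_pCons)
         (simp add: algebra_simps)
    then have "?u ^ Suc l - form_lift (Suc l) ([:\<beta>, \<alpha>:] ^ Suc l) =
        ?x * ?u ^ l + (?c \<alpha> * ?s + ?c \<beta> * ?t) * (?u ^ l - form_lift l ?q)"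
      by (simp add: line_form_def algebra_simps)
    then show ?case using Suc by (simp add: dvd_add dvd_mult)
  qed
  have 1: "?x dvd ?s ^ i * ?u ^ l - form_lift (i + l) (monom 1 i * [:\<beta>, \<alpha>:] ^ l)" for i l
  proof (induction i)
    case (Suc i)
    have "form_lift (Suc i + l) (monom 1 (Suc i) * [:\<beta>, \<alpha>:] ^ l) = ?s * form_lift (i + l) (monom 1 i * [:\<beta>, \<alpha>:] ^ l)"
      by (simp add: monom_Suc form_lift_pCons)
    then have "?s ^ Suc i * ?u ^ l - form_lift (Suc i + l) (monom 1 (Suc i) * [:\<beta>, \<alpha>:] ^ l) =
       ?s * (?s ^ i * ?u ^ l - form_lift (i + l) (monom 1 i * [:\<beta>, \<alpha>:] ^ l))"
      by (simp add: algebra_simps)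
    then show ?case using Suc by (simp add: dvd_mult)
  qed (use 0 in simp)
  have 2: "?x dvd ?s ^ i * ?t ^ j * ?u ^ l - form_lift (i + j + l) (monom 1 i * [:\<beta>, \<alpha>:] ^ l)" for i j l
  proof (induction j)
    case (Suc j)
    let ?q = "monom 1 i * [:\<beta>, \<alpha>:] ^ l"
    have "degree ?q \<le> i + l"
      by (rule order_trans[OF degree_mult_le add_mono[OF degree_monom_le degree_linear_power_le]])
    then have "form_lift (i + Suc j + l) ?q = ?t * form_lift (i + j + l) ?q"
      by (simp add: form_lift_Suc)
    then have "?s ^ i * ?t ^ Suc j * ?u ^ l - form_lift (i + Suc j + l) ?q =
       ?t * (?s ^ i * ?t ^ j * ?u ^ l - form_lift (i + j + l) ?q)"
      by (simp add: algebra_simps)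
    then show ?case using Suc by (simp add: dvd_mult)
  qed (use 1 in simp)
  have "?x dvd (\<Sum>\<mu>\<in>A. Poly_Mapping.single \<mu> (Poly_Mapping.lookup p \<mu>))
      - form_lift n (on_line \<alpha> \<beta> (\<Sum>\<mu>\<in>A. Poly_Mapping.single \<mu> (Poly_Mapping.lookup p \<mu>)))"
    if "finite A" "A \<subseteq> Poly_Mapping.keys p" for A
    using that
  proof (induction A rule: finite_induct)
    case empty
    show ?case by (simp add: on_line_simps form_lift_def)
  next
    case (insert \<mu> A)
    let ?m = "Poly_Mapping.single \<mu> (Poly_Mapping.lookup p \<mu>)"
    have n: "n = Poly_Mapping.lookup \<mu> S + Poly_Mapping.lookup \<mu> Tv + Poly_Mapping.lookup \<mu> U"
      using insert.prems assms by (auto simp: homogeneous_def mon_deg_def)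
    have "?m - form_lift n (on_line \<alpha> \<beta> ?m) = Poly_Mapping.single 0 (Poly_Mapping.lookup p \<mu>) *
       (mon_eval var_poly \<mu> - form_lift n (mon_eval (line_val \<alpha> \<beta>) \<mu>))"
      unfolding on_line_def poly3_eval_single[OF ring_map_const_poly]
      by (subst single_split) (simp add: form_lift_smult algebra_simps)
    also have "?x dvd \<dots>" 
      by (rule dvd_mult) (use 2 in \<open>simp add: mon_eval_line_val mon_eval_def[of var_poly] n\<close>)
    finally have "?x dvd (?m - form_lift n (on_line \<alpha> \<beta> ?m))" .
    from dvd_add[OF this insert.IH] show ?case
      using insert by (simp add: on_line_simps form_lift_add algebra_simps)
  qed
  from this[OF finite_keys order_refl] show ?thesis by (simp add: poly_mapping_sum_single)
qed

lemma line_form_factor: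
  assumes "homogeneous n p" "on_line \<alpha> \<beta> p = 0"
  obtains q where "p = line_form \<alpha> \<beta> * q" "homogeneous (n - 1) q"
proof -
  have "line_form \<alpha> \<beta> dvd p"
    using line_form_dvd_diff_lift[OF assms(1), of \<alpha> \<beta>] assms(2) by (simp add: form_lift_def)
  then obtain q where "p = line_form \<alpha> \<beta> * q" by (elim dvdE)
  then have "p = line_form \<alpha> \<beta> * (if Suc 0 \<le> n then hcomp (n - 1) q else 0)"
    using hcomp_mult'[OF homogeneous_line_form, of n \<alpha> \<beta> q] hcomp_homogeneous[OF assms(1), of n] by auto
  then show ?thesis by (rule that) auto
qed

subsection \<open>General position\<close>

text \<open>Modulo \<open>p\<close> the polynomial \<open>q\<close> is nonzero over a domain containing the ground field.\<close>

lemma finite_prime_dvd_values: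
  fixes p :: "'k::field poly" and q :: "'k poly poly"
  assumes p: "prime_elem p"
  shows "\<not> (\<forall>j. p dvd coeff q j) \<Longrightarrow> finite {c. p dvd poly q [:c:]}"
proof (induction "degree q" arbitrary: q rule: less_induct)
  case less
  show ?case
  proof (cases "\<exists>c. p dvd poly q [:c:]")
    case True
    then obtain c where c: "p dvd poly q [:c:]" by blast
    define q1 where "q1 = synthetic_div q [:c:]"
    have q: "q = [:- [:c:], 1:] * q1 + [:poly q [:c:]:]"
      using synthetic_div_correct'[of "[:c:]" q] unfolding q1_def by simp
    have "degree q \<noteq> 0"
    proof
      assume "degree q = 0"
      then obtain r where "q = [:r:]" by (rule degree_eq_zeroE)
      then have "p dvd coeff q j" for j using c by (cases j) auto
      then show False using less.prems by blast
    qed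
    then have deg: "degree q1 < degree q" unfolding q1_def by (simp add: degree_synthetic_div)
    have "\<not> (\<forall>j. p dvd coeff q1 j)"
    proof
      assume *: "\<forall>j. p dvd coeff q1 j"
      have "p dvd coeff q j" for j
        by (subst q) (use * c in \<open>auto simp: coeff_pCons simp del: mult_pCons_left split: nat.splits
             intro!: dvd_add dvd_diff dvd_smult simp: algebra_simps\<close>)
      then show False using less.prems by blast
    qed
    then have fin: "finite {c. p dvd poly q1 [:c:]}" using less.hyps[OF deg] by blast
    have "c' = c \<or> p dvd poly q1 [:c':]" if "p dvd poly q [:c':]" for c'
    proof -
      have "poly q [:c':] = [:c' - c:] * poly q1 [:c':] + poly q [:c:]" by (subst q) (simp add: smult_diff_left)
      then have "p dvd [:c' - c:] * poly q1 [:c':]" using that c by (simp add: dvd_add_left_iff)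
      then have "p dvd [:c' - c:] \<or> p dvd poly q1 [:c':]" using p by (simp only: prime_elem_dvd_mult_iff)
      moreover have "c' = c" if "p dvd [:c' - c:]"
      proof (rule ccontr)
        assume "c' \<noteq> c"
        then have "[:c' - c:] dvd 1" by (simp add: is_unit_const_poly_iff dvd_field_iff)
        then show False using that p prime_elem_not_unit dvd_trans by blast
      qed
      ultimately show ?thesis by blast
    qed
    then have "{c. p dvd poly q [:c:]} \<subseteq> insert c {c. p dvd poly q1 [:c:]}" by blast
    then show ?thesis using fin finite_subset by blast
  qed simp
qed

text \<open>Each of the finitely many prime factors of \<open>R\<close> rules out only finitely many
  constants \<open>c\<close>.\<close>

lemma exists_coprime_value:
  fixes R :: "'k::field_gcd poly" and q :: "'k poly poly"
  assumes inf: "infinite (UNIV :: 'k set)" and "R \<noteq> 0"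
    and "\<And>p. prime_elem p \<Longrightarrow> p dvd R \<Longrightarrow> \<forall>j. p dvd coeff q j \<Longrightarrow> False"
  shows "\<exists>c. coprime R (poly q [:c:])"
proof -
  have "finite (\<Union>p\<in>prime_factors R. {c. p dvd poly q [:c:]})"
    using assms(3) by (intro finite_UN_I finite_prime_dvd_values) (auto simp: in_prime_factors_iff)
  then obtain c where c: "c \<notin> (\<Union>p\<in>prime_factors R. {c. p dvd poly q [:c:]})"
    using inf ex_new_if_finite by blast
  have "coprime R (poly q [:c:])"
  proof (rule ccontr)
    assume "\<not> coprime R (poly q [:c:])"
    then have "\<not> is_unit (gcd R (poly q [:c:]))" by (simp add: coprime_iff_gcd_eq_1)
    moreover have "gcd R (poly q [:c:]) \<noteq> 0" using \<open>R \<noteq> 0\<close> by simp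
    ultimately obtain p where p: "p dvd gcd R (poly q [:c:])" "prime p"
      using prime_divisor_exists by blast
    then have "p \<in> prime_factors R" using \<open>R \<noteq> 0\<close> by (simp add: in_prime_factors_iff)
    then show False using c p by simp
  qed
  then show ?thesis ..
qed

text \<open>Three successive general choices: \<alpha> for the point of the line at t = 0, \<beta>
  so that \<open>h1\<close> and \<open>h2\<close> have coprime restrictions, and a constant
  \<open>c\<close> that combines the generators into a single \<open>G\<close>.\<close>

lemma general_line:
  fixes f :: "nat \<Rightarrow> 'k::field_gcd poly3"
  assumes inf: "infinite (UNIV :: 'k set)"
    and hom: "\<forall>i<m. homogeneous (e i) (f i) \<and> e i \<le> d"
    and i0: "i0 < m" "Poly_Mapping.lookup (f i0) \<mu> \<noteq> 0" "Poly_Mapping.lookup \<mu> Tv = 0"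
    and h1: "homogeneous n1 h1" "h1 \<noteq> 0" "h1 \<in> gen_ideal m f"
      "\<And>\<mu>. Poly_Mapping.lookup h1 \<mu> \<noteq> 0 \<Longrightarrow> Poly_Mapping.lookup \<mu> U = 0"
    and h2: "homogeneous n2 h2" "h2 \<noteq> 0" "h2 \<in> gen_ideal m f"
      "\<And>\<mu>. Poly_Mapping.lookup h2 \<mu> \<noteq> 0 \<Longrightarrow> Poly_Mapping.lookup \<mu> S = 0"
  obtains \<alpha> \<beta> F G where "F \<in> gen_ideal m f" "G \<in> gen_ideal m f" "homogeneous d F" "homogeneous d G"
    "degree (on_line \<alpha> \<beta> F) = d" "on_line \<alpha> \<beta> F \<noteq> 0" "coprime (on_line \<alpha> \<beta> F) (on_line \<alpha> \<beta> G)"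
proof -
  let ?w = "poly3_eval (\<lambda>x. [:x:]) (\<lambda>x. case x of S \<Rightarrow> 1 | Tv \<Rightarrow> 0 | U \<Rightarrow> [:0, 1:]) (f i0)"
  have "?w \<noteq> 0"
    by (rule dehomogenized_nonzero[where a = Tv and b = S and c = U, OF _ _ i0(2,3)]) (use hom i0 in auto)
  then have "finite {\<alpha>. poly ?w \<alpha> = 0}" by (rule poly_roots_finite)
  then obtain \<alpha> where \<alpha>: "poly ?w \<alpha> \<noteq> 0" using inf ex_new_if_finite by blast
  have rp: "ring_map (\<lambda>p :: 'k poly. poly p \<alpha>)" by (simp add: ring_map_def)
  have w: "poly ?w \<alpha> = poly3_eval (\<lambda>c. c) (\<lambda>x. case x of S \<Rightarrow> 1 | Tv \<Rightarrow> 0 | U \<Rightarrow> \<alpha>) (f i0)"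
    by (subst ring_map_poly3_eval_comp[OF rp]) (auto intro!: poly3_eval_cong simp: mon_eval_def)
  define W1 where "W1 = poly3_eval (\<lambda>x. [:x:]) (line_val 0 0) h1"
  define W2 where "W2 = poly3_eval (\<lambda>x. [:x:]) (\<lambda>x. case x of S \<Rightarrow> 0 | Tv \<Rightarrow> 1 | U \<Rightarrow> [:0, 1:]) h2"
  have ex: "\<exists>\<mu>. Poly_Mapping.lookup h \<mu> \<noteq> 0" if "h \<noteq> 0" for h :: "'k poly3"
    using that by (metis lookup_zero poly_mapping_eqI)
  obtain \<mu>1 where \<mu>1: "Poly_Mapping.lookup h1 \<mu>1 \<noteq> 0" using ex[OF h1(2)] by blast
  obtain \<mu>2 where \<mu>2: "Poly_Mapping.lookup h2 \<mu>2 \<noteq> 0" using ex[OF h2(2)] by blast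
  have "W1 \<noteq> 0" unfolding W1_def
    by (rule dehomogenized_nonzero[where a = U and b = Tv and c = S, OF h1(1) _ \<mu>1 h1(4)[OF \<mu>1]])
       (auto simp: line_val_def h1(4))
  have "W2 \<noteq> 0" unfolding W2_def
    by (rule dehomogenized_nonzero[where a = S and b = Tv and c = U, OF h2(1) _ \<mu>2 h2(4)[OF \<mu>2]])
       (auto simp: h2(4))
  \<comment> \<open>As \<open>h1\<close> is free of u, its restriction depends neither on \<alpha>
    nor on \<beta>; only \<open>h2\<close> moves with the line.\<close>
  have b1: "on_line \<alpha> \<beta> h1 = W1" for \<beta>
    unfolding on_line_def W1_def
    by (rule poly3_eval_cong) (simp add: mon_eval_def line_val_def h1(4))
  have b2: "on_line \<alpha> \<beta> h2 = pcompose W2 [:\<beta>, \<alpha>:]" for \<beta>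
  proof -
    have r: "ring_map (\<lambda>p. pcompose p [:\<beta>, \<alpha>:])"
      by (simp add: ring_map_def pcompose_add pcompose_mult pcompose_1)
    show ?thesis unfolding on_line_def W2_def
      by (subst ring_map_poly3_eval_comp[OF r])
         (auto intro!: poly3_eval_cong simp: mon_eval_def line_val_def h2(4) pcompose_pCons pcompose_1)
  qed
  \<comment> \<open>This is \<open>W2\<close> evaluated at Y + \<alpha>s, a polynomial in Y over
    \<open>K[s]\<close> with \<beta> to be inserted for Y. Its leading coefficient is a nonzero
    constant, so no prime divides all its coefficients.\<close>
  define q where "q = pcompose (map_poly (\<lambda>c. [:c:]) W2) [:[:0, \<alpha>:], 1:]"
  have q: "poly q [:\<beta>:] = pcompose W2 [:\<beta>, \<alpha>:]" for \<beta>
    unfolding q_def poly_pcompose by (simp add: pcompose_altdef)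
  have "lead_coeff q = [:lead_coeff W2:]"
    unfolding q_def by (subst lead_coeff_comp) (simp_all add: degree_map_poly coeff_map_poly)
  then have lq: "is_unit (lead_coeff q)" using \<open>W2 \<noteq> 0\<close> by (simp add: is_unit_const_poly_iff dvd_field_iff)
  have "\<exists>\<beta>. coprime W1 (poly q [:\<beta>:])"
    by (rule exists_coprime_value[OF inf \<open>W1 \<noteq> 0\<close>]) (use lq dvd_trans prime_elem_not_unit in blast)
  then obtain \<beta> where cop: "coprime (on_line \<alpha> \<beta> h1) (on_line \<alpha> \<beta> h2)"
    unfolding b1 b2 q by blast
  let ?b = "on_line \<alpha> \<beta>"
  \<comment> \<open>Padding with s rather than t keeps the value at (1:0:\<alpha>) nonzero, so the
    restriction has full degree \<open>d\<close>.\<close>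
  define F where "F = var_poly S ^ (d - e i0) * f i0"
  have F: "F \<in> gen_ideal m f" unfolding F_def by (intro gen_ideal_mult gen_ideal_gen i0)
  have homF: "homogeneous d F" unfolding F_def
    by (rule homogeneous_mult'[OF homogeneous_var_power]) (use hom i0 in auto)
  have "coeff (?b (f i0)) (e i0) \<noteq> 0" using \<alpha> coeff_on_line_top[of "e i0" "f i0"] hom i0 w by simp
  then have nz: "?b (f i0) \<noteq> 0" and "degree (?b (f i0)) = e i0"
    using degree_on_line_le[of "e i0" "f i0" \<alpha> \<beta>] hom i0 by (auto intro: le_antisym le_degree)
  moreover have bF: "?b F = monom 1 (d - e i0) * ?b (f i0)"
    by (simp add: F_def on_line_simps line_val_def monom_altdef)
  ultimately have degF: "degree (?b F) = d" and nzF: "?b F \<noteq> 0"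
    using hom i0 by (simp_all add: degree_mult_eq degree_monom_eq)
  \<comment> \<open>Its value at a constant \<open>c\<close> is the combination of the restricted
    generators with weights \<open>c ^ i\<close>. A prime dividing all coefficients would divide the
    restriction of every ideal element, in particular those of \<open>h1\<close> and
    \<open>h2\<close>.\<close>
  define q2 where "q2 = (\<Sum>i<m. monom (?b (f i)) i)"
  have cq2: "coeff q2 j = ?b (f j)" if "j < m" for j
    unfolding q2_def coeff_sum using that by (simp add: sum.delta)
  have dvd_ideal: "p dvd ?b h" if "\<forall>i<m. p dvd ?b (f i)" "h \<in> gen_ideal m f" for p h
    using that by (elim gen_idealE) (auto simp: on_line_simps intro!: dvd_sum dvd_mult)
  have "\<exists>c. coprime (?b F) (poly q2 [:c:])"
  proof (rule exists_coprime_value[OF inf nzF])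
    fix p assume p: "prime_elem p" "\<forall>j. p dvd coeff q2 j"
    then have "\<forall>i<m. p dvd ?b (f i)" by (metis cq2)
    then have "p dvd ?b h1" "p dvd ?b h2" using dvd_ideal h1(3) h2(3) by blast+
    then show False using cop p(1) coprime_common_divisor prime_elem_not_unit by blast
  qed
  then obtain c where c: "coprime (?b F) (poly q2 [:c:])" ..
  \<comment> \<open>Padding with powers of t equalises the degrees without changing restrictions,
    since t restricts to 1.\<close>
  define G where "G = (\<Sum>i<m. (Poly_Mapping.single 0 c ^ i * var_poly Tv ^ (d - e i)) * f i)"
  have "?b G = poly q2 [:c:]"
    unfolding G_def q2_def by (simp add: on_line_simps line_val_def poly_sum poly_monom mult_ac)
  moreover have "G \<in> gen_ideal m f" unfolding G_def
    by (intro gen_ideal_sum gen_ideal_mult gen_ideal_gen) simp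
  moreover have "homogeneous d G" unfolding G_def
  proof (rule homogeneous_sum)
    fix i assume "i \<in> {..<m}"
    then have "homogeneous (0 + (d - e i) + e i) (Poly_Mapping.single 0 c ^ i * var_poly Tv ^ (d - e i) * f i)"
      using homogeneous_power[OF homogeneous_const, of i c] hom
      by (intro homogeneous_mult homogeneous_var_power) auto
    then show "homogeneous d (Poly_Mapping.single 0 c ^ i * var_poly Tv ^ (d - e i) * f i)"
      using hom \<open>i \<in> _\<close> by simp
  qed
  ultimately show ?thesis using that F homF degF nzF c by metis
qed

subsection \<open>A complete intersection and a parameter\<close>

locale line_ci =
  fixes \<alpha> \<beta> :: "'k::field_gcd" and F G :: "'k poly3" and d :: nat
  assumes d: "1 \<le> d" and F: "homogeneous d F" and G: "homogeneous d G"
    and degF: "degree (on_line \<alpha> \<beta> F) = d" and F0: "on_line \<alpha> \<beta> F \<noteq> 0"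
    and cop: "coprime (on_line \<alpha> \<beta> F) (on_line \<alpha> \<beta> G)"
begin

abbreviation "x \<equiv> line_form \<alpha> \<beta>"
abbreviation "bar \<equiv> on_line \<alpha> \<beta>"

lemma degG: "degree (bar G) \<le> d"
  by (rule degree_on_line_le[OF G])

text \<open>A Bezout representation of the restriction of \<open>g\<close> is normalised by reducing
  the coefficient of \<open>G\<close> modulo \<open>F\<close>, to degree at most d - 1. Its product
  with \<open>G\<close> then has degree at most 2d - 1, whence the bound on \<open>n\<close>; the
  coefficient of \<open>F\<close> is forced into degree at most n - d because \<open>F\<close>
  restricts to degree exactly d. Now all terms can be lifted to forms.\<close>

lemma decompose:
  assumes g: "homogeneous n g" and n: "2 * d - 1 \<le> n"
  obtains g' P Q where "g = x * g' + F * P + G * Q" "homogeneous (n - 1) g'" 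
    "homogeneous (n - d) P" "homogeneous (n - d) Q"
proof -
  obtain a0 b0 where ab0: "bezout_coefficients (bar F) (bar G) = (a0, b0)" by (rule prod.exhaust)
  have 1: "a0 * bar F + b0 * bar G = 1"
    using bezout_coefficients[OF ab0] cop by simp
  define b where "b = (b0 * bar g) mod bar F"
  define a where "a = a0 * bar g + bar G * ((b0 * bar g) div bar F)"
  have "a * bar F + b * bar G = a0 * bar g * bar F + bar G * ((b0 * bar g) div bar F * bar F + (b0 * bar g) mod bar F)"
    unfolding a_def b_def by (simp only: ring_distribs mult_ac add_ac)
  also have "\<dots> = a0 * bar g * bar F + bar G * (b0 * bar g)"
    by (simp only: div_mult_mod_eq)
  also have "\<dots> = (a0 * bar F + b0 * bar G) * bar g"
    by (simp add: algebra_simps)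
  finally have ab: "a * bar F + b * bar G = bar g" using 1 by simp
  have degb: "degree b \<le> d - 1"
    using degree_mod_less[OF F0, of "b0 * bar g"] d degF unfolding b_def by auto
  have "degree (a * bar F) \<le> n"
  proof -
    have "a * bar F = bar g - b * bar G" using ab by (simp add: algebra_simps)
    moreover have "degree (b * bar G) \<le> n"
      using degree_mult_le[of b "bar G"] degb degG n d by linarith
    ultimately show ?thesis using degree_on_line_le[OF g] by (simp add: degree_diff_le)
  qed
  then have dega: "degree a \<le> n - d"
    using F0 degF by (cases "a = 0") (auto simp: degree_mult_eq)
  let ?P = "form_lift (n - d) a" and ?Q = "form_lift (n - d) b"
  have dn: "d \<le> n" "d - 1 \<le> n - d" using n d by auto
  have "bar (g - F * ?P - G * ?Q) = 0"
    using dega degb dn ab by (simp add: on_line_simps on_line_form_lift algebra_simps)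
  moreover have "homogeneous n (g - F * ?P - G * ?Q)"
    by (intro homogeneous_diff g homogeneous_mult'[OF F homogeneous_form_lift]
        homogeneous_mult'[OF G homogeneous_form_lift]) (use dn in auto)
  ultimately obtain g' where "g - F * ?P - G * ?Q = x * g'" "homogeneous (n - 1) g'"
    using line_form_factor by metis
  then show ?thesis using homogeneous_form_lift by (intro that[of g' ?P ?Q]) (auto simp: algebra_simps)
qed

text \<open>This is regularity of \<open>x\<close> modulo \<open>(F, G)\<close>. The restrictions of
  \<open>P\<close> and \<open>Q\<close> form a syzygy of coprime polynomials, hence a multiple
  \<open>c\<close> of the trivial one. Subtracting the lifted trivial syzygy leaves coefficients
  divisible by \<open>x\<close>.\<close>

lemma cancel:
  assumes n: "2 * d \<le> n + 1" and P: "homogeneous (n + 1 - d) P" and Q: "homogeneous (n + 1 - d) Q"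
    and eq: "x * y = F * P + G * Q"
  obtains P' Q' where "y = F * P' + G * Q'"
proof -
  have 0: "bar F * bar P + bar G * bar Q = 0"
    using arg_cong[OF eq, of bar] by (simp add: on_line_simps on_line_line_form)
  then have "bar F dvd bar G * bar Q" by (metis add_eq_0_iff dvd_minus_iff dvd_triv_left)
  then have "bar F dvd bar Q" using cop by (simp add: coprime_dvd_mult_right_iff)
  then obtain c where c: "bar Q = bar F * c" by (elim dvdE)
  have "bar F * (bar P + bar G * c) = 0" using 0 c by (simp add: algebra_simps)
  then have c': "bar P = - (bar G * c)" using F0 by (simp add: add_eq_0_iff2)
  have degc: "degree c \<le> n + 1 - 2 * d"
  proof (cases "c = 0")
    case False
    then have "d + degree c = degree (bar Q)" using c F0 degF by (simp add: degree_mult_eq)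
    then show ?thesis using degree_on_line_le[OF Q, of \<alpha> \<beta>] by simp
  qed simp
  let ?C = "form_lift (n + 1 - 2 * d) c"
  have C: "bar ?C = c" by (rule on_line_form_lift[OF degc])
  have "homogeneous (n + 1 - d) (P + G * ?C)" "homogeneous (n + 1 - d) (Q - F * ?C)"
    by (intro homogeneous_add homogeneous_diff P Q homogeneous_mult'[OF G homogeneous_form_lift]
        homogeneous_mult'[OF F homogeneous_form_lift]; use n in simp)+
  moreover have "bar (P + G * ?C) = 0" "bar (Q - F * ?C) = 0"
    using c c' C by (simp_all add: on_line_simps)
  ultimately obtain P' Q' where "P + G * ?C = x * P'" "Q - F * ?C = x * Q'"
    using line_form_factor by metis
  then have P': "P = x * P' - G * ?C" and Q': "Q = x * Q' + F * ?C" by (simp_all add: algebra_simps)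
  have "x * y = x * (F * P' + G * Q')" unfolding eq P' Q' by (simp add: algebra_simps)
  then show ?thesis using that line_form_nonzero by (metis mult_left_cancel)
qed

text \<open>In a representation of \<open>x * y\<close> the coefficients have degree at least n + 1
  - d, hence at least 2d - 1, so \<open>decompose\<close> applies to each. Collecting the parts
  divisible by \<open>x\<close> gives an element of \<open>J\<close> that agrees with
  \<open>y\<close> up to something which \<open>x\<close> multiplies into \<open>(F, G)\<close>, and
  \<open>cancel\<close> finishes.\<close>

lemma injective_mod_ideal:
  assumes hom: "\<forall>i<m. homogeneous (e i) (f i) \<and> e i \<le> d"
    and FJ: "F \<in> gen_ideal m f" and GJ: "G \<in> gen_ideal m f"
    and y: "homogeneous n y" "x * y \<in> gen_ideal m f" and n: "3 * d - 2 \<le> n"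
  shows "y \<in> gen_ideal m f"
proof -
  have xy: "homogeneous (n + 1) (x * y)" using homogeneous_mult[OF homogeneous_line_form y(1)] by simp
  have hom': "\<forall>i<m. homogeneous (e i) (f i)" using hom by blast
  obtain g where g: "x * y = (\<Sum>i<m. g i * f i)" "\<And>i. e i \<le> n + 1 \<Longrightarrow> homogeneous (n + 1 - e i) (g i)"
      "\<And>i. n + 1 < e i \<Longrightarrow> g i = 0"
    by (rule gen_ideal_homogeneousE[OF hom' y(2) xy]) blast
  define D where "D = (\<lambda>i g' P Q. g i = x * g' + F * P + G * Q \<and>
    homogeneous (n + 1 - e i - d) P \<and> homogeneous (n + 1 - e i - d) Q)"
  have "\<exists>g' P Q. i < m \<longrightarrow> D i g' P Q" for i
  proof (cases "i < m")
    case True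
    then have "e i \<le> d" using hom by simp
    then have "e i \<le> n + 1" "2 * d - 1 \<le> n + 1 - e i" using n d by auto
    then obtain g' P Q where "D i g' P Q" unfolding D_def by (rule decompose[OF g(2)]) blast
    then show ?thesis by blast
  qed simp
  then obtain g' P Q where D: "\<And>i. i < m \<Longrightarrow> D i (g' i) (P i) (Q i)" by metis
  then have dec: "\<And>i. i < m \<Longrightarrow> g i = x * g' i + F * P i + G * Q i"
    and PQ: "\<And>i. i < m \<Longrightarrow> homogeneous (n + 1 - e i - d) (P i)" "\<And>i. i < m \<Longrightarrow> homogeneous (n + 1 - e i - d) (Q i)"
    unfolding D_def by blast+
  let ?g = "\<Sum>i<m. g' i * f i" and ?P = "\<Sum>i<m. P i * f i" and ?Q = "\<Sum>i<m. Q i * f i"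
  have "x * y = (\<Sum>i<m. (x * g' i + F * P i + G * Q i) * f i)"
    unfolding g(1) by (rule sum.cong) (use dec in auto)
  also have "\<dots> = x * ?g + F * ?P + G * ?Q"
    by (simp add: ring_distribs sum.distrib sum_distrib_left mult.assoc)
  finally have eq: "x * (y - ?g) = F * ?P + G * ?Q" by (simp add: algebra_simps)
  have deg: "n + 1 - e i - d + e i = n + 1 - d" if "i < m" for i
  proof -
    have "e i \<le> d" using hom that by simp
    then show ?thesis using n d by auto
  qed
  have hP: "homogeneous (n + 1 - d) ?P"
  proof (rule homogeneous_sum)
    fix i assume "i \<in> {..<m}"
    then have i: "i < m" by simp
    show "homogeneous (n + 1 - d) (P i * f i)"
      by (rule homogeneous_mult'[OF PQ(1)[OF i] hom'[rule_format, OF i] deg[OF i]])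
  qed
  have hQ: "homogeneous (n + 1 - d) ?Q"
  proof (rule homogeneous_sum)
    fix i assume "i \<in> {..<m}"
    then have i: "i < m" by simp
    show "homogeneous (n + 1 - d) (Q i * f i)"
      by (rule homogeneous_mult'[OF PQ(2)[OF i] hom'[rule_format, OF i] deg[OF i]])
  qed
  have "2 * d \<le> n + 1" using n d by linarith
  then obtain P' Q' where "y - ?g = F * P' + G * Q'" using cancel[OF _ hP hQ eq] by blast
  then have "y = ?g + (P' * F + Q' * G)" by (simp add: algebra_simps)
  then show ?thesis
    using gen_ideal_add[OF gen_idealI[of ?g g' f m] gen_ideal_add[OF gen_ideal_mult[OF FJ] gen_ideal_mult[OF GJ]]]
    by simp
qed

end

subsection \<open>Descent from an infinite extension field\<close>

abbreviation const_fract :: "'a::field \<Rightarrow> 'a poly fract" where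
  "const_fract c \<equiv> to_fract [:c:]"

lemma const_fract_simps:
  "const_fract (a + b) = const_fract a + const_fract b" "const_fract (a * b) = const_fract a * const_fract b"
  "const_fract 1 = 1"
proof -
  show "const_fract (a + b) = const_fract a + const_fract b" unfolding to_fract_add[symmetric] by simp
  show "const_fract (a * b) = const_fract a * const_fract b" unfolding to_fract_mult[symmetric] by simp
  show "const_fract 1 = 1" unfolding one_pCons[symmetric] by simp
qed

lemma infinite_poly_fract: "infinite (UNIV :: 'a::field poly fract set)"
proof
  assume "finite (UNIV :: 'a poly fract set)"
  then have "finite (range (\<lambda>n. to_fract (monom (1::'a) n)))" by (rule finite_subset[rotated]) simp
  moreover have "inj (\<lambda>n. to_fract (monom (1::'a) n))"
    by (rule injI, drule iffD1[OF to_fract_eq_iff], drule arg_cong[of _ _ degree]) (simp add: degree_monom_eq)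
  ultimately have "finite (UNIV :: nat set)" by (rule finite_imageD)
  then show False by simp
qed

text \<open>The element 1 extends to a basis of \<open>K\<close> over \<open>k\<close>; the
  functional is prescribed on it.\<close>

lemma exists_retraction:
  obtains \<pi> :: "'a::field poly fract \<Rightarrow> 'a"
  where "additive_map \<pi>" "\<And>c y. \<pi> (const_fract c * y) = c * \<pi> y" "\<pi> 1 = 1"
proof -
  let ?s = "\<lambda>c (y :: 'a poly fract). const_fract c * y"
  interpret vector_space_pair ?s "(*) :: 'a \<Rightarrow> 'a \<Rightarrow> 'a"
    by standard (simp_all only: const_fract_simps ring_distribs mult.assoc mult_1_left)
  have "vs1.independent {1}" by simp
  then obtain g where "Vector_Spaces.linear ?s (*) g" "\<forall>y\<in>{1}. g y = 1"
    using linear_independent_extend[of "{1}" "\<lambda>_. 1"] by blast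
  then show ?thesis by (intro that[of g]) (auto simp: Vector_Spaces.linear_iff additive_map_def)
qed

lemma homogeneous_map: "additive_map h \<Longrightarrow> homogeneous n p \<Longrightarrow> homogeneous n (Poly_Mapping.map h p)"
  unfolding homogeneous_iff by (metis lookup_map_additive additive_map_0)

lemma map_var_poly: "h 0 = 0 \<Longrightarrow> h 1 = 1 \<Longrightarrow> Poly_Mapping.map h (var_poly y) = var_poly y"
  by (simp add: var_poly_def)

text \<open>In the second statement \<open>u \<mapsto> p\<close>, \<open>t \<mapsto> -q\<close>, \<open>s \<mapsto> r\<close> defines a homomorphism from the maximal ideal to \<open>T/J\<close>,
  and the conclusion says that it is multiplication by \<open>w\<close>. With \<open>\<phi>\<close> the value at \<open>x\<close>, \<open>w\<close> is found by dividing
  \<open>\<phi>\<close> by \<open>x\<close> modulo \<open>J\<close>.\<close>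

theorem saturation_bounds:
  fixes f :: "nat \<Rightarrow> 'a::field poly3"
  assumes d: "1 \<le> d" and hom: "\<forall>i<m. homogeneous (e i) (f i) \<and> e i \<le> d"
    and gcd1: "\<And>g. (\<forall>i<m. g dvd f i) \<Longrightarrow> g dvd 1"
    and n: "3 * d - 2 \<le> n"
  shows "homogeneous n a \<Longrightarrow> (\<And>v. var_poly v * a \<in> gen_ideal m f) \<Longrightarrow> a \<in> gen_ideal m f"
    and "homogeneous n p \<Longrightarrow> homogeneous n q \<Longrightarrow> homogeneous n r \<Longrightarrow>
      var_poly Tv * p + var_poly U * q \<in> gen_ideal m f \<Longrightarrow>
      var_poly U * r - var_poly S * p \<in> gen_ideal m f \<Longrightarrow>
      - var_poly S * q - var_poly Tv * r \<in> gen_ideal m f \<Longrightarrow>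
      \<exists>w. homogeneous (n - 1) w \<and> p - var_poly U * w \<in> gen_ideal m f \<and>
        q + var_poly Tv * w \<in> gen_ideal m f \<and> r - var_poly S * w \<in> gen_ideal m f"
proof -
  let ?K = "Poly_Mapping.map const_fract :: 'a poly3 \<Rightarrow> 'a poly fract poly3"
  obtain \<pi> :: "'a poly fract \<Rightarrow> 'a" where \<pi>: "additive_map \<pi>" "\<And>c y. \<pi> (const_fract c * y) = c * \<pi> y" "\<pi> 1 = 1"
    by (rule exists_retraction) blast
  have ac: "additive_map (const_fract :: 'a \<Rightarrow> _)" by (simp only: additive_map_def const_fract_simps simp_thms)
  have ai: "additive_map (\<lambda>y :: 'a. y)" "additive_map (\<lambda>y :: 'a poly fract. y)" by (simp_all add: additive_map_def)
  have Kid: "Poly_Mapping.map (\<lambda>y. y) p = p" for p :: "'b::{comm_ring_1} poly3"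
    by (rule poly_mapping_eqI) (simp add: lookup_map_additive additive_map_def)
  have K_mult: "?K (p * q) = ?K p * ?K q" for p q
    using map_mult_semilinear[OF ac ai(1) ac, of p q] by (simp only: Kid const_fract_simps simp_thms)
  have \<pi>_mult: "Poly_Mapping.map \<pi> (?K p * q) = p * Poly_Mapping.map \<pi> q" for p q
    using map_mult_semilinear[OF \<pi>(1) ac ai(1), of p q] \<pi>(2) by (simp add: Kid)
  have \<pi>K: "Poly_Mapping.map \<pi> (?K p) = p" for p
    using \<pi>_mult[of p 1] \<pi>(3) additive_map_0[OF \<pi>(1)] map_single[of "1 :: 'a poly fract" \<pi> "0 :: var \<Rightarrow>\<^sub>0 nat"] by simp
  have K_var: "?K (var_poly y) = var_poly y" for y by (rule map_var_poly) (simp_all flip: one_pCons)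
  note K_add = map_coeffs_add[OF ac] and \<pi>_add = map_coeffs_add[OF \<pi>(1)]
  have K_diff: "?K (p - q) = ?K p - ?K q" for p q using K_add[of "p - q" q] by (simp add: algebra_simps)
  have \<pi>_diff: "Poly_Mapping.map \<pi> (p - q) = Poly_Mapping.map \<pi> p - Poly_Mapping.map \<pi> q" for p q
    using \<pi>_add[of "p - q" q] by (simp add: algebra_simps)
  let ?f = "\<lambda>i. ?K (f i)"
  let ?J = "gen_ideal m ?f"
  have KJ: "?K p \<in> ?J" if p: "p \<in> gen_ideal m f" for p
  proof -
    obtain g where "p = (\<Sum>i<m. g i * f i)" using p by (rule gen_idealE)
    then show ?thesis by (intro gen_idealI[of _ "\<lambda>i. ?K (g i)"]) (simp add: map_coeffs_sum[OF ac] K_mult)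
  qed
  \<comment> \<open>As the retraction is linear over \<open>T\<close> and fixes the generators, the
    extended ideal contracts to the original one.\<close>
  have \<pi>J: "Poly_Mapping.map \<pi> p \<in> gen_ideal m f" if p: "p \<in> ?J" for p
  proof -
    obtain g where "p = (\<Sum>i<m. g i * ?f i)" using p by (rule gen_idealE)
    then show ?thesis
      by (intro gen_idealI[of _ "\<lambda>i. Poly_Mapping.map \<pi> (g i)"])
         (simp add: map_coeffs_sum[OF \<pi>(1)] \<pi>_mult mult.commute[of _ "?K _"] mult.commute[of _ "f _"])
  qed
  have homK: "\<forall>i<m. homogeneous (e i) (?f i) \<and> e i \<le> d" using hom homogeneous_map[OF ac] by blast
  have hom': "\<forall>i<m. homogeneous (e i) (f i)" using hom by blast
  obtain n1 h1 where h1: "h1 \<noteq> 0" "homogeneous n1 h1" "h1 \<in> gen_ideal m f"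
    "\<And>\<mu>. Poly_Mapping.lookup h1 \<mu> \<noteq> 0 \<Longrightarrow> Poly_Mapping.lookup \<mu> U = 0"
    using ideal_contains_form_without_var[OF hom' gcd1] by blast
  obtain n2 h2 where h2: "h2 \<noteq> 0" "homogeneous n2 h2" "h2 \<in> gen_ideal m f"
    "\<And>\<mu>. Poly_Mapping.lookup h2 \<mu> \<noteq> 0 \<Longrightarrow> Poly_Mapping.lookup \<mu> S = 0"
    using ideal_contains_form_without_var[OF hom' gcd1] by blast
  have nz: "?K p \<noteq> 0" if "p \<noteq> 0" for p using that \<pi>K[of p] by (metis map_coeffs_0)
  have lK: "Poly_Mapping.lookup (?K p) \<mu> \<noteq> 0 \<longleftrightarrow> Poly_Mapping.lookup p \<mu> \<noteq> 0" for p \<mu>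
    by (simp add: lookup_map_additive[OF ac])
  \<comment> \<open>A generator not divisible by t has a monomial free of t, so it does not vanish
    identically on t = 0. This is what the choice of \<alpha> requires.\<close>
  have "\<not> (\<forall>i<m. var_poly Tv dvd f i)"
  proof
    assume "\<forall>i<m. var_poly Tv dvd f i"
    then have "(var_poly Tv :: 'a poly3) dvd 1" by (rule gcd1)
    then show False by (simp add: var_dvd_iff ring_mapD[OF ring_map_var_zero])
  qed
  then obtain i0 where i0: "i0 < m" "\<not> var_poly Tv dvd f i0" by blast
  have "\<exists>\<mu>. Poly_Mapping.lookup (f i0) \<mu> \<noteq> 0 \<and> Poly_Mapping.lookup \<mu> Tv = 0"
  proof (rule ccontr)
    assume "\<nexists>\<mu>. Poly_Mapping.lookup (f i0) \<mu> \<noteq> 0 \<and> Poly_Mapping.lookup \<mu> Tv = 0"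
    then have "mon_eval (\<lambda>y. if y = Tv then 0 else var_poly y) \<mu> = (0 :: 'a poly3)"
      if "\<mu> \<in> Poly_Mapping.keys (f i0)" for \<mu>
      using that by (auto simp: mon_eval_def in_keys_iff)
    then have "var_zero Tv (f i0) = 0" by (simp add: var_zero_def poly3_eval_def)
    then show False using i0(2) by (simp add: var_dvd_iff)
  qed
  then obtain \<mu> where \<mu>: "Poly_Mapping.lookup (f i0) \<mu> \<noteq> 0" "Poly_Mapping.lookup \<mu> Tv = 0" by blast
  have K\<mu>: "Poly_Mapping.lookup (?K (f i0)) \<mu> \<noteq> 0"
    and Kh1: "\<And>\<mu>. Poly_Mapping.lookup (?K h1) \<mu> \<noteq> 0 \<Longrightarrow> Poly_Mapping.lookup \<mu> U = 0"
    and Kh2: "\<And>\<mu>. Poly_Mapping.lookup (?K h2) \<mu> \<noteq> 0 \<Longrightarrow> Poly_Mapping.lookup \<mu> S = 0"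
    unfolding lK using \<mu>(1) h1(4) h2(4) by blast+
  obtain \<alpha> \<beta> F G where FG: "F \<in> ?J" "G \<in> ?J" "homogeneous d F" "homogeneous d G"
    "degree (on_line \<alpha> \<beta> F) = d" "on_line \<alpha> \<beta> F \<noteq> 0" "coprime (on_line \<alpha> \<beta> F) (on_line \<alpha> \<beta> G)"
    by (rule general_line[OF infinite_poly_fract homK i0(1) K\<mu> \<mu>(2)
          homogeneous_map[OF ac h1(2)] nz[OF h1(1)] KJ[OF h1(3)] Kh1
          homogeneous_map[OF ac h2(2)] nz[OF h2(1)] KJ[OF h2(3)] Kh2])
  interpret line_ci \<alpha> \<beta> F G d by unfold_locales (use FG d in auto)
  note inj = injective_mod_ideal[OF homK FG(1,2) _ _ n]
  let ?s = "var_poly S :: 'a poly fract poly3" and ?t = "var_poly Tv :: 'a poly fract poly3"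
    and ?u = "var_poly U :: 'a poly fract poly3"
  let ?a = "Poly_Mapping.single 0 \<alpha> :: 'a poly fract poly3" and ?b = "Poly_Mapping.single 0 \<beta> :: 'a poly fract poly3"
  show "a \<in> gen_ideal m f" if a: "homogeneous n a" "\<And>v. var_poly v * a \<in> gen_ideal m f"
  proof -
    have v: "var_poly v * ?K a \<in> ?J" for v using KJ[OF a(2)[of v]] by (simp add: K_mult K_var)
    have "x * ?K a = ?u * ?K a - ?a * (?s * ?K a) - ?b * (?t * ?K a)"
      by (simp add: line_form_def algebra_simps)
    then have "x * ?K a \<in> ?J" by (simp only:) (intro gen_ideal_diff gen_ideal_mult v)
    then have "?K a \<in> ?J" using inj[OF homogeneous_map[OF ac a(1)]] by blast
    then show ?thesis using \<pi>J \<pi>K by metis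
  qed
  show "\<exists>w. homogeneous (n - 1) w \<and> p - var_poly U * w \<in> gen_ideal m f \<and>
        q + var_poly Tv * w \<in> gen_ideal m f \<and> r - var_poly S * w \<in> gen_ideal m f"
    if h: "homogeneous n p" "homogeneous n q" "homogeneous n r"
      and J: "var_poly Tv * p + var_poly U * q \<in> gen_ideal m f" "var_poly U * r - var_poly S * p \<in> gen_ideal m f"
        "- var_poly S * q - var_poly Tv * r \<in> gen_ideal m f"
  proof -
    let ?p = "?K p" and ?q = "?K q" and ?r = "?K r"
    note hK = homogeneous_map[OF ac h(1)] homogeneous_map[OF ac h(2)] homogeneous_map[OF ac h(3)]
    have J1: "?t * ?p + ?u * ?q \<in> ?J" using KJ[OF J(1)] by (simp add: K_add K_mult K_var)
    have J2: "?u * ?r - ?s * ?p \<in> ?J" using KJ[OF J(2)] by (simp add: K_diff K_mult K_var)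
    have "?s * q' + ?t * r' \<in> ?J" if "q' = ?q" "r' = ?r" for q' r'
    proof -
      have "var_poly S * q + var_poly Tv * r \<in> gen_ideal m f"
        using gen_ideal_uminus[OF J(3)] by (simp add: algebra_simps)
      from KJ[OF this] show ?thesis using that by (simp add: K_add K_mult K_var)
    qed
    then have J3: "?s * ?q + ?t * ?r \<in> ?J" by blast
    have n2: "2 * d - 1 \<le> n" using n d by arith
    define \<phi> where "\<phi> = ?p - ?a * ?r + ?b * ?q"
    have h\<phi>: "homogeneous n \<phi>" unfolding \<phi>_def
      by (intro homogeneous_add homogeneous_diff hK homogeneous_mult'[OF homogeneous_const]) (use hK in auto)
    obtain w P Q where w: "\<phi> = x * w + F * P + G * Q" "homogeneous (n - 1) w"
      using decompose[OF h\<phi>] n2 by metis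
    have n1: "Suc 0 + (n - 1) = n" using n d by simp
    have hw: "homogeneous n (var_poly v * w)" for v
      by (rule homogeneous_mult'[OF homogeneous_var_poly w(2) n1])
    have xw: "x * w = \<phi> - P * F - Q * G" using w(1) by (simp add: algebra_simps)
    have PQJ: "P * F + Q * G \<in> ?J" by (intro gen_ideal_add gen_ideal_mult FG)
    \<comment> \<open>Multiplying by \<open>x\<close> replaces \<open>x * w\<close> by \<phi> up to
      \<open>F\<close> and \<open>G\<close>; what remains are multiples of the three relations
      assumed to lie in \<open>J\<close>. Injectivity of \<open>x\<close> in degree \<open>n\<close>
      then removes the factor.\<close>
    have eq: "x * (?p - ?u * w) = ?a * (?u * ?r - ?s * ?p) - ?b * (?t * ?p + ?u * ?q) + ?u * (P * F + Q * G)"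
      "x * (?q + ?t * w) = ?a * (- (?s * ?q + ?t * ?r)) + (?t * ?p + ?u * ?q) - ?t * (P * F + Q * G)"
      "x * (?r - ?s * w) = (?u * ?r - ?s * ?p) - ?b * (?s * ?q + ?t * ?r) + ?s * (P * F + Q * G)"
    proof -
      have *: "x * (y + z * w) = x * y + z * (x * w)" "x * (y - z * w) = x * y - z * (x * w)" for y z
        by (simp_all add: algebra_simps)
      show "x * (?p - ?u * w) = ?a * (?u * ?r - ?s * ?p) - ?b * (?t * ?p + ?u * ?q) + ?u * (P * F + Q * G)"
        "x * (?q + ?t * w) = ?a * (- (?s * ?q + ?t * ?r)) + (?t * ?p + ?u * ?q) - ?t * (P * F + Q * G)"
        "x * (?r - ?s * w) = (?u * ?r - ?s * ?p) - ?b * (?s * ?q + ?t * ?r) + ?s * (P * F + Q * G)"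
        unfolding * xw unfolding \<phi>_def line_form_def by (simp_all add: algebra_simps)
    qed
    have "x * (?p - ?u * w) \<in> ?J" unfolding eq(1)
      by (rule gen_ideal_add[OF gen_ideal_diff[OF gen_ideal_mult[OF J2] gen_ideal_mult[OF J1]] gen_ideal_mult[OF PQJ]])
    from inj[OF homogeneous_diff[OF hK(1) hw] this] have "?p - ?u * w \<in> ?J" .
    moreover have "x * (?q + ?t * w) \<in> ?J" unfolding eq(2)
      by (rule gen_ideal_diff[OF gen_ideal_add[OF gen_ideal_mult[OF gen_ideal_uminus[OF J3]] J1] gen_ideal_mult[OF PQJ]])
    from inj[OF homogeneous_add[OF hK(2) hw] this] have "?q + ?t * w \<in> ?J" .
    moreover have "x * (?r - ?s * w) \<in> ?J" unfolding eq(3)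
      by (rule gen_ideal_add[OF gen_ideal_diff[OF J2 gen_ideal_mult[OF J3]] gen_ideal_mult[OF PQJ]])
    from inj[OF homogeneous_diff[OF hK(3) hw] this] have "?r - ?s * w \<in> ?J" .
    ultimately have "Poly_Mapping.map \<pi> (?p - ?u * w) \<in> gen_ideal m f"
      "Poly_Mapping.map \<pi> (?q + ?t * w) \<in> gen_ideal m f" "Poly_Mapping.map \<pi> (?r - ?s * w) \<in> gen_ideal m f"
      by (blast intro: \<pi>J)+
    moreover have "Poly_Mapping.map \<pi> (var_poly v * w) = var_poly v * Poly_Mapping.map \<pi> w" for v
      using \<pi>_mult[of "var_poly v" w] by (simp add: K_var)
    ultimately show ?thesis
      using homogeneous_map[OF \<pi>(1) w(2)]
      by (intro exI[of _ "Poly_Mapping.map \<pi> w"]) (simp add: \<pi>_add \<pi>_diff \<pi>K)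
  qed
qed

subsection \<open>Dimensions of graded pieces\<close>

lemma pscale_eq: "pscale c p = Poly_Mapping.single 0 c * p"
  unfolding pscale_def by (rule mult_map_scale_conv_mult)

lemma vector_space_pscale: "vector_space (pscale :: 'a::field \<Rightarrow> _)"
  by standard (simp_all add: pscale_eq single_add ring_distribs mult_single flip: mult.assoc)

lemma vector_space_cscale: "vector_space (cscale :: 'a::field \<Rightarrow> _)"
  unfolding cscale_def[abs_def] by (rule vector_space_pointwise[OF vector_space_pscale])

interpretation PP: vector_space_pair pscale pscale
  by (simp add: vector_space_pair_def vector_space_pscale)

interpretation CC: vector_space_pair cscale cscale
  by (simp add: vector_space_pair_def vector_space_cscale)

interpretation CP: vector_space_pair cscale pscale
  by (simp add: vector_space_pair_def vector_space_cscale vector_space_pscale)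

lemma linear_mult: "Vector_Spaces.linear pscale pscale (\<lambda>p. g * p)"
  by (subst Vector_Spaces.linear_iff) (simp add: vector_space_pscale pscale_eq ring_distribs mult_ac)

definition monomials :: "nat \<Rightarrow> (var \<Rightarrow>\<^sub>0 nat) set" where
  "monomials n = {\<mu>. mon_deg \<mu> = n}"

lemma monomials_card: "finite (monomials n) \<and> card (monomials n) = (n + 2) choose 2"
proof -
  define mk :: "nat \<times> nat \<Rightarrow> var \<Rightarrow>\<^sub>0 nat" where
    "mk = (\<lambda>(i, j). Poly_Mapping.single S i + Poly_Mapping.single Tv j + Poly_Mapping.single U (n - i - j))"
  have mk: "Poly_Mapping.lookup (mk (i, j)) S = i" "Poly_Mapping.lookup (mk (i, j)) Tv = j"
    "Poly_Mapping.lookup (mk (i, j)) U = n - i - j" for i j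
    by (simp_all add: mk_def lookup_add lookup_single)
  have bij: "bij_betw mk (SIGMA i:{..n}. {..n - i}) (monomials n)"
  proof (rule bij_betw_imageI)
    show "inj_on mk (SIGMA i:{..n}. {..n - i})"
    proof (rule inj_onI)
      fix a b assume eq: "mk a = mk b"
      have "Poly_Mapping.lookup (mk (fst a, snd a)) v = Poly_Mapping.lookup (mk (fst b, snd b)) v" for v
        using eq by simp
      from this[of S] this[of Tv] show "a = b" by (cases a; cases b) (simp add: mk)
    qed
    show "mk ` (SIGMA i:{..n}. {..n - i}) = monomials n"
    proof
      show "mk ` (SIGMA i:{..n}. {..n - i}) \<subseteq> monomials n"
        by (auto simp: monomials_def mon_deg_def mk)
      show "monomials n \<subseteq> mk ` (SIGMA i:{..n}. {..n - i})"
      proof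
        fix \<mu> assume "\<mu> \<in> monomials n"
        then have n: "Poly_Mapping.lookup \<mu> S + Poly_Mapping.lookup \<mu> Tv + Poly_Mapping.lookup \<mu> U = n"
          by (simp add: monomials_def mon_deg_def)
        have "\<mu> = mk (Poly_Mapping.lookup \<mu> S, Poly_Mapping.lookup \<mu> Tv)"
        proof (rule poly_mapping_eqI)
          fix k show "Poly_Mapping.lookup \<mu> k = Poly_Mapping.lookup (mk (Poly_Mapping.lookup \<mu> S, Poly_Mapping.lookup \<mu> Tv)) k"
            using n by (cases k) (auto simp: mk)
        qed
        then show "\<mu> \<in> mk ` (SIGMA i:{..n}. {..n - i})" by (rule image_eqI) (use n in auto)
      qed
    qed
  qed
  have "card (SIGMA i:{..n}. {..n - i}) = (n + 2) choose 2"
  proof -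
    have "card (SIGMA i:{..n}. {..n - i}) = (\<Sum>i<Suc n. Suc (Suc n - Suc i))"
      by (simp add: lessThan_Suc_atMost)
    also have "\<dots> = (\<Sum>i<Suc n. Suc i)" by (rule sum.nat_diff_reindex)
    also have "\<dots> = (n + 2) choose 2" by (induction n) (simp_all add: numeral_2_eq_2)
    finally show ?thesis .
  qed
  then show ?thesis
    using bij_betw_finite[OF bij] bij_betw_same_card[OF bij] by simp
qed

definition forms :: "nat \<Rightarrow> 'a::field poly3 set" where
  "forms n = {p. homogeneous n p}"

lemma homogeneous_pscale: "homogeneous n p \<Longrightarrow> homogeneous n (pscale c p)"
  unfolding pscale_eq by (rule homogeneous_mult'[OF homogeneous_const _ add_0])

lemma subspace_forms: "PP.vs1.subspace (forms n)"
  by (rule PP.vs1.subspaceI) (simp_all add: forms_def homogeneous_add homogeneous_pscale)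

lemma forms_span: "forms n \<subseteq> PP.vs1.span ((\<lambda>\<mu>. Poly_Mapping.single \<mu> 1) ` monomials n)"
proof
  fix p :: "'a poly3" assume p: "p \<in> forms n"
  have "(\<Sum>\<mu>\<in>Poly_Mapping.keys p. Poly_Mapping.single \<mu> (Poly_Mapping.lookup p \<mu>))
      \<in> PP.vs1.span ((\<lambda>\<mu>. Poly_Mapping.single \<mu> 1) ` monomials n)"
  proof (rule PP.vs1.span_sum)
    fix \<mu> assume "\<mu> \<in> Poly_Mapping.keys p"
    then have "\<mu> \<in> monomials n" using p by (simp add: forms_def homogeneous_def monomials_def)
    moreover have "Poly_Mapping.single \<mu> (Poly_Mapping.lookup p \<mu>) = pscale (Poly_Mapping.lookup p \<mu>) (Poly_Mapping.single \<mu> 1)"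
      by (simp add: pscale_eq mult_single)
    ultimately show "Poly_Mapping.single \<mu> (Poly_Mapping.lookup p \<mu>) \<in> PP.vs1.span ((\<lambda>\<mu>. Poly_Mapping.single \<mu> 1) ` monomials n)"
      by (simp add: PP.vs1.span_scale PP.vs1.span_base)
  qed
  then show "p \<in> PP.vs1.span ((\<lambda>\<mu>. Poly_Mapping.single \<mu> 1) ` monomials n)" by (simp add: poly_mapping_sum_single)
qed

lemma fin_dim_forms: "fin_dim pscale (forms n)"
  unfolding fin_dim_def
  by (rule exI[of _ "(\<lambda>\<mu>. Poly_Mapping.single \<mu> 1) ` monomials n"]) (simp add: forms_span monomials_card)

lemma dim_forms: "PP.vs1.dim (forms n :: 'a::field poly3 set) = (n + 2) choose 2"
proof -
  let ?B = "(\<lambda>\<mu>. Poly_Mapping.single \<mu> (1::'a)) ` monomials n"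
  have inj: "inj_on (\<lambda>\<mu>. Poly_Mapping.single \<mu> (1::'a)) (monomials n)"
    by (rule inj_onI, drule arg_cong[of _ _ Poly_Mapping.keys]) simp
  have ind: "PP.vs1.independent ?B"
  proof (rule PP.vs1.independent_if_scalars_zero)
    show "finite ?B" using monomials_card by blast
    fix c :: "'a poly3 \<Rightarrow> 'a" and b assume c: "(\<Sum>b\<in>?B. pscale (c b) b) = 0" and "b \<in> ?B"
    then obtain \<mu> where \<mu>: "\<mu> \<in> monomials n" "b = Poly_Mapping.single \<mu> 1" by blast
    have "0 = Poly_Mapping.lookup (\<Sum>b\<in>?B. pscale (c b) b) \<mu>" by (simp add: c)
    also have "\<dots> = (\<Sum>\<nu>\<in>monomials n. Poly_Mapping.lookup (pscale (c (Poly_Mapping.single \<nu> 1)) (Poly_Mapping.single \<nu> 1)) \<mu>)"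
      by (simp add: lookup_sum sum.reindex[OF inj])
    also have "\<dots> = (\<Sum>\<nu>\<in>monomials n. if \<nu> = \<mu> then c b else 0)"
      by (rule sum.cong) (auto simp: pscale_eq mult_single lookup_single when_def \<mu>(2))
    also have "\<dots> = c b" using \<mu>(1) monomials_card[of n] by (simp add: sum.delta)
    finally show "c b = 0" by simp
  qed
  have "?B \<subseteq> forms n" by (auto simp: forms_def monomials_def intro: homogeneous_single)
  moreover have "card ?B = (n + 2) choose 2" using card_image[OF inj] monomials_card[of n] by simp
  ultimately show ?thesis by (rule PP.vs1.dim_unique[OF _ forms_span ind])
qed

lemma subspace_ideal_piece: "PP.vs1.subspace (ideal_piece m f n)"
  by (rule PP.vs1.subspaceI)
     (simp_all add: ideal_piece_def homogeneous_add homogeneous_pscale gen_ideal_add, simp add: pscale_eq gen_ideal_mult)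

lemma ideal_piece_subset_forms: "ideal_piece m f n \<subseteq> forms n"
  by (auto simp: ideal_piece_def forms_def)

lemma fin_dim_ideal_piece: "fin_dim pscale (ideal_piece m f n)"
  by (rule PP.vs1.fin_dim_subset[OF ideal_piece_subset_forms fin_dim_forms])

lemma hilb_le:
  fixes f :: "nat \<Rightarrow> 'a::field poly3"
  shows "hilb m f n \<le> (n + 2) choose 2"
  unfolding hilb_def dim_forms[where 'a = 'a, symmetric]
  by (rule PP.vs1.dim_mono_fin[OF ideal_piece_subset_forms fin_dim_forms])

lemma ideal_piece_mult:
  "p \<in> ideal_piece m f n \<Longrightarrow> homogeneous k g \<Longrightarrow> k + n = l \<Longrightarrow> g * p \<in> ideal_piece m f l"
  by (auto simp: ideal_piece_def intro: gen_ideal_mult homogeneous_mult')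

lemma hilb_Suc: "hilb m f n \<le> hilb m f (Suc n)"
  unfolding hilb_def
  by (rule PP.dim_le_of_inj[OF linear_mult[of "var_poly S"] subspace_ideal_piece fin_dim_ideal_piece])
     (auto intro: ideal_piece_mult[OF _ homogeneous_var_poly] fin_dim_ideal_piece)

lemma hilb_mono: "n \<le> k \<Longrightarrow> hilb m f n \<le> hilb m f k"
  using lift_Suc_mono_le[of "hilb m f"] hilb_Suc by blast

text \<open>Multiplication by \<open>g\<close> embeds all forms of degree \<open>n\<close>; this
  provides the quadratic growth of the Hilbert function.\<close>

lemma hilb_ge:
  assumes "g \<in> gen_ideal m f" "homogeneous k g" "g \<noteq> 0"
  shows "(n + 2) choose 2 \<le> hilb m f (k + n)"
  unfolding hilb_def dim_forms[where 'a = 'a, symmetric]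
proof (rule PP.dim_le_of_inj[OF linear_mult[of g] subspace_forms fin_dim_forms])
  show "(*) g ` forms n \<subseteq> ideal_piece m f (k + n)"
  proof
    fix p assume "p \<in> (*) g ` forms n"
    then obtain q where "p = q * g" "homogeneous n q" by (auto simp: forms_def mult.commute)
    then show "p \<in> ideal_piece m f (k + n)"
      using assms by (auto simp: ideal_piece_def intro: gen_ideal_mult homogeneous_mult')
  qed
qed (use assms in \<open>auto intro: fin_dim_ideal_piece\<close>)

lemma hilb_le_generators:
  assumes "\<forall>i<m. homogeneous d (f i)"
  shows "hilb m f (d + n) \<le> m * ((n + 2) choose 2)"
proof -
  let ?M = "(\<lambda>\<mu>. Poly_Mapping.single \<mu> 1) ` monomials n :: 'a poly3 set"
  let ?W = "\<Union>i<m. (\<lambda>p. f i * p) ` ?M"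
  have "ideal_piece m f (d + n) \<subseteq> PP.vs1.span ?W"
  proof
    fix p assume "p \<in> ideal_piece m f (d + n)"
    then have "p \<in> gen_ideal m f" "homogeneous (d + n) p" by (simp_all add: ideal_piece_def)
    then obtain g where g': "p = (\<Sum>i<m. g i * f i)" "\<And>i. d \<le> d + n \<Longrightarrow> homogeneous (d + n - d) (g i)"
      by (rule gen_ideal_homogeneousE[OF assms(1)]) blast
    then have g: "p = (\<Sum>i<m. g i * f i)" "\<And>i. homogeneous n (g i)" by simp_all
    have "g i * f i \<in> PP.vs1.span ?W" if "i < m" for i
    proof -
      have "g i \<in> PP.vs1.span ?M" using forms_span g(2) by (auto simp: forms_def)
      then have "f i * g i \<in> PP.vs1.span ((\<lambda>p. f i * p) ` ?M)"
        using PP.linear_span_image[OF linear_mult[of "f i"], of ?M] by blast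
      moreover have "PP.vs1.span ((\<lambda>p. f i * p) ` ?M) \<subseteq> PP.vs1.span ?W"
        by (rule PP.vs1.span_mono) (use that in blast)
      ultimately show ?thesis by (auto simp: mult.commute)
    qed
    then show "p \<in> PP.vs1.span ?W" unfolding g(1) by (intro PP.vs1.span_sum) simp
  qed
  moreover have fin: "finite ?M" using monomials_card by blast
  ultimately have "hilb m f (d + n) \<le> card ?W"
    unfolding hilb_def by (intro PP.vs1.dim_le_card) auto
  also have "\<dots> \<le> (\<Sum>i<m. card ((\<lambda>p. f i * p) ` ?M))" by (rule card_UN_le) simp
  also have "\<dots> \<le> (\<Sum>i<m. (n + 2) choose 2)"
  proof (rule sum_mono)
    fix i
    have "card ((\<lambda>p. f i * p) ` ?M) \<le> card ?M" by (rule card_image_le[OF fin])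
    also have "\<dots> \<le> card (monomials n)" by (rule card_image_le) (use monomials_card in blast)
    finally show "card ((\<lambda>p. f i * p) ` ?M) \<le> (n + 2) choose 2" using monomials_card by simp
  qed
  finally show ?thesis by simp
qed

subsection \<open>The Koszul complex\<close>

lemma finite_var: "finite (UNIV :: var set)" and card_UNIV_var: "card (UNIV :: var set) = 3"
  by (simp_all add: UNIV_var)

lemma finite_var_sets: "finite {A :: var set. P A}"
proof -
  have "finite (UNIV :: var set set)" using finite_var by (simp add: Finite_Set.finite_set)
  then show ?thesis by (rule finite_subset[OF subset_UNIV])
qed

lemma chain_piece_dim:
  fixes f :: "nat \<Rightarrow> 'a::field poly3"
  shows "CC.vs1.subspace (chain_piece m f i j) \<and> fin_dim cscale (chain_piece m f i j) \<and>
   CC.vs1.dim (chain_piece m f i j) = (if i \<le> j then (3 choose i) * hilb m f (j - i) else 0)"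
proof (cases "i \<le> j")
  case True
  have "chain_piece m f i j = {x. \<forall>A. (A \<in> {A. card A = i} \<longrightarrow> x A \<in> ideal_piece m f (j - i)) \<and>
      (A \<notin> {A. card A = i} \<longrightarrow> x A = 0)}"
    using True by (simp add: chain_piece_def)
  moreover have c: "card {A :: var set. card A = i} = 3 choose i"
    using n_subsets[of "UNIV :: var set" i] by (simp add: card_UNIV_var finite_var)
  ultimately show ?thesis
    using dim_functions[OF vector_space_pscale subspace_ideal_piece[of m f "j - i"] fin_dim_ideal_piece finite_var_sets[of "\<lambda>A. card A = i"]] True
    unfolding hilb_def cscale_def[abs_def] by (simp only: if_True c simp_thms)
next
  case False
  then have 0: "chain_piece m f i j = {0}" by (simp add: chain_piece_def fun_eq_iff set_eq_iff)
  have "fin_dim cscale {0 :: 'a chain}" unfolding fin_dim_def by (rule exI[of _ "{}"]) simp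
  then show ?thesis unfolding 0 using False CC.vs1.dim_zero_singleton by simp
qed

lemmas subspace_chain = chain_piece_dim[THEN conjunct1]
  and fin_dim_chain = chain_piece_dim[THEN conjunct2, THEN conjunct1]
  and dim_chain = chain_piece_dim[THEN conjunct2, THEN conjunct2]

lemma linear_koszul: "Vector_Spaces.linear cscale cscale koszul_d"
proof (subst Vector_Spaces.linear_iff, intro conjI allI vector_space_cscale)
  show "koszul_d (x + y) = koszul_d x + koszul_d y" for x y :: "'a chain"
    by (rule ext) (simp add: koszul_d_def ring_distribs sum.distrib)
  show "koszul_d (cscale c x) = cscale c (koszul_d x)" for c and x :: "'a chain"
    by (rule ext) (simp add: koszul_d_def cscale_def pscale_eq sum_distrib_left mult_ac)
qed

lemma koszul_values:
  "koszul_d x {} = var_poly S * x {S} + var_poly Tv * x {Tv} + var_poly U * x {U}"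
  "koszul_d x {S} = - var_poly Tv * x {S, Tv} - var_poly U * x {S, U}"
  "koszul_d x {Tv} = var_poly S * x {S, Tv} - var_poly U * x {Tv, U}"
  "koszul_d x {U} = var_poly S * x {S, U} + var_poly Tv * x {Tv, U}"
  "koszul_d x {S, Tv} = var_poly U * x UNIV"
  "koszul_d x {S, U} = - var_poly Tv * x UNIV"
  "koszul_d x {Tv, U} = var_poly S * x UNIV"
  "koszul_d x UNIV = 0"
proof -
  have D: "UNIV - {} = {S, Tv, U}" "UNIV - {S} = {Tv, U}" "UNIV - {Tv} = {S, U}" "UNIV - {U} = {S, Tv}"
    "UNIV - {S, Tv} = {U}" "UNIV - {S, U} = {Tv}" "UNIV - {Tv, U} = {S}"
    by (auto simp: UNIV_var)
  have I: "{b. b = S \<and> P b} = (if P S then {S} else {})" "{b. b = Tv \<and> P b} = (if P Tv then {Tv} else {})"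
    "{b. b = U \<and> P b} = (if P U then {U} else {})" for P by auto
  have J: "{b. (b = S \<or> b = Tv) \<and> P b} = (if P S then {S} else {}) \<union> (if P Tv then {Tv} else {})"
    "{b. (b = S \<or> b = U) \<and> P b} = (if P S then {S} else {}) \<union> (if P U then {U} else {})"
    "{b. (b = Tv \<or> b = U) \<and> P b} = (if P Tv then {Tv} else {}) \<union> (if P U then {U} else {})" for P by auto
  have K: "insert Tv {S} = {S, Tv}" "insert U {S} = {S, U}" "insert U {Tv} = {Tv, U}"
    "insert U {S, Tv} = UNIV" "insert Tv {S, U} = UNIV" "insert S {Tv, U} = UNIV"
    by (auto simp: UNIV_var)
  show "koszul_d x {} = var_poly S * x {S} + var_poly Tv * x {Tv} + var_poly U * x {U}"
    by (simp add: koszul_d_def UNIV_var)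
  show "koszul_d x {S} = - var_poly Tv * x {S, Tv} - var_poly U * x {S, U}"
    "koszul_d x {Tv} = var_poly S * x {S, Tv} - var_poly U * x {Tv, U}"
    "koszul_d x {U} = var_poly S * x {S, U} + var_poly Tv * x {Tv, U}"
    "koszul_d x {S, Tv} = var_poly U * x UNIV"
    "koszul_d x {S, U} = - var_poly Tv * x UNIV"
    "koszul_d x {Tv, U} = var_poly S * x UNIV"
    "koszul_d x UNIV = 0"
    by (simp_all add: koszul_d_def D I J K)
qed

lemma var_set_cases:
  "B = {} \<or> B = {S} \<or> B = {Tv} \<or> B = {U} \<or> B = {S, Tv} \<or> B = {S, U} \<or> B = {Tv, U} \<or> B = (UNIV :: var set)"
proof -
  have "B \<in> Pow {S, Tv, U}" using UNIV_var by blast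
  then show ?thesis unfolding UNIV_var by (auto simp: Pow_insert)
qed

lemma chainD:
  "x \<in> chain_piece m f i j \<Longrightarrow> card A = i \<Longrightarrow> i \<le> j \<Longrightarrow> x A \<in> ideal_piece m f (j - i)"
  "x \<in> chain_piece m f i j \<Longrightarrow> card A \<noteq> i \<Longrightarrow> x A = 0"
  "x \<in> chain_piece m f i j \<Longrightarrow> j < i \<Longrightarrow> x A = 0"
  by (auto simp: chain_piece_def)

subsection \<open>Vanishing of graded Betti numbers\<close>

abbreviation koszul_cycles :: "nat \<Rightarrow> (nat \<Rightarrow> 'a::field poly3) \<Rightarrow> nat \<Rightarrow> nat \<Rightarrow> 'a chain set" where
  "koszul_cycles m f i j \<equiv> {x \<in> chain_piece m f i j. koszul_d x = (\<lambda>_. 0)}"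

lemma betti_graded_eq:
  "betti_graded m f i j = CC.vs1.dim (koszul_cycles m f i j) - CC.vs1.dim (koszul_d ` chain_piece m f (Suc i) j)"
  by (simp add: betti_graded_def)

lemma rank_nullity_koszul:
  "CC.vs1.dim (chain_piece m f i j) = CC.vs1.dim (koszul_cycles m f i j) + CC.vs1.dim (koszul_d ` chain_piece m f i j)"
  using CC.rank_nullity[OF linear_koszul subspace_chain fin_dim_chain, of m f i j] by (simp add: zero_fun_def)

lemma fin_dim_cycles: "fin_dim cscale (koszul_cycles m f i j)"
  by (rule CC.vs1.fin_dim_subset[OF _ fin_dim_chain[of m f i j]]) auto

lemma fin_dim_boundaries: "fin_dim cscale (koszul_d ` chain_piece m f i j)"
  by (rule CC.fin_dim_image[OF linear_koszul fin_dim_chain])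

lemma betti_graded_exact:
  assumes "koszul_cycles m f i j \<subseteq> koszul_d ` chain_piece m f (Suc i) j"
  shows "betti_graded m f i j = 0"
  unfolding betti_graded_eq using CC.vs1.dim_mono_fin[OF assms fin_dim_boundaries] by simp

lemma betti_graded_no_cycles:
  assumes "koszul_cycles m f i j \<subseteq> {0}"
  shows "betti_graded m f i j = 0"
proof -
  have "CC.vs1.dim (koszul_cycles m f i j) \<le> card ({} :: 'a chain set)"
    by (rule CC.vs1.dim_le_card) (use assms in auto)
  then show ?thesis unfolding betti_graded_eq by simp
qed

lemma betti_graded_low: "j < i \<Longrightarrow> betti_graded m f i j = 0"
  by (rule betti_graded_no_cycles) (auto simp: chain_piece_def fun_eq_iff)

text \<open>A 3-chain has a single coefficient, which the differential multiplies by variables, so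
  no nonzero cycle exists; beyond 3 there are no index sets.\<close>

lemma betti_graded_ge_3:
  assumes "3 \<le> i"
  shows "betti_graded m f i j = 0"
proof (rule betti_graded_no_cycles, rule subsetI)
  fix x assume x: "x \<in> koszul_cycles m f i j"
  have "x A = 0" for A
  proof (cases "A = UNIV")
    case True
    have "koszul_d x {Tv, U} = 0" using x by simp
    then show ?thesis using True by (simp add: koszul_values)
  next
    case False
    then have "A \<subset> UNIV" by blast
    then have "card A \<noteq> i"
      using assms psubset_card_mono[OF finite_var, of A] card_UNIV_var by auto
    then show ?thesis using x chainD(2) by blast
  qed
  then show "x \<in> {0}" by (simp add: fun_eq_iff)
qed

lemma homogeneous_Suc_decompose:
  assumes "homogeneous (Suc n) g"
  obtains a b c :: "'a::field poly3" where "g = var_poly S * a + var_poly Tv * b + var_poly U * c"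
    "homogeneous n a" "homogeneous n b" "homogeneous n c"
proof -
  let ?P = "\<lambda>g :: 'a poly3. \<exists>a b c. g = var_poly S * a + var_poly Tv * b + var_poly U * c \<and>
    homogeneous n a \<and> homogeneous n b \<and> homogeneous n c"
  have single: "?P (Poly_Mapping.single \<mu> z)" if \<mu>: "mon_deg \<mu> = Suc n" for \<mu> z
  proof -
    have "\<exists>v. Poly_Mapping.lookup \<mu> v \<noteq> 0"
    proof (rule ccontr)
      assume "\<nexists>v. Poly_Mapping.lookup \<mu> v \<noteq> 0"
      then show False using \<mu> by (simp add: mon_deg_def)
    qed
    then obtain v where v: "Poly_Mapping.lookup \<mu> v \<noteq> 0" by blast
    define \<nu> where "\<nu> = \<mu> - Poly_Mapping.single v 1"
    have \<mu>\<nu>: "\<mu> = Poly_Mapping.single v 1 + \<nu>"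
      using v by (intro poly_mapping_eqI) (auto simp: \<nu>_def lookup_add lookup_minus lookup_single when_def)
    have eq: "Poly_Mapping.single \<mu> z = var_poly v * Poly_Mapping.single \<nu> z"
      by (simp add: \<mu>\<nu> var_poly_def mult_single)
    have "mon_deg \<nu> = n" using \<mu> by (simp add: \<mu>\<nu> mon_deg_add)
    then have h: "homogeneous n (Poly_Mapping.single \<nu> z)" by (rule homogeneous_single)
    let ?z = "\<lambda>v'. if v' = v then Poly_Mapping.single \<nu> z else 0"
    have "Poly_Mapping.single \<mu> z = var_poly S * ?z S + var_poly Tv * ?z Tv + var_poly U * ?z U"
      unfolding eq by (cases v) simp_all
    moreover have "homogeneous n (?z v')" for v' using h by simp
    ultimately show ?thesis by blast
  qed
  have "?P (\<Sum>\<mu>\<in>A. Poly_Mapping.single \<mu> (Poly_Mapping.lookup g \<mu>))" if "finite A" "A \<subseteq> Poly_Mapping.keys g" for A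
    using that
  proof (induction A rule: finite_induct)
    case empty
    show ?case by (intro exI[of _ 0]) simp
  next
    case (insert \<mu> A)
    then obtain a b c where 1: "(\<Sum>\<mu>\<in>A. Poly_Mapping.single \<mu> (Poly_Mapping.lookup g \<mu>)) = var_poly S * a + var_poly Tv * b + var_poly U * c"
      "homogeneous n a" "homogeneous n b" "homogeneous n c" by blast
    have "mon_deg \<mu> = Suc n" using insert.prems assms by (simp add: homogeneous_def)
    from single[OF this, of "Poly_Mapping.lookup g \<mu>"] obtain a' b' c' where
      2: "Poly_Mapping.single \<mu> (Poly_Mapping.lookup g \<mu>) = var_poly S * a' + var_poly Tv * b' + var_poly U * c'"
      "homogeneous n a'" "homogeneous n b'" "homogeneous n c'" by blast
    show ?case
      by (rule exI[of _ "a + a'"], rule exI[of _ "b + b'"], rule exI[of _ "c + c'"])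
         (simp add: insert.hyps 1 2 homogeneous_add algebra_simps)
  qed
  from this[OF finite_keys order_refl] show ?thesis using that by (auto simp: poly_mapping_sum_single)
qed

locale coprime_forms =
  fixes m d :: nat and e :: "nat \<Rightarrow> nat" and f :: "nat \<Rightarrow> 'a::field poly3"
  assumes d: "1 \<le> d" and hom: "\<forall>i<m. homogeneous (e i) (f i) \<and> e i \<le> d"
    and gcd1: "\<And>g. (\<forall>i<m. g dvd f i) \<Longrightarrow> g dvd 1"
begin

lemma hom': "\<forall>i<m. homogeneous (e i) (f i)"
  using hom by blast

text \<open>Over \<open>T\<close> a 1-cycle bounds a chain with coefficients -p, -q, -r.
  \<open>saturation_bounds(2)\<close> in degree \<open>j - 2\<close> supplies \<open>w\<close> such
  that adding \<open>w\<close> times the boundary of the top basis element, with coefficients u, -t,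
  s, moves all three into \<open>J\<close> without changing the boundary.\<close>

lemma betti_1_vanish:
  assumes j: "3 * d \<le> j"
  shows "betti_graded m f 1 j = 0"
proof (rule betti_graded_exact, rule subsetI)
  fix x assume x: "x \<in> koszul_cycles m f 1 j"
  then have xc: "x \<in> chain_piece m f 1 j" and dx: "koszul_d x B = 0" for B by auto
  have j3: "1 \<le> j" "2 \<le> j" "Suc 0 + (j - 2) = j - 1" "3 * d - 2 \<le> j - 2" "Suc 0 + (j - 2 - 1) = j - 2"
    using j d by auto
  have xv: "x {v} \<in> ideal_piece m f (j - 1)" for v using chainD(1)[OF xc, of "{v}"] j3 by simp
  have "var_poly S * x {S} + var_poly Tv * x {Tv} + var_poly U * x {U} = 0"
    using dx[of "{}"] by (simp add: koszul_values)
  then obtain p0 q0 r0 where pqr0: "x {S} = var_poly Tv * p0 + var_poly U * q0"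
      "x {Tv} = var_poly U * r0 - var_poly S * p0" "x {U} = - var_poly S * q0 - var_poly Tv * r0"
    by (rule koszul_exact)
  \<comment> \<open>\<open>koszul_exact\<close> gives no control of degrees; passing to components
    of degree \<open>j - 2\<close> restores homogeneity.\<close>
  define p q r where "p = hcomp (j - 2) p0" and "q = hcomp (j - 2) q0" and "r = hcomp (j - 2) r0"
  have hv: "hcomp (j - 1) (var_poly v * y) = var_poly v * hcomp (j - 2) y" for v and y :: "'a poly3"
    using hcomp_mult'[OF homogeneous_var_poly, of "j - 1" v y] j3 by (simp add: numeral_2_eq_2)
  have hd: "hcomp n (y - z) = hcomp n y - hcomp n z" for n and y z :: "'a poly3"
    using hcomp_add[of n "y - z" z] by (simp add: algebra_simps)
  have hm: "hcomp n (- y) = - hcomp n y" for n and y :: "'a poly3"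
    using hd[of n 0 y] by simp
  have hx: "hcomp (j - 1) (x {v}) = x {v}" for v
    using xv[of v] by (simp add: ideal_piece_def hcomp_id)
  have eqs: "x {S} = var_poly Tv * p + var_poly U * q"
    using arg_cong[OF pqr0(1), of "hcomp (j - 1)"] unfolding hx hcomp_add hv p_def q_def .
  have eqt: "x {Tv} = var_poly U * r - var_poly S * p"
    using arg_cong[OF pqr0(2), of "hcomp (j - 1)"] unfolding hx hd hv p_def r_def .
  have equ: "x {U} = - var_poly S * q - var_poly Tv * r"
    using arg_cong[OF pqr0(3), of "hcomp (j - 1)"] unfolding hx hd hm hv mult_minus_left q_def r_def .
  have h: "homogeneous (j - 2) p" "homogeneous (j - 2) q" "homogeneous (j - 2) r"
    by (simp_all add: p_def q_def r_def)
  have J: "var_poly Tv * p + var_poly U * q \<in> gen_ideal m f"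
    "var_poly U * r - var_poly S * p \<in> gen_ideal m f" "- var_poly S * q - var_poly Tv * r \<in> gen_ideal m f"
    using xv[of S] xv[of Tv] xv[of U] unfolding eqs eqt equ by (simp_all add: ideal_piece_def)
  obtain w where w: "homogeneous (j - 2 - 1) w" "p - var_poly U * w \<in> gen_ideal m f"
      "q + var_poly Tv * w \<in> gen_ideal m f" "r - var_poly S * w \<in> gen_ideal m f"
    using saturation_bounds(2)[OF d hom gcd1 j3(4) h J] by blast
  define y :: "'a chain" where "y = (\<lambda>A. if A = {S, Tv} then - (p - var_poly U * w)
      else if A = {S, U} then - (q + var_poly Tv * w) else if A = {Tv, U} then - (r - var_poly S * w) else 0)"
  have vw: "homogeneous (j - 2) (var_poly v * w)" for v
    by (rule homogeneous_mult'[OF homogeneous_var_poly w(1) j3(5)])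
  have ne: "{S, Tv} \<noteq> {S, U}" "{S, Tv} \<noteq> {Tv, U}" "{S, U} \<noteq> {Tv, U}" "{S, U} \<noteq> {S, Tv}" "{Tv, U} \<noteq> {S, Tv}" "{Tv, U} \<noteq> {S, U}"
    "(UNIV :: var set) \<noteq> {S, Tv}" "(UNIV :: var set) \<noteq> {S, U}" "(UNIV :: var set) \<noteq> {Tv, U}"
    by (auto simp: UNIV_var doubleton_eq_iff)
  have yv: "y {S, Tv} = - (p - var_poly U * w)" "y {S, U} = - (q + var_poly Tv * w)"
    "y {Tv, U} = - (r - var_poly S * w)" "y UNIV = 0" "y {v} = 0" for v
    using ne by (auto simp: y_def)
  have yJ: "- (p - var_poly U * w) \<in> ideal_piece m f (j - 2)" "- (q + var_poly Tv * w) \<in> ideal_piece m f (j - 2)"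
    "- (r - var_poly S * w) \<in> ideal_piece m f (j - 2)"
    unfolding ideal_piece_def mem_Collect_eq
    using gen_ideal_uminus[OF w(2)] homogeneous_uminus[OF homogeneous_diff[OF h(1) vw[of U]]]
      gen_ideal_uminus[OF w(3)] homogeneous_uminus[OF homogeneous_add[OF h(2) vw[of Tv]]]
      gen_ideal_uminus[OF w(4)] homogeneous_uminus[OF homogeneous_diff[OF h(3) vw[of S]]]
    by blast+
  have yJ0: "0 \<in> ideal_piece m f (j - 2)" by (simp add: ideal_piece_def)
  have "y \<in> chain_piece m f 2 j"
    unfolding chain_piece_def
  proof (intro CollectI allI conjI impI)
    fix A :: "var set" assume "card A = 2 \<and> 2 \<le> j"
    show "y A \<in> ideal_piece m f (j - 2)"
      unfolding y_def using yJ yJ0 by presburger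
  next
    fix A :: "var set" assume "\<not> (card A = 2 \<and> 2 \<le> j)"
    then have "card A \<noteq> 2" using j3 by blast
    then show "y A = 0" unfolding y_def by auto
  qed
  moreover have "koszul_d y = x"
  proof
    fix B
    have card3: "card (UNIV :: var set) \<noteq> 1" by (simp add: card_UNIV_var)
    have x0: "x B = 0" if "card B \<noteq> 1" using chainD(2)[OF xc that] .
    consider "B = {}" | "B = {S}" | "B = {Tv}" | "B = {U}" | "B = {S, Tv}" | "B = {S, U}" | "B = {Tv, U}" | "B = UNIV"
      using var_set_cases[of B] by blast
    then show "koszul_d y B = x B"
    proof cases
      case 1 then show ?thesis using x0 by (simp add: koszul_values yv)
    next
      case 2 then show ?thesis by (simp add: koszul_values yv eqs algebra_simps)
    next
      case 3 then show ?thesis by (simp add: koszul_values yv eqt algebra_simps)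
    next
      case 4 then show ?thesis by (simp add: koszul_values yv equ algebra_simps)
    next
      case 5 then show ?thesis using x0 by (simp add: koszul_values yv)
    next
      case 6 then show ?thesis using x0 by (simp add: koszul_values yv)
    next
      case 7 then show ?thesis using x0 by (simp add: koszul_values yv)
    next
      case 8 then show ?thesis using x0 card3 by (simp add: koszul_values)
    qed
  qed
  ultimately show "x \<in> koszul_d ` chain_piece m f (Suc 1) j" by (metis Suc_1 image_eqI)
qed

text \<open>Over \<open>T\<close> a 2-cycle is \<open>w\<close> times the boundary of the top basis
  element. Its coefficients lie in \<open>J\<close>, so every variable multiplies \<open>w\<close>
  into \<open>J\<close>; as \<open>w\<close> has degree j - 3, which is at least 3d - 2,
  \<open>saturation_bounds(1)\<close> puts it into \<open>J\<close>.\<close>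

lemma betti_2_vanish:
  assumes j: "3 * d < j"
  shows "betti_graded m f 2 j = 0"
proof (rule betti_graded_exact, rule subsetI)
  fix x assume x: "x \<in> koszul_cycles m f 2 j"
  then have xc: "x \<in> chain_piece m f 2 j" and dx: "koszul_d x B = 0" for B by auto
  have j3: "2 \<le> j" "3 \<le> j" "3 * d - 2 \<le> j - 3" "Suc 0 \<le> j - 2" "j - 2 - Suc 0 = j - 3" using j d by auto
  have xA: "x A \<in> ideal_piece m f (j - 2)" if "card A = 2" for A using chainD(1)[OF xc that] j3 by simp
  have 1: "var_poly S * x {S, Tv} = var_poly U * x {Tv, U}" using dx[of "{Tv}"] by (simp add: koszul_values)
  have 2: "- var_poly Tv * x {S, Tv} - var_poly U * x {S, U} = 0" using dx[of "{S}"] by (simp add: koszul_values)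
  have "var_zero U (var_poly S * x {S, Tv}) = 0"
    unfolding 1 by (simp add: ring_mapD[OF ring_map_var_zero] var_zero_var)
  then have "var_poly U dvd x {S, Tv}"
    by (simp add: var_dvd_iff ring_mapD[OF ring_map_var_zero] var_zero_var)
  then obtain w0 where w0: "x {S, Tv} = var_poly U * w0" by (elim dvdE)
  define w where "w = hcomp (j - 3) w0"
  have "hcomp (j - 2) (x {S, Tv}) = x {S, Tv}"
    using xA[of "{S, Tv}"] by (simp add: ideal_piece_def hcomp_id)
  then have w: "x {S, Tv} = var_poly U * w"
    using arg_cong[OF w0, of "hcomp (j - 2)"] hcomp_mult'[OF homogeneous_var_poly, of "j - 2" U w0] j3
    by (simp add: w_def)
  have "var_poly U * (var_poly S * w) = var_poly U * x {Tv, U}" using 1 w by (simp add: mult_ac)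
  then have w': "x {Tv, U} = var_poly S * w" by simp
  have "var_poly U * (var_poly Tv * w + x {S, U}) = - (- var_poly Tv * x {S, Tv} - var_poly U * x {S, U})"
    by (simp add: w algebra_simps)
  then have "var_poly U * (var_poly Tv * w + x {S, U}) = 0" unfolding 2 by simp
  then have "var_poly Tv * w + x {S, U} = 0" by simp
  then have w'': "x {S, U} = - var_poly Tv * w" using minus_unique[of "var_poly Tv * w" "x {S, U}"] by simp
  have "var_poly v * w \<in> gen_ideal m f" for v
    using xA[of "{S, Tv}"] xA[of "{S, U}"] xA[of "{Tv, U}"] gen_ideal_uminus[of "x {S, U}" m f]
    by (cases v) (auto simp: ideal_piece_def w w' w'')
  moreover have hw: "homogeneous (j - 3) w" by (simp add: w_def)
  ultimately have wJ: "w \<in> ideal_piece m f (j - 3)"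
    using saturation_bounds(1)[OF d hom gcd1 j3(3)] by (simp add: ideal_piece_def)
  define y :: "'a chain" where "y = (\<lambda>A. if A = UNIV then w else 0)"
  have c3: "card A = 3 \<longleftrightarrow> A = UNIV" for A :: "var set"
    using card_UNIV_var card_subset_eq[OF finite_var, of A] by auto
  have "y \<in> chain_piece m f 3 j"
    using wJ j3 by (auto simp: chain_piece_def y_def c3)
  moreover have "koszul_d y = x"
  proof
    fix B
    have ne: "{} \<noteq> (UNIV :: var set)" "{v} \<noteq> (UNIV :: var set)" "{S, Tv} \<noteq> UNIV" "{S, U} \<noteq> UNIV" "{Tv, U} \<noteq> UNIV" for v
      using card_UNIV_var by (auto simp: UNIV_var)
    have yv: "y UNIV = w" "y {} = 0" "y {v} = 0" "y {S, Tv} = 0" "y {S, U} = 0" "y {Tv, U} = 0" for v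
      using ne by (auto simp: y_def)
    have card3: "card (UNIV :: var set) \<noteq> 2" by (simp add: card_UNIV_var)
    have x0: "x B = 0" if "card B \<noteq> 2" using chainD(2)[OF xc that] .
    consider "B = {}" | "B = {S}" | "B = {Tv}" | "B = {U}" | "B = {S, Tv}" | "B = {S, U}" | "B = {Tv, U}" | "B = UNIV"
      using var_set_cases[of B] by blast
    then show "koszul_d y B = x B"
    proof cases
      case 8 then show ?thesis using x0 card3 by (simp add: koszul_values)
    qed (use x0 in \<open>simp_all add: koszul_values yv w w' w''\<close>)
  qed
  ultimately show "x \<in> koszul_d ` chain_piece m f (Suc 2) j" by (metis eval_nat_numeral(3) image_eqI)
qed

end

subsection \<open>Minimal generators\<close>

lemma homogeneous_0_const: "homogeneous 0 g \<Longrightarrow> g = Poly_Mapping.single 0 (Poly_Mapping.lookup g 0)"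
proof (rule poly_mapping_eqI)
  fix \<mu> assume g: "homogeneous 0 g"
  have "\<mu> = 0" if "mon_deg \<mu> = 0"
  proof (rule poly_mapping_eqI)
    fix k show "Poly_Mapping.lookup \<mu> k = Poly_Mapping.lookup 0 k"
      using that by (cases k) (simp_all add: mon_deg_def)
  qed
  then show "Poly_Mapping.lookup g \<mu> = Poly_Mapping.lookup (Poly_Mapping.single 0 (Poly_Mapping.lookup g 0)) \<mu>"
    using g by (cases "\<mu> = 0") (auto simp: homogeneous_iff lookup_single)
qed

definition chain_0 :: "'a::field poly3 \<Rightarrow> 'a chain" where
  "chain_0 p = (\<lambda>A. if A = {} then p else 0)"

lemma chain_0_sum:
  fixes g :: "'i \<Rightarrow> 'a::field poly3"
  shows "chain_0 (sum g I) = (\<Sum>i\<in>I. chain_0 (g i))"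
proof -
  have 1: "chain_0 (p + q) = chain_0 p + chain_0 q" for p q :: "'a poly3"
    by (simp add: chain_0_def fun_eq_iff)
  have 0: "chain_0 0 = (0 :: 'a chain)" by (simp add: chain_0_def fun_eq_iff)
  show ?thesis by (induction I rule: infinite_finite_induct) (simp_all add: 0 1)
qed

lemma chain_0_mem: "p \<in> ideal_piece m f j \<Longrightarrow> chain_0 p \<in> chain_piece m f 0 j"
  by (auto simp: chain_piece_def chain_0_def card_eq_0_iff finite_subset[OF subset_UNIV finite_var])

lemma chain_piece_0:
  assumes "x \<in> chain_piece m f 0 j"
  shows "x {} \<in> ideal_piece m f j" and "x = chain_0 (x {})"
proof -
  show "x {} \<in> ideal_piece m f j" using chainD(1)[OF assms, of "{}"] by simp
  have "x A = 0" if "A \<noteq> {}" for A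
    using chainD(2)[OF assms, of A] that finite_subset[OF subset_UNIV finite_var, of A] by simp
  then show "x = chain_0 (x {})" by (auto simp: chain_0_def)
qed

lemma koszul_chain_0:
  assumes "x \<in> chain_piece m f 0 j"
  shows "koszul_d x = (\<lambda>_. 0)"
proof -
  have "koszul_d (chain_0 (x {})) = (\<lambda>_. 0)"
    by (simp add: koszul_d_def chain_0_def)
  then show ?thesis by (simp only: chain_piece_0(2)[OF assms, symmetric])
qed

lemma boundary_chain_0:
  assumes "a \<in> ideal_piece m f j" "b \<in> ideal_piece m f j" "c \<in> ideal_piece m f j"
  shows "chain_0 (var_poly S * a + var_poly Tv * b + var_poly U * c) \<in> koszul_d ` chain_piece m f (Suc 0) (Suc j)"
proof
  define y where "y = (\<lambda>A. if A = {S} then a else if A = {Tv} then b else if A = {U} then c else 0)"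
  have y1: "y {S} = a" "y {Tv} = b" "y {U} = c" by (simp_all add: y_def)
  have y0: "y A = 0" if "card A \<noteq> 1" for A using that unfolding y_def by auto
  show "y \<in> chain_piece m f (Suc 0) (Suc j)"
    unfolding chain_piece_def
  proof (intro CollectI allI conjI impI)
    fix A :: "var set" assume "card A = Suc 0 \<and> Suc 0 \<le> Suc j"
    then obtain v where "A = {v}" by (auto simp: card_1_singleton_iff)
    then show "y A \<in> ideal_piece m f (Suc j - Suc 0)" using assms y1 by (cases v) simp_all
  next
    fix A :: "var set" assume "\<not> (card A = Suc 0 \<and> Suc 0 \<le> Suc j)"
    then show "y A = 0" by (intro y0) simp
  qed
  show "chain_0 (var_poly S * a + var_poly Tv * b + var_poly U * c) = koszul_d y"
  proof
    fix B
    have z: "y {S, Tv} = 0" "y {S, U} = 0" "y {Tv, U} = 0" "y UNIV = 0"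
      by (intro y0; simp add: card_UNIV_var)+
    have ne: "(UNIV :: var set) \<noteq> {}" by blast
    show "chain_0 (var_poly S * a + var_poly Tv * b + var_poly U * c) B = koszul_d y B"
      using var_set_cases[of B] by (elim disjE) (simp_all add: koszul_values chain_0_def y1 z ne)
  qed
qed

context coprime_forms
begin

text \<open>A generator of degree below \<open>j\<close> enters with a coefficient of positive
  degree, which splits along the variables; its contribution is therefore a boundary. Generators of
  degree \<open>j\<close> enter with constant coefficients.\<close>

lemma betti_graded_0_le: "betti_graded m f 0 j \<le> card {i. i < m \<and> e i = j}"
proof -
  let ?D = "koszul_d ` chain_piece m f (Suc 0) j"
  obtain B where B: "finite B" "?D \<subseteq> CC.vs1.span B" "card B = CC.vs1.dim ?D"
    using CC.vs1.fin_dim_basis[OF fin_dim_boundaries] by metis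
  let ?G = "(\<lambda>i. chain_0 (f i)) ` {i. i < m \<and> e i = j}"
  have "koszul_cycles m f 0 j \<subseteq> CC.vs1.span (B \<union> ?G)"
  proof
    fix x assume "x \<in> koszul_cycles m f 0 j"
    then have x: "x {} \<in> ideal_piece m f j" "x = chain_0 (x {})" using chain_piece_0 by blast+
    then have x': "x {} \<in> gen_ideal m f" "homogeneous j (x {})" by (simp_all add: ideal_piece_def)
    obtain g where g: "x {} = (\<Sum>i<m. g i * f i)" "\<And>i. e i \<le> j \<Longrightarrow> homogeneous (j - e i) (g i)"
        "\<And>i. j < e i \<Longrightarrow> g i = 0"
      by (rule gen_ideal_homogeneousE[OF hom' x']) blast
    have "chain_0 (g i * f i) \<in> CC.vs1.span (B \<union> ?G)" if i: "i < m" for i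
    proof -
      consider "j < e i" | "e i = j" | "e i < j" by linarith
      then show ?thesis
      proof cases
        case 1
        then have "chain_0 (g i * f i) = 0" by (simp add: g(3) chain_0_def zero_fun_def)
        then show ?thesis by (simp only: CC.vs1.span_zero)
      next
        case 2
        then have "g i = Poly_Mapping.single 0 (Poly_Mapping.lookup (g i) 0)"
          using g(2)[of i] homogeneous_0_const[of "g i"] by simp
        then have "chain_0 (g i * f i) = cscale (Poly_Mapping.lookup (g i) 0) (chain_0 (f i))"
          by (auto simp: chain_0_def cscale_def pscale_eq fun_eq_iff)
        moreover have "chain_0 (f i) \<in> B \<union> ?G" using i 2 by blast
        ultimately show ?thesis by (simp add: CC.vs1.span_scale CC.vs1.span_base)
      next
        case 3
        then have j: "j = Suc (j - e i - 1 + e i)" "Suc (j - e i - 1) = j - e i" "e i \<le> j" by simp_all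
        have hg: "homogeneous (Suc (j - e i - 1)) (g i)" unfolding j(2) by (rule g(2)[OF j(3)])
        obtain a b c where abc: "g i = var_poly S * a + var_poly Tv * b + var_poly U * c"
          "homogeneous (j - e i - 1) a" "homogeneous (j - e i - 1) b" "homogeneous (j - e i - 1) c"
          by (rule homogeneous_Suc_decompose[OF hg])
        have fi: "f i \<in> ideal_piece m f (e i)" using i hom' by (simp add: ideal_piece_def gen_ideal_gen)
        have "chain_0 (var_poly S * (a * f i) + var_poly Tv * (b * f i) + var_poly U * (c * f i))
            \<in> koszul_d ` chain_piece m f (Suc 0) (Suc (j - e i - 1 + e i))"
          by (intro boundary_chain_0 ideal_piece_mult[OF fi abc(2)] ideal_piece_mult[OF fi abc(3)]
              ideal_piece_mult[OF fi abc(4)] refl)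
        then have "chain_0 (g i * f i) \<in> ?D"
          unfolding j(1)[symmetric] abc(1) by (simp add: algebra_simps)
        then show ?thesis using B(2) CC.vs1.span_mono[of B "B \<union> ?G"] by blast
      qed
    qed
    then have "chain_0 (\<Sum>i<m. g i * f i) \<in> CC.vs1.span (B \<union> ?G)"
      unfolding chain_0_sum by (intro CC.vs1.span_sum) simp
    then show "x \<in> CC.vs1.span (B \<union> ?G)" using x(2) g(1) by simp
  qed
  then have "CC.vs1.dim (koszul_cycles m f 0 j) \<le> card (B \<union> ?G)"
    by (rule CC.vs1.dim_le_card) (use B(1) in simp)
  also have "\<dots> \<le> card B + card ?G" by (rule card_Un_le)
  also have "\<dots> \<le> CC.vs1.dim ?D + card {i. i < m \<and> e i = j}"
    using B(3) card_image_le[of "{i. i < m \<and> e i = j}" "\<lambda>i. chain_0 (f i)"] by simp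
  finally show ?thesis unfolding betti_graded_eq by simp
qed

lemma betti_0_vanish:
  assumes "d < j"
  shows "betti_graded m f 0 j = 0"
proof -
  have "{i. i < m \<and> e i = j} = {}" using assms hom by auto
  then show ?thesis using betti_graded_0_le[of j] by (simp only: card.empty)
qed

lemma exists_nonzero_form:
  obtains i where "i < m" "f i \<noteq> 0"
proof -
  have "\<not> (\<forall>i<m. 0 dvd f i)" using gcd1[of 0] by auto
  then show ?thesis using that by auto
qed

text \<open>In the lowest degree where the ideal is nonzero there are no boundaries. This makes the
  set whose maximum is \<open>cm_reg\<close> nonempty.\<close>

lemma exists_betti_0: "\<exists>j. betti_graded m f 0 j \<noteq> 0"
proof -
  obtain i where i: "i < m" "f i \<noteq> 0" by (rule exists_nonzero_form)
  let ?Q = "\<lambda>j. \<exists>p\<in>ideal_piece m f j. p \<noteq> 0"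
  have "?Q (e i)" using i hom' by (intro bexI[of _ "f i"]) (simp_all add: ideal_piece_def gen_ideal_gen)
  define j where "j = (LEAST j. ?Q j)"
  have "?Q j" unfolding j_def by (rule LeastI[of ?Q, OF \<open>?Q (e i)\<close>])
  then obtain p where p: "p \<in> ideal_piece m f j" "p \<noteq> 0" by blast
  have min: "q = 0" if "q \<in> ideal_piece m f (j - 1)" "1 \<le> j" for q
  proof -
    have "j - 1 < (LEAST j. ?Q j)" using that(2) unfolding j_def[symmetric] by simp
    then have "\<not> ?Q (j - 1)" by (rule not_less_Least)
    then show ?thesis using that(1) by blast
  qed
  have "koszul_d ` chain_piece m f (Suc 0) j \<subseteq> {0}"
  proof
    fix z assume "z \<in> koszul_d ` chain_piece m f (Suc 0) j"
    then obtain y where y: "y \<in> chain_piece m f (Suc 0) j" "z = koszul_d y" by blast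
    have "y A = 0" for A
    proof (cases "card A = Suc 0 \<and> Suc 0 \<le> j")
      case True
      then show ?thesis using min[of "y A"] chainD(1)[OF y(1), of A] by simp
    next
      case False
      then show ?thesis using y(1) unfolding chain_piece_def by blast
    qed
    then show "z \<in> {0}" using y(2) by (simp add: koszul_d_def zero_fun_def)
  qed
  then have "CC.vs1.dim (koszul_d ` chain_piece m f (Suc 0) j) \<le> card ({} :: 'a chain set)"
    by (intro CC.vs1.dim_le_card) auto
  moreover have "CC.vs1.dim (koszul_cycles m f 0 j) \<noteq> 0"
  proof
    assume *: "CC.vs1.dim (koszul_cycles m f 0 j) = 0"
    obtain B where B: "finite B" "koszul_cycles m f 0 j \<subseteq> CC.vs1.span B" "card B = 0"
      by (rule CC.vs1.fin_dim_basis[OF fin_dim_cycles[of m f 0 j]]) (simp only: *)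
    then have "B = {}" by simp
    then have "koszul_cycles m f 0 j \<subseteq> {0}" using B(2) by (simp only: CC.vs1.span_empty)
    moreover have "chain_0 p \<in> koszul_cycles m f 0 j"
      using chain_0_mem[OF p(1)] koszul_chain_0[OF chain_0_mem[OF p(1)]] by simp
    ultimately have "chain_0 p = 0" by blast
    then have "chain_0 p {} = 0" by (simp only: zero_fun_def)
    then show False using p(2) by (simp add: chain_0_def)
  qed
  ultimately show ?thesis unfolding betti_graded_eq by (intro exI[of _ j]) simp
qed

subsection \<open>Regularity and total Betti numbers\<close>

lemma betti_graded_bound:
  assumes "betti_graded m f i j \<noteq> 0"
  shows "i \<le> 2" "i \<le> j" "j - i \<le> 3 * d - 2"
proof -
  show i: "i \<le> 2" using betti_graded_ge_3[of i m f j] assms by linarith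
  show "i \<le> j" using betti_graded_low[of j i m f] assms by linarith
  consider "i = 0" | "i = 1" | "i = 2" using i by linarith
  then show "j - i \<le> 3 * d - 2"
  proof cases
    case 1
    then have "j \<le> d" using betti_0_vanish[of j] assms by (metis not_le)
    then show ?thesis using d by linarith
  next
    case 2
    then have "j < 3 * d" using betti_1_vanish[of j] assms by (metis not_le)
    then show ?thesis using 2 d by linarith
  next
    case 3
    then have "j \<le> 3 * d" using betti_2_vanish[of j] assms by (metis not_le)
    then show ?thesis using 3 d by linarith
  qed
qed

lemma cm_reg_bounds:
  shows "cm_reg m f \<le> 3 * d - 2"
    and "betti_graded m f i j \<noteq> 0 \<Longrightarrow> j - i \<le> cm_reg m f"
proof -
  let ?R = "{j - i | i j. i \<le> j \<and> betti_graded m f i j \<noteq> 0}"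
  have sub: "?R \<subseteq> {..3 * d - 2}" using betti_graded_bound by auto
  then have fin: "finite ?R" by (rule finite_subset) simp
  have "?R \<noteq> {}" using exists_betti_0 by blast
  then show "cm_reg m f \<le> 3 * d - 2" unfolding cm_reg_def using Max_in[OF fin] sub by auto
  show "j - i \<le> cm_reg m f" if "betti_graded m f i j \<noteq> 0"
    unfolding cm_reg_def by (rule Max_ge[OF fin]) (use that betti_graded_bound in blast)
qed

text \<open>One summation range common to all \<open>i\<close> lets the alternating sum be formed
  degree by degree.\<close>

lemma betti_eq_sum:
  assumes "3 * d \<le> N"
  shows "betti m f i = (\<Sum>j\<le>N. betti_graded m f i j)"
  unfolding betti_def
proof (rule sum.mono_neutral_left)
  show "{j. betti_graded m f i j \<noteq> 0} \<subseteq> {..N}"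
  proof
    fix j assume "j \<in> {j. betti_graded m f i j \<noteq> 0}"
    then have "betti_graded m f i j \<noteq> 0" by simp
    from betti_graded_bound[OF this] have "j \<le> 3 * d" using d by linarith
    then show "j \<in> {..N}" using assms by simp
  qed
qed auto

lemma betti_0_le: "betti m f 0 \<le> m"
proof -
  have "betti m f 0 \<le> (\<Sum>j\<le>3 * d. card {i. i < m \<and> e i = j})"
    unfolding betti_eq_sum[OF order_refl] by (rule sum_mono) (rule betti_graded_0_le)
  also have "\<dots> = card (\<Union>j\<in>{..3 * d}. {i. i < m \<and> e i = j})"
    by (rule card_UN_disjoint[symmetric]) auto
  also have "\<dots> \<le> card {..<m}" by (rule card_mono) auto
  finally show ?thesis by simp
qed

end

lemma betti_graded_2_le:
  "betti_graded m f 2 j \<le> (if 3 \<le> j then hilb m f (j - 2) - hilb m f (j - 3) else hilb m f (j - 2))"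
proof (cases "2 \<le> j")
  case False
  then show ?thesis using betti_graded_low[of j 2 m f] by simp
next
  case True
  let ?Z = "koszul_cycles m f 2 j"
  have ev: "Vector_Spaces.linear cscale pscale (\<lambda>x. x {S, Tv})"
    by (subst Vector_Spaces.linear_iff) (simp add: vector_space_pscale vector_space_cscale cscale_def)
  have sub: "CC.vs1.subspace ?Z"
  proof -
    have "?Z = chain_piece m f 2 j \<inter> {x. koszul_d x = 0}" unfolding zero_fun_def by blast
    then show ?thesis
      by (simp only: CC.vs1.subspace_inter[OF subspace_chain CC.linear_subspace_kernel[OF linear_koszul]])
  qed
  have "CC.vs1.dim ?Z \<le> hilb m f (j - 2)"
    unfolding hilb_def
  proof (rule CP.dim_le_of_inj[OF ev sub fin_dim_cycles _ _ fin_dim_ideal_piece])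
    show "(\<lambda>x. x {S, Tv}) ` ?Z \<subseteq> ideal_piece m f (j - 2)"
      using True chainD(1)[of _ m f 2 j "{S, Tv}"] by auto
    fix x assume x: "x \<in> ?Z" "x {S, Tv} = 0"
    then have xc: "x \<in> chain_piece m f 2 j" and dx: "koszul_d x B = 0" for B by auto
    have su: "x {S, U} = 0" using dx[of "{S}"] x(2) by (simp add: koszul_values)
    have tu: "x {Tv, U} = 0" using dx[of "{Tv}"] x(2) by (simp add: koszul_values)
    have "x A = 0" for A
    proof (cases "card A = 2")
      case True
      then have "A = {S, Tv} \<or> A = {S, U} \<or> A = {Tv, U}"
        using var_set_cases[of A] card_UNIV_var by (elim disjE) simp_all
      then show ?thesis using su tu x(2) by (elim disjE) simp_all
    qed (rule chainD(2)[OF xc])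
    then show "x = 0" by (simp add: fun_eq_iff)
  qed
  \<comment> \<open>The subtracted term: the differential is injective on 3-chains, which consist of
    one coefficient in degree \<open>j - 3\<close>.\<close>
  moreover have "CC.vs1.dim (koszul_d ` chain_piece m f (Suc 2) j) = hilb m f (j - 3)" if "3 \<le> j"
  proof -
    have c3: "card A = 3 \<Longrightarrow> A = UNIV" for A :: "var set"
      using card_UNIV_var card_subset_eq[OF finite_var, of A] by auto
    have "CC.vs1.dim (koszul_d ` chain_piece m f (Suc 2) j) = CC.vs1.dim (chain_piece m f (Suc 2) j)"
    proof (rule CC.dim_image_inj[OF linear_koszul subspace_chain fin_dim_chain])
      fix x assume x: "x \<in> chain_piece m f (Suc 2) j" "koszul_d x = 0"
      have U0: "x UNIV = 0" using koszul_values(5)[of x] unfolding x(2) by simp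
      have "x A = 0" for A
      proof (cases "card A = 3")
        case True
        then show ?thesis using c3[of A] U0 by simp
      next
        case False
        then show ?thesis using chainD(2)[OF x(1), of A] by simp
      qed
      then show "x = 0" by (simp add: fun_eq_iff)
    qed
    also have "\<dots> = hilb m f (j - 3)" using that by (simp add: dim_chain)
    finally show ?thesis .
  qed
  ultimately show ?thesis unfolding betti_graded_eq by auto
qed

lemma (in coprime_forms) betti_2_le: "betti m f 2 \<le> hilb m f (cm_reg m f)"
proof -
  let ?r = "cm_reg m f"
  have "betti m f 2 = (\<Sum>j\<in>{j. betti_graded m f 2 j \<noteq> 0}. betti_graded m f 2 j)" by (rule betti_def)
  also have "\<dots> \<le> (\<Sum>j\<in>(\<lambda>k. k + 2) ` {..?r}. betti_graded m f 2 j)"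
  proof (rule sum_mono2)
    show "{j. betti_graded m f 2 j \<noteq> 0} \<subseteq> (\<lambda>k. k + 2) ` {..?r}"
    proof
      fix j assume "j \<in> {j. betti_graded m f 2 j \<noteq> 0}"
      then have j: "betti_graded m f 2 j \<noteq> 0" by simp
      show "j \<in> (\<lambda>k. k + 2) ` {..?r}"
        by (rule image_eqI[of _ _ "j - 2"]) (use betti_graded_bound(2)[OF j] cm_reg_bounds(2)[OF j] in auto)
    qed
  qed auto
  also have "\<dots> = (\<Sum>k\<le>?r. betti_graded m f 2 (k + 2))" by (subst sum.reindex) (auto simp: inj_on_def)
  also have "\<dots> \<le> hilb m f ?r"
  proof -
    have "(\<Sum>k\<le>n. betti_graded m f 2 (k + 2)) \<le> hilb m f n" for n
    proof (induction n)
      case 0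
      show ?case using betti_graded_2_le[of m f "Suc (Suc 0)"] by simp
    next
      case (Suc n)
      have "betti_graded m f 2 (Suc n + 2) \<le> hilb m f (Suc n) - hilb m f n"
        using betti_graded_2_le[of m f "Suc n + 2"] by simp
      then show ?case using Suc hilb_Suc[of m f n] by simp
    qed
    then show ?thesis .
  qed
  finally show ?thesis .
qed

subsection \<open>The Euler characteristic\<close>

lemma koszul_d_squared:
  assumes x: "x \<in> chain_piece m f 2 j"
  shows "koszul_d x \<in> koszul_cycles m f 1 j"
proof (cases "2 \<le> j")
  case False
  then have "x = 0" using chainD(3)[OF x] by (simp add: fun_eq_iff)
  moreover have "koszul_d 0 = (0 :: 'a chain)" by (rule CC.linear_0[OF linear_koszul])
  ultimately show ?thesis
    unfolding zero_fun_def[symmetric] using CC.vs1.subspace_0[OF subspace_chain[of m f 1 j]] by simp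
next
  case True
  have x0: "x UNIV = 0" "x {v} = 0" for v
    using chainD(2)[OF x, of UNIV] chainD(2)[OF x, of "{v}"] by (simp_all add: card_UNIV_var)
  have xv: "x A \<in> ideal_piece m f (j - 2)" if "card A = 2" for A by (rule chainD(1)[OF x that True])
  have deg: "1 + (j - 2) = j - 1" using True by simp
  have vx: "var_poly v * x A \<in> ideal_piece m f (j - 1)" if "card A = 2" for v A
    using ideal_piece_mult[OF xv[OF that] homogeneous_var_poly, of "j - 1" v] deg by simp
  note sub = PP.vs1.subspace_add[OF subspace_ideal_piece] PP.vs1.subspace_diff[OF subspace_ideal_piece]
    PP.vs1.subspace_neg[OF subspace_ideal_piece]
  have "koszul_d x \<in> chain_piece m f 1 j"
    unfolding chain_piece_def
  proof (intro CollectI allI conjI impI)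
    fix A :: "var set" assume "card A = 1 \<and> 1 \<le> j"
    then obtain v where "A = {v}" by (auto simp: card_1_singleton_iff)
    moreover have "koszul_d x {v} \<in> ideal_piece m f (j - 1)"
      by (cases v; simp only: koszul_values mult_minus_left; intro sub vx; simp)
    ultimately show "koszul_d x A \<in> ideal_piece m f (j - 1)" by simp
  next
    fix A :: "var set" assume "\<not> (card A = 1 \<and> 1 \<le> j)"
    then have "card A \<noteq> 1" using True by simp
    then show "koszul_d x A = 0"
      using var_set_cases[of A] by (elim disjE) (simp_all add: koszul_values x0)
  qed
  moreover have "koszul_d (koszul_d x) B = 0" for B
    using var_set_cases[of B] by (elim disjE) (simp_all add: koszul_values[where x = "koszul_d x"] koszul_values[where x = x] x0 algebra_simps)
  ultimately show ?thesis by (simp add: fun_eq_iff)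
qed

text \<open>Graded Betti numbers are truncated differences, which can only exceed the true ones. In
  even positions this helps the inequality; in position 1 truncation must not occur, which follows
  from \<open>koszul_d_squared\<close>.\<close>

lemma betti_euler_ge:
  "int (betti_graded m f 0 j) + int (betti_graded m f 2 j) - int (betti_graded m f 1 j) \<ge>
   int (CC.vs1.dim (chain_piece m f 0 j)) - int (CC.vs1.dim (chain_piece m f 1 j))
   + int (CC.vs1.dim (chain_piece m f 2 j)) - int (CC.vs1.dim (chain_piece m f 3 j))"
proof -
  have Z0: "koszul_cycles m f 0 j = chain_piece m f 0 j" using koszul_chain_0[of _ m f j] by blast
  have "koszul_d ` chain_piece m f 2 j \<subseteq> koszul_cycles m f 1 j" using koszul_d_squared by blast
  then have "CC.vs1.dim (koszul_d ` chain_piece m f 2 j) \<le> CC.vs1.dim (koszul_cycles m f 1 j)"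
    by (rule CC.vs1.dim_mono_fin[OF _ fin_dim_cycles])
  moreover note rank_nullity_koszul[of m f 1 j] rank_nullity_koszul[of m f 2 j] rank_nullity_koszul[of m f 3 j]
  ultimately show ?thesis
    unfolding betti_graded_eq Z0 by (simp add: numeral_2_eq_2 numeral_3_eq_3)
qed

text \<open>The alternating dimension of the Koszul complex in degree \<open>j\<close> is the third
  difference of the Hilbert function, so its partial sums are second differences.\<close>

lemma sum_euler_ge:
  "int (hilb m f (N + 2)) - 2 * int (hilb m f (N + 1)) + int (hilb m f N) \<le>
   (\<Sum>j\<le>N + 2. int (betti_graded m f 0 j) + int (betti_graded m f 2 j) - int (betti_graded m f 1 j))"
proof -
  let ?H = "\<lambda>n. int (hilb m f n)"
  define \<chi> where "\<chi> = (\<lambda>j. ?H j - (if 1 \<le> j then 3 * ?H (j - 1) else 0) + (if 2 \<le> j then 3 * ?H (j - 2) else 0)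
     - (if 3 \<le> j then ?H (j - 3) else 0))"
  have c32: "(3::nat) choose 2 = 3" by (simp add: numeral_2_eq_2 numeral_3_eq_3)
  have "\<chi> j \<le> int (betti_graded m f 0 j) + int (betti_graded m f 2 j) - int (betti_graded m f 1 j)" for j
    using betti_euler_ge[of m f j] by (simp add: dim_chain \<chi>_def c32 split: if_splits)
  then have "(\<Sum>j\<le>N + 2. \<chi> j) \<le>
      (\<Sum>j\<le>N + 2. int (betti_graded m f 0 j) + int (betti_graded m f 2 j) - int (betti_graded m f 1 j))"
    by (intro sum_mono)
  moreover have "(\<Sum>j\<le>N + 2. \<chi> j) = ?H (N + 2) - 2 * ?H (N + 1) + ?H N"
  proof (induction N)
    case 0
    show ?case by (simp add: \<chi>_def numeral_2_eq_2)
  next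
    case (Suc N)
    have e: "Suc N + 2 = Suc (N + 2)" "Suc (N + 2) - 1 = N + 2" "Suc (N + 2) - 2 = N + 1" "Suc (N + 2) - 3 = N" "Suc N + 1 = N + 2"
      by simp_all
    have "\<chi> (Suc (N + 2)) = ?H (Suc (N + 2)) - 3 * ?H (N + 2) + 3 * ?H (N + 1) - ?H N"
      unfolding \<chi>_def e by simp
    then show ?case unfolding e sum.atMost_Suc Suc.IH by (simp only:) (simp add: algebra_simps)
  qed
  ultimately show ?thesis by simp
qed

text \<open>If the second differences were eventually at most \<open>c \<le> 0\<close>, the function would grow at most linearly.\<close>

lemma second_difference_pos:
  fixes H :: "nat \<Rightarrow> nat"
  assumes mono: "\<And>n. H n \<le> H (Suc n)" and quad: "\<And>n. (n + 2) choose 2 \<le> H (k + n)"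
    and diff: "\<And>N. N0 \<le> N \<Longrightarrow> int (H (N + 2)) - 2 * int (H (N + 1)) + int (H N) \<le> c"
  shows "1 \<le> c"
proof (rule ccontr)
  assume "\<not> 1 \<le> c"
  then have c: "c \<le> 0" by simp
  define M where "M = max N0 k"
  define D where "D = H (M + 1) - H M"
  have D: "int D = int (H (M + 1)) - int (H M)" using mono[of M] by (simp add: D_def)
  \<comment> \<open>Second differences at most \<open>c \<le> 0\<close> make the first differences
    nonincreasing from \<open>M\<close> on.\<close>
  have 1: "int (H (M + Suc n)) - int (H (M + n)) \<le> int D" for n
  proof (induction n)
    case (Suc n)
    have "int (H (M + n + 2)) - 2 * int (H (M + n + 1)) + int (H (M + n)) \<le> c"
      by (rule diff) (simp add: M_def)
    then show ?case using Suc c by simp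
  qed (simp add: D)
  have 2: "H (M + n) \<le> H M + n * D" for n
  proof (induction n)
    case (Suc n)
    then show ?case using 1[of n] by simp
  qed simp
  \<comment> \<open>Then \<open>n * n\<close> equals 2n(H M) + 2nD and cancels the linear growth;
    the constant 2(H M) that remains is at most 2n, less than 3n + 2.\<close>
  define n where "n = 2 * (H M + D)"
  have "H (k + n) \<le> H (M + n)" by (rule lift_Suc_mono_le[of H, OF mono]) (simp add: M_def)
  then have "(n + 2) choose 2 \<le> H M + n * D" using quad[of n] 2[of n] by linarith
  moreover have "2 * ((n + 2) choose 2) = (n + 2) * (n + 1)"
    by (induction n) (simp_all add: numeral_2_eq_2)
  ultimately have "(n + 2) * (n + 1) \<le> 2 * H M + 2 * (n * D)" by linarith
  moreover have "(n + 2) * (n + 1) = n * n + 3 * n + 2" by (simp add: algebra_simps)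
  moreover have "n * n = 2 * (n * H M) + 2 * (n * D)" by (subst (2) n_def) (simp add: algebra_simps)
  moreover have "H M \<le> n" by (simp add: n_def)
  ultimately show False by linarith
qed

text \<open>The alternating sum of the Betti numbers is the rank of \<open>J\<close>, that is 1;
  here its lower bound is read off from growth, since from 3d on the partial sums are
  constant.\<close>

lemma (in coprime_forms) betti_euler: "betti m f 1 + 1 \<le> betti m f 0 + betti m f 2"
proof -
  obtain i where i: "i < m" "f i \<noteq> 0" by (rule exists_nonzero_form)
  have "1 \<le> int (betti m f 0) + int (betti m f 2) - int (betti m f 1)"
  proof (rule second_difference_pos)
    show "hilb m f n \<le> hilb m f (Suc n)" for n by (rule hilb_Suc)
    show "(n + 2) choose 2 \<le> hilb m f (e i + n)" for n
      using hom i by (intro hilb_ge[of "f i"] gen_ideal_gen) blast+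
    fix N assume "3 * d \<le> N"
    then have "3 * d \<le> N + 2" by simp
    then show "int (hilb m f (N + 2)) - 2 * int (hilb m f (N + 1)) + int (hilb m f N)
        \<le> int (betti m f 0) + int (betti m f 2) - int (betti m f 1)"
      using sum_euler_ge[of m f N] by (simp add: betti_eq_sum sum.distrib sum_subtractf)
  qed
  then show ?thesis by linarith
qed

theorem theorem3p3:
  fixes m d :: nat and f :: "nat \<Rightarrow> 'a::field poly3"
  assumes m2: "m \<ge> 2"
    and d1: "d \<ge> 1"
    and hom: "\<forall>i<m. \<exists>e\<le>d. homogeneous e (f i)"
    and gcd1: "\<forall>g :: 'a poly3. (\<forall>i<m. g dvd f i) \<longrightarrow> g dvd 1"
  shows "cm_reg m f \<le> 3 * d - 2
         \<and> betti m f 1 \<le> betti m f 2 + m - 1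
         \<and> betti m f 2 \<le> hilb m f (cm_reg m f)
         \<and> hilb m f (cm_reg m f) \<le> hilb m f (3 * d - 2)
         \<and> hilb m f (3 * d - 2) \<le> (3 * d) choose 2
         \<and> ((\<forall>i<m. homogeneous d (f i) \<and> f i \<noteq> 0) \<longrightarrow> betti m f 2 \<le> m * ((2 * d) choose 2))"
proof -
  obtain e where e: "\<forall>i<m. homogeneous (e i) (f i) \<and> e i \<le> d"
    using hom by metis
  interpret coprime_forms m d e f
    by unfold_locales (use d1 e gcd1 in blast)+
  \<comment> \<open>Since \<open>d \<ge> 1\<close>, the truncated differences are exact. The second
    identity views degree 3d - 2 as generator degree d plus coefficient degree 2d - 2, which gives
    the binomial of 2d over 2.\<close>
  have d2: "3 * d - 2 + 2 = 3 * d" "d + (2 * d - 2) = 3 * d - 2" "2 * d - 2 + 2 = 2 * d" using d1 by simp_all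
  have mono: "hilb m f (cm_reg m f) \<le> hilb m f (3 * d - 2)" by (rule hilb_mono[OF cm_reg_bounds(1)])
  have "betti m f 2 \<le> m * ((2 * d) choose 2)" if "\<forall>i<m. homogeneous d (f i) \<and> f i \<noteq> 0"
  proof -
    have "hilb m f (3 * d - 2) \<le> m * ((2 * d) choose 2)"
      using hilb_le_generators[of m d f "2 * d - 2"] that unfolding d2 by blast
    then show ?thesis using betti_2_le mono by linarith
  qed
  moreover have "hilb m f (3 * d - 2) \<le> (3 * d) choose 2" using hilb_le[of m f "3 * d - 2"] unfolding d2 .
  moreover have "betti m f 1 \<le> betti m f 2 + m - 1" using betti_euler betti_0_le by linarith
  ultimately show ?thesis using cm_reg_bounds(1) betti_2_le mono by blast
qed

end
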